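(* Suppose that $L$ has the local boundedness property in $\Omega$ with constants $R_{max}\in(0,\infty]$ and $N_0>0$ (defined in the context), and let $\boldsymbol G(x,y)$ be the Green's matrix of $L$ in $\Omega$. Then $$|\boldsymbol G(x,y)|\le C|x-y|^{2-n}\quad\text{for all }x,y\in\Omega\text{ satisfying }0<|x-y|<R_{max},$$ where $C$ is a constant depending only on $n,m,\nu,N_0$.
   Context: Setting. $n\ge 3$, $m\ge 1$, and $\Omega\subset\mathbb R^n$ is a (possibly unbounded) domain. Repeated indices are summed ($\alpha,\beta$ from $1$ to $n$; $i,j$ from $1$ to $m$). The operator $L$ acts on $\mathbb R^m$-valued functions $\boldsymbol u=(u^1,\dots,u^m)^T$ by $L\boldsymbol u=-D_\alpha(\boldsymbol A^{\alpha\beta}D_\beta\boldsymbol u)$, where $\boldsymbol A^{\alpha\beta}=(A^{\alpha\beta}_{ij})$ are $m\times m$ matrix valued measurable functions on $\mathbb R^n$ such that, for some constant $\nu\in(0,1]$, $A^{\alpha\beta}_{ij}(x)\xi^j_\beta\xi^i_\alpha\ge\nu|\boldsymbol\xi|^2$ for all $\boldsymbol\xi\in\mathbb R^{mn}$, $x\in\mathbb R^n$, and $\sum_{i,j,\alpha,\beta}|A^{\alpha\beta}_{ij}(x)|^2\le\nu^{-2}$ for all $x\in\mathbb R^n$. No symmetry is assumed. The adjoint operator is ${}^tL\boldsymbol u=-D_\alpha({}^t\boldsymbol A^{\alpha\beta}D_\beta\boldsymbol u)$ with ${}^tA^{\alpha\beta}_{ij}=A^{\beta\alpha}_{ji}$.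 For an open set $U$, $\boldsymbol u$ is a weak solution of $L\boldsymbol u=\boldsymbol f$ in $U$ if $\int_U A^{\alpha\beta}_{ij}D_\beta u^jD_\alpha\phi^i=\int_U f^i\phi^i$ for all $\boldsymbol\phi\in C^\infty_c(U)^m$; similarly for ${}^tL$. Function spaces. For an open set $U\subset\mathbb R^n$, $Y^{1,2}(U)$ is the space of weakly differentiable $u\in L^{2n/(n-2)}(U)$ with $Du\in L^2(U)$, normed by $\|u\|_{L^{2n/(n-2)}(U)}+\|Du\|_{L^2(U)}$; $Y^{1,2}_0(U)$ is the closure of $C_c^\infty(U)$ in $Y^{1,2}(U)$. For $\varSigma\subset\overline U$, a function $u\in Y^{1,2}(U)$ vanishes on $\varSigma$ if it is a limit in $Y^{1,2}(U)$ of functions in $C_c^\infty(\overline U\setminus\varSigma)$. $L^\infty_c(\Omega)$ is the set of $L^\infty(\Omega)$ functions with compact support in $\overline\Omega$. $\Omega_R(x)=\Omega\cap B_R(x)$ and $\varSigma_R(x)=\partial\Omega\cap B_R(x)$. All notions are applied componentwise to vector and matrix valued functions. Green's matrix. An $m\times m$ matrix valued function $\boldsymbol G(x,y)=(G_{ij}(x,y))$ on $\{(x,y)\in\Omega\times\Omega:x\ne y\}$ is the Green's matrix of $L$ in $\Omega$ if: (i) for all $y\in\Omega$, $\boldsymbol G(\cdot,y)\in W^{1,1}_{loc}(\Omega)$ and $\int_\Omega A^{\alpha\beta}_{ij}D_\beta G_{jk}(\cdot,y)D_\alpha\phi^i=\phi^k(y)$ for all $\boldsymbol\phi\in C_c^\infty(\Omega)^m$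 and all $k$; (ii) for all $y\in\Omega$ and $r>0$, $\boldsymbol G(\cdot,y)\in Y^{1,2}(\Omega\setminus B_r(y))$, and $\boldsymbol G(\cdot,y)$ vanishes on $\partial\Omega$ (away from the pole: $(1-\zeta)\boldsymbol G(\cdot,y)\in Y^{1,2}_0(\Omega)$ whenever $\zeta\in C_c^\infty(\Omega)$ equals $1$ near $y$); (iii) for every $\boldsymbol f\in L^\infty_c(\Omega)^m$, the function $\boldsymbol u(x)=\int_\Omega\boldsymbol G(y,x)\boldsymbol f(y)\,dy$ — with components understood so that ${}^tL\boldsymbol u=\boldsymbol f$, i.e. $u^k(x)=\int_\Omega G_{ik}(y,x)f^i(y)\,dy$ — belongs to $Y^{1,2}_0(\Omega)$ and satisfies $\int_\Omega A^{\alpha\beta}_{ij}D_\alpha u^iD_\beta\phi^j=\int_\Omega f^j\phi^j$ for all $\boldsymbol\phi\in C_c^\infty(\Omega)^m$. These properties determine the Green's matrix uniquely. Since $\boldsymbol G(\cdot,y)$ is a Sobolev function, pointwise statements refer to its continuous representative on $\Omega\setminus\{y\}$ when there is one, and to a.e. $x$ otherwise. Local boundedness property with constants $R_{max}\in(0,\infty]$, $N_0>0$: for all $x\in\Omega$, $R\in(0,R_{max})$ and $\boldsymbol f\in L^\infty(\Omega_R(x))$, if $\boldsymbol u\in W^{1,2}(\Omega_R(x))$ is a weak solution of either $L\boldsymbol u=\boldsymbol f$ or ${}^tL\boldsymbol u=\boldsymbol f$ in $\Omega_R(x)$ and vanishes on $\varSigma_R(x)$, then $\|\boldsymbol u\|_{L^\infty(\Omega_{R/2}(x))}\le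 N_0\big(R^{-n/2}\|\boldsymbol u\|_{L^2(\Omega_R(x))}+R^2\|\boldsymbol f\|_{L^\infty(\Omega_R(x))}\big)$.
   Formalization: Properties (i)–(iii) fix G(·,y) only for a.e. y and the bound can fail at exceptional y; it is proved for a.e. y in Ω and for every y at which the integral formula in (iii) gives the limit of ball averages of the potentials (all y if G is continuous for x≠y). *)

theory Defs
  imports "HOL-Analysis.Analysis" "HOL-Probability.Essential_Supremum"
begin

section \<open>Smooth and test functions\<close>

definition pd :: "'n \<Rightarrow> (real^'n \<Rightarrow> real) \<Rightarrow> real^'n \<Rightarrow> real" where
  "pd \<alpha> f x = frechet_derivative f (at x) (axis \<alpha> 1)"

primrec C_k :: "nat \<Rightarrow> (real^'n \<Rightarrow> real) \<Rightarrow> bool" where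
  "C_k 0 f \<longleftrightarrow> continuous_on UNIV f"
| "C_k (Suc k) f \<longleftrightarrow> (\<forall>x. f differentiable (at x)) \<and> (\<forall>\<alpha>. C_k k (pd \<alpha> f))"

definition smooth :: "(real^'n \<Rightarrow> real) \<Rightarrow> bool" where
  "smooth f \<longleftrightarrow> (\<forall>k. C_k k f)"

text \<open>Elements of \<open>C\<^sub>c\<^sup>\<infinity>(U)\<close> are extended by zero to the whole space.\<close>

definition Cc_inf :: "(real^'n) set \<Rightarrow> (real^'n \<Rightarrow> real) set" where
  "Cc_inf U = {\<phi>. smooth \<phi> \<and> compact (closure {x. \<phi> x \<noteq> 0}) \<and> closure {x. \<phi> x \<noteq> 0} \<subseteq> U}"

text \<open>\<open>C\<^sub>c\<^sup>\<infinity>\<close> of the closure of \<open>U\<close> minus \<open>S\<close>: smooth functions on the closure of \<open>U\<close>, i.e.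
  restrictions of smooth functions on the whole space (whose values off the closure of \<open>U\<close> are
  irrelevant), the support being taken relative to the closure of \<open>U\<close>.\<close>

definition Cc_inf_closure_minus :: "(real^'n) set \<Rightarrow> (real^'n) set \<Rightarrow> (real^'n \<Rightarrow> real) set" where
  "Cc_inf_closure_minus U S =
     {\<phi>. smooth \<phi> \<and> compact (closure {x \<in> closure U. \<phi> x \<noteq> 0})
          \<and> closure {x \<in> closure U. \<phi> x \<noteq> 0} \<subseteq> closure U - S}"

section \<open>Function spaces\<close>

text \<open>Functions are total; an element of a space over \<open>U\<close> is judged by its values on \<open>U\<close> only.\<close>

definition Lp :: "real \<Rightarrow> (real^'n) set \<Rightarrow> (real^'n \<Rightarrow> 'b::euclidean_space) set" where
  "Lp p U = {u. u \<in> borel_measurable (lebesgue_on U) \<and>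
                integrable (lebesgue_on U) (\<lambda>x. norm (u x) powr p)}"

definition Lp_norm :: "real \<Rightarrow> (real^'n) set \<Rightarrow> (real^'n \<Rightarrow> 'b::euclidean_space) \<Rightarrow> real" where
  "Lp_norm p U u = (LINT x|lebesgue_on U. norm (u x) powr p) powr (1 / p)"

definition Linf :: "(real^'n) set \<Rightarrow> (real^'n \<Rightarrow> 'b::euclidean_space) set" where
  "Linf U = {u. u \<in> borel_measurable (lebesgue_on U) \<and>
                (\<exists>c. AE x in lebesgue_on U. norm (u x) \<le> c)}"

definition Linf_norm :: "(real^'n) set \<Rightarrow> (real^'n \<Rightarrow> 'b::euclidean_space) \<Rightarrow> real" where
  "Linf_norm U u = real_of_ereal (esssup (lebesgue_on U) (\<lambda>x. ereal (norm (u x))))"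

definition Linf_c :: "(real^'n) set \<Rightarrow> (real^'n \<Rightarrow> 'b::euclidean_space) set" where
  "Linf_c U = {f \<in> Linf U. \<exists>K. compact K \<and> K \<subseteq> closure U \<and>
                 (AE x in lebesgue_on U. x \<notin> K \<longrightarrow> f x = 0)}"

definition L1_loc :: "(real^'n) set \<Rightarrow> (real^'n \<Rightarrow> 'b::euclidean_space) set" where
  "L1_loc U = {u. \<forall>K. compact K \<and> K \<subseteq> U \<longrightarrow> integrable (lebesgue_on K) u}"

definition weak_gradient :: "(real^'n) set \<Rightarrow> (real^'n \<Rightarrow> real) \<Rightarrow> (real^'n \<Rightarrow> real^'n) \<Rightarrow> bool" where
  "weak_gradient U u g \<longleftrightarrow> u \<in> L1_loc U \<and> g \<in> L1_loc U \<and>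
     (\<forall>\<phi> \<in> Cc_inf U. \<forall>\<alpha>. (LINT x|lebesgue_on U. u x * pd \<alpha> \<phi> x)
                         = - (LINT x|lebesgue_on U. g x $ \<alpha> * \<phi> x))"

text \<open>For open \<open>U\<close> these are exactly the functions with a weak gradient.\<close>

definition W11_loc :: "(real^'n) set \<Rightarrow> (real^'n \<Rightarrow> real) set" where
  "W11_loc U = {u. \<exists>g. weak_gradient U u g}"

text \<open>The weak gradient is unique almost everywhere; all uses below are insensitive to the
  representative.\<close>

definition wgrad :: "(real^'n) set \<Rightarrow> (real^'n \<Rightarrow> real) \<Rightarrow> real^'n \<Rightarrow> real^'n" where
  "wgrad U u = (SOME g. weak_gradient U u g)"

definition W12 :: "(real^'n) set \<Rightarrow> (real^'n \<Rightarrow> real) set" where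
  "W12 U = {u \<in> W11_loc U. u \<in> Lp 2 U \<and> wgrad U u \<in> Lp 2 U}"

definition sobolev_exp :: "'n::finite itself \<Rightarrow> real" where
  "sobolev_exp _ = 2 * real CARD('n) / (real CARD('n) - 2)"

definition Y12 :: "(real^'n) set \<Rightarrow> (real^'n \<Rightarrow> real) set" where
  "Y12 U = {u \<in> W11_loc U. u \<in> Lp (sobolev_exp TYPE('n)) U \<and> wgrad U u \<in> Lp 2 U}"

definition Y12_norm :: "(real^'n) set \<Rightarrow> (real^'n \<Rightarrow> real) \<Rightarrow> real" where
  "Y12_norm U u = Lp_norm (sobolev_exp TYPE('n)) U u + Lp_norm 2 U (wgrad U u)"

definition Y12_limit_of :: "(real^'n) set \<Rightarrow> (real^'n \<Rightarrow> real) set \<Rightarrow> (real^'n \<Rightarrow> real) \<Rightarrow> bool" where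
  "Y12_limit_of U D u \<longleftrightarrow> u \<in> Y12 U \<and>
     (\<exists>\<phi> :: nat \<Rightarrow> real^'n \<Rightarrow> real. (\<forall>k. \<phi> k \<in> D) \<and>
        (\<lambda>k. Y12_norm U (\<lambda>x. u x - \<phi> k x)) \<longlonglongrightarrow> 0)"

definition Y12_0 :: "(real^'n) set \<Rightarrow> (real^'n \<Rightarrow> real) set" where
  "Y12_0 U = {u. Y12_limit_of U (Cc_inf U) u}"

definition vanishes_on :: "(real^'n) set \<Rightarrow> (real^'n) set \<Rightarrow> (real^'n \<Rightarrow> real) \<Rightarrow> bool" where
  "vanishes_on U S u \<longleftrightarrow> Y12_limit_of U (Cc_inf_closure_minus U S) u"

text \<open>Componentwise extension of a property of scalar functions to vector valued ones.\<close>

definition vec_all :: "((real^'n \<Rightarrow> real) \<Rightarrow> bool) \<Rightarrow> (real^'n \<Rightarrow> real^'m) \<Rightarrow> bool" where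
  "vec_all P u \<longleftrightarrow> (\<forall>i. P (\<lambda>x. u x $ i))"

section \<open>The operator\<close>

text \<open>The entry \<open>i j\<close> of the matrix with superscripts \<open>\<alpha>\<close>, \<open>\<beta>\<close> at the point \<open>x\<close> is
  \<open>A \<alpha> \<beta> x $ i $ j\<close>; a vector in the \<open>mn\<close>-dimensional space is \<open>\<xi> :: real^'n^'m\<close>, with
  \<open>\<xi> $ i $ \<alpha>\<close> the component carrying lower index \<open>\<alpha>\<close> and upper index \<open>i\<close>.\<close>

type_synonym ('n, 'm) coeffs = "'n \<Rightarrow> 'n \<Rightarrow> real^'n \<Rightarrow> real^'m^'m"

definition elliptic_coeffs :: "real \<Rightarrow> ('n::finite, 'm::finite) coeffs \<Rightarrow> bool" where
  "elliptic_coeffs \<nu> A \<longleftrightarrow>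
     (\<forall>\<alpha> \<beta>. A \<alpha> \<beta> \<in> borel_measurable lebesgue) \<and>
     (\<forall>x. \<forall>\<xi> :: real^'n^'m.
        (\<Sum>i\<in>UNIV. \<Sum>j\<in>UNIV. \<Sum>\<alpha>\<in>UNIV. \<Sum>\<beta>\<in>UNIV.
           A \<alpha> \<beta> x $ i $ j * \<xi> $ j $ \<beta> * \<xi> $ i $ \<alpha>) \<ge> \<nu> * (norm \<xi>)\<^sup>2) \<and>
     (\<forall>x. (\<Sum>i\<in>UNIV. \<Sum>j\<in>UNIV. \<Sum>\<alpha>\<in>UNIV. \<Sum>\<beta>\<in>UNIV. \<bar>A \<alpha> \<beta> x $ i $ j\<bar>\<^sup>2) \<le> 1 / \<nu>\<^sup>2)"

definition adjoint_coeffs :: "('n::finite, 'm::finite) coeffs \<Rightarrow> ('n, 'm) coeffs" where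
  "adjoint_coeffs A = (\<lambda>\<alpha> \<beta> x. transpose (A \<beta> \<alpha> x))"

definition weak_form ::
  "('n::finite, 'm::finite) coeffs \<Rightarrow> (real^'n) set \<Rightarrow> (real^'n \<Rightarrow> real^'m) \<Rightarrow> (real^'n \<Rightarrow> real^'m) \<Rightarrow> real"
where
  "weak_form A U u \<phi> =
     (LINT x|lebesgue_on U. (\<Sum>i\<in>UNIV. \<Sum>j\<in>UNIV. \<Sum>\<alpha>\<in>UNIV. \<Sum>\<beta>\<in>UNIV.
        A \<alpha> \<beta> x $ i $ j * wgrad U (\<lambda>z. u z $ j) x $ \<beta> * pd \<alpha> (\<lambda>z. \<phi> z $ i) x))"

definition weak_solution ::
  "('n::finite, 'm::finite) coeffs \<Rightarrow> (real^'n) set \<Rightarrow> (real^'n \<Rightarrow> real^'m) \<Rightarrow> (real^'n \<Rightarrow> real^'m) \<Rightarrow> bool"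
where
  "weak_solution A U u f \<longleftrightarrow>
     (\<forall>\<phi>. vec_all (\<lambda>\<psi>. \<psi> \<in> Cc_inf U) \<phi> \<longrightarrow>
        weak_form A U u \<phi> = (LINT x|lebesgue_on U. f x \<bullet> \<phi> x))"

text \<open>\<open>vanishes_on\<close> makes \<open>u\<close> an element of \<open>Y12\<close> of the bounded set \<open>\<Omega> \<inter> ball x R\<close>, on which
  \<open>Y12\<close> is contained in \<open>W12\<close>.\<close>

definition local_boundedness ::
  "('n::finite, 'm::finite) coeffs \<Rightarrow> (real^'n) set \<Rightarrow> ereal \<Rightarrow> real \<Rightarrow> bool"
where
  "local_boundedness A \<Omega> Rmax N\<^sub>0 \<longleftrightarrow>
     (\<forall>x\<in>\<Omega>. \<forall>R. 0 < R \<and> ereal R < Rmax \<longrightarrow>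
        (\<forall>(f :: real^'n \<Rightarrow> real^'m) u.
           f \<in> Linf (\<Omega> \<inter> ball x R) \<longrightarrow>
           vec_all (\<lambda>w. w \<in> W12 (\<Omega> \<inter> ball x R)) u \<longrightarrow>
           weak_solution A (\<Omega> \<inter> ball x R) u f \<or>
             weak_solution (adjoint_coeffs A) (\<Omega> \<inter> ball x R) u f \<longrightarrow>
           vec_all (vanishes_on (\<Omega> \<inter> ball x R) (frontier \<Omega> \<inter> ball x R)) u \<longrightarrow>
           u \<in> Linf (\<Omega> \<inter> ball x (R / 2)) \<and>
           Linf_norm (\<Omega> \<inter> ball x (R / 2)) u
             \<le> N\<^sub>0 * (R powr (- real CARD('n) / 2) * Lp_norm 2 (\<Omega> \<inter> ball x R) u
                     + R\<^sup>2 * Linf_norm (\<Omega> \<inter> ball x R) f)))"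

section \<open>Green's matrix\<close>

text \<open>\<open>G x y\<close> is the matrix with pole \<open>y\<close>; its diagonal values \<open>G y y\<close> are irrelevant, and
  \<open>column k (G x y)\<close> is the vector whose entry \<open>j\<close> is the entry \<open>j k\<close> of \<open>G x y\<close>.\<close>

definition green_potential ::
  "(real^'n) set \<Rightarrow> (real^'n \<Rightarrow> real^'n \<Rightarrow> real^'m^'m) \<Rightarrow> (real^'n \<Rightarrow> real^'m) \<Rightarrow> real^'n \<Rightarrow> real^'m"
where
  "green_potential \<Omega> G f x = (\<chi> k. LINT y|lebesgue_on \<Omega>. (\<Sum>i\<in>UNIV. G y x $ i $ k * f y $ i))"

text \<open>Deleting closed balls instead of open ones in the second clause keeps the set open; as all
  radii are considered, nothing changes.\<close>

definition green_matrix ::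
  "('n::finite, 'm::finite) coeffs \<Rightarrow> (real^'n) set \<Rightarrow> (real^'n \<Rightarrow> real^'n \<Rightarrow> real^'m^'m) \<Rightarrow> bool"
where
  "green_matrix A \<Omega> G \<longleftrightarrow>
     (\<forall>y\<in>\<Omega>. \<forall>k.
        vec_all (\<lambda>w. w \<in> W11_loc \<Omega>) (\<lambda>x. column k (G x y)) \<and>
        (\<forall>\<phi>. vec_all (\<lambda>\<psi>. \<psi> \<in> Cc_inf \<Omega>) \<phi> \<longrightarrow>
           weak_form A \<Omega> (\<lambda>x. column k (G x y)) \<phi> = \<phi> y $ k)) \<and>
     (\<forall>y\<in>\<Omega>. \<forall>k.
        (\<forall>r>0. vec_all (\<lambda>w. w \<in> Y12 (\<Omega> - cball y r)) (\<lambda>x. column k (G x y))) \<and>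
        (\<forall>\<zeta> \<in> Cc_inf \<Omega>. (\<exists>\<epsilon>>0. \<forall>x\<in>ball y \<epsilon>. \<zeta> x = 1) \<longrightarrow>
           vec_all (\<lambda>w. w \<in> Y12_0 \<Omega>) (\<lambda>x. (1 - \<zeta> x) *\<^sub>R column k (G x y)))) \<and>
     (\<forall>f \<in> Linf_c \<Omega>.
        vec_all (\<lambda>w. w \<in> Y12_0 \<Omega>) (green_potential \<Omega> G f) \<and>
        weak_solution (adjoint_coeffs A) \<Omega> (green_potential \<Omega> G f) f)"

text \<open>The third clause above concerns potentials as Sobolev functions, so it determines
  \<open>G(\<cdot>,y)\<close> only for almost every pole \<open>y\<close>. The first two clauses do not determine it for an
  individual \<open>y\<close>: for suitable coefficients that are discontinuous at \<open>y\<close> there are (Serrin) nonzero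
  solutions of \<open>L v = 0\<close> in \<open>W11_loc \<Omega>\<close> that grow faster than \<open>|x - y|\<close> to the power \<open>2 - n\<close> at
  \<open>y\<close> and vanish on the boundary, and they can be added to \<open>G(\<cdot>,y)\<close>. A pole is precise if the
  integral formula for the potentials produces their precise (Lebesgue) value there. It suffices
  to look at densities supported in \<open>\<Omega>\<close> away from the pole; if \<open>G\<close> is jointly continuous off the
  diagonal then every pole is precise.\<close>

definition precise_pole ::
  "(real^'n) set \<Rightarrow> (real^'n \<Rightarrow> real^'n \<Rightarrow> real^'m^'m) \<Rightarrow> real^'n \<Rightarrow> bool"
where
  "precise_pole \<Omega> G y \<longleftrightarrow>
     (\<forall>f \<in> Linf \<Omega>. (\<exists>K. compact K \<and> K \<subseteq> \<Omega> - {y} \<and> (\<forall>x. x \<notin> K \<longrightarrow> f x = 0)) \<longrightarrow>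
        ((\<lambda>r. (1 / measure lebesgue (ball y r)) *\<^sub>R
                (LINT z|lebesgue_on (ball y r). green_potential \<Omega> G f z))
           \<longlongrightarrow> green_potential \<Omega> G f y) (at_right 0))"

text \<open>Pointwise statements about a Sobolev function \<open>g\<close> on \<open>U\<close>: they hold almost everywhere, and
  everywhere for the continuous representative if there is one.\<close>

definition holds_pointwise ::
  "(real^'n) set \<Rightarrow> (real^'n \<Rightarrow> 'b::euclidean_space) \<Rightarrow> (real^'n \<Rightarrow> 'b \<Rightarrow> bool) \<Rightarrow> bool"
where
  "holds_pointwise U g P \<longleftrightarrow>
     (AE x in lebesgue_on U. P x (g x)) \<and>
     (\<forall>h. continuous_on U h \<longrightarrow> (AE x in lebesgue_on U. h x = g x) \<longrightarrow> (\<forall>x\<in>U. P x (h x)))"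

definition green_bound_at ::
  "(real^'n) set \<Rightarrow> (real^'n \<Rightarrow> real^'n \<Rightarrow> real^'m^'m) \<Rightarrow> ereal \<Rightarrow> real \<Rightarrow> real^'n \<Rightarrow> bool"
where
  "green_bound_at \<Omega> G Rmax C y \<longleftrightarrow>
     holds_pointwise (\<Omega> - {y}) (\<lambda>x. G x y)
       (\<lambda>x M. 0 < norm (x - y) \<and> ereal (norm (x - y)) < Rmax \<longrightarrow>
              norm M \<le> C * norm (x - y) powr (2 - real CARD('n)))"

end

theory Submission
  imports Defs
begin

text \<open>
  Let \<open>x \<noteq> y\<close> be points of \<open>\<Omega>\<close> with \<open>|x - y| < Rmax\<close>, and let \<open>r = |x - y| / 2\<close>, so that the balls of
  radius \<open>r\<close> around \<open>x\<close> and \<open>y\<close> are disjoint. Let \<open>f\<close> be a density carried by the part of the ball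
  around \<open>x\<close> inside \<open>\<Omega>\<close>. Its potential \<open>u\<close> solves the adjoint equation with right-hand side \<open>f\<close>.
  For \<open>n \<ge> 3\<close> the Hardy inequality bounds the \<open>L\<^sup>2\<close> norm of a function in \<open>Y12_0 \<Omega>\<close> over a ball of
  radius \<open>r\<close> by \<open>C r\<close> times the \<open>L\<^sup>2\<close> norm of its gradient. On the ball around \<open>x\<close> this turns the
  energy identity into \<open>\<parallel>Du\<parallel> \<le> C r \<parallel>f\<parallel>\<close>, and on the ball around \<open>y\<close> it then yields an
  \<open>L\<^sup>2\<close> bound \<open>C r\<^sup>2 \<parallel>f\<parallel>\<close> for \<open>u\<close>. There \<open>u\<close> solves the homogeneous adjoint equation, so local
  boundedness gives \<open>|u| \<le> C r\<^bsup>2 - n/2\<^esup> \<parallel>f\<parallel>\<close> almost everywhere near \<open>y\<close>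
  (\<open>potential_local_bound\<close>).

  Suppose that this holds at the point \<open>y\<close> as well. Since \<open>u(y)\<close> is the integral of \<open>G(\<cdot>,y)\<close>
  against \<open>f\<close>, duality bounds the \<open>L\<^sup>2\<close> norm of \<open>G(\<cdot>,y)\<close> on the ball around \<open>x\<close> by
  \<open>C r\<^bsup>2 - n/2\<^esup>\<close>. On that ball \<open>G(\<cdot>,y)\<close> solves the homogeneous equation, and a second application
  of local boundedness gives \<open>|G(\<cdot>,y)| \<le> C r\<^bsup>2 - n\<^esup>\<close> almost everywhere near \<open>x\<close>
  (\<open>green_matrix_local_bound\<close>). As \<open>x\<close> varies, countably many such neighbourhoods cover all points
  in question; a continuous representative inherits the bound everywhere.

  It remains to pass from almost every point near \<open>y\<close> to \<open>y\<close> itself. At a precise pole the value of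
  a potential is the limit of its averages, which obey the same bound. In general the exceptional
  set of poles must be null and must not depend on \<open>f\<close>. Therefore \<open>f\<close> only ranges over a countable
  family, the rational step functions over finite unions of rational boxes; they are dense in
  \<open>L\<^sup>2\<close> (\<open>step_functions_dense_in_L2\<close>), which suffices for the duality argument.

  Local boundedness speaks of functions on \<open>\<Omega>\<close> intersected with a ball and of their weak gradients
  there. These agree almost everywhere with the gradients on \<open>\<Omega>\<close> because weak gradients are unique
  (\<open>weak_gradient_unique\<close>), a consequence of the fundamental lemma of the calculus of variations.
\<close>

section \<open>Smooth functions\<close>

definition grad :: "(real^'n \<Rightarrow> real) \<Rightarrow> real^'n \<Rightarrow> real^'n" where
  "grad f x = (\<chi> \<alpha>. pd \<alpha> f x)"

lemma grad_nth [simp]: "grad f x $ \<alpha> = pd \<alpha> f x"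
  by (simp add: grad_def)

lemma pd_eqI: "(f has_derivative f') (at x) \<Longrightarrow> pd \<alpha> f x = f' (axis \<alpha> 1)"
  unfolding pd_def by (simp add: frechet_derivative_at[symmetric])

lemma has_derivative_pd:
  "f differentiable (at x) \<Longrightarrow> (f has_derivative frechet_derivative f (at x)) (at x)"
  by (simp add: frechet_derivative_works)

lemma pd_const [simp]: "pd \<alpha> (\<lambda>x. c) = (\<lambda>x. 0)"
  by (rule ext, subst pd_eqI[of _ "\<lambda>_. 0"]) auto

lemma pd_add:
  "f differentiable (at x) \<Longrightarrow> g differentiable (at x) \<Longrightarrow>
    pd \<alpha> (\<lambda>x. f x + g x) x = pd \<alpha> f x + pd \<alpha> g x"
  by (subst pd_eqI[OF has_derivative_add[OF has_derivative_pd has_derivative_pd]])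
    (auto simp: pd_def)

lemma pd_mult:
  "f differentiable (at x) \<Longrightarrow> g differentiable (at x) \<Longrightarrow>
    pd \<alpha> (\<lambda>x. f x * g x) x = f x * pd \<alpha> g x + pd \<alpha> f x * g x"
  by (subst pd_eqI[OF has_derivative_mult[OF has_derivative_pd has_derivative_pd]])
    (auto simp: pd_def)

lemma pd_comp:
  assumes "(g has_real_derivative g') (at (f x))" "f differentiable (at x)"
  shows "pd \<alpha> (\<lambda>x. g (f x)) x = g' * pd \<alpha> f x"
  using pd_eqI[OF has_derivative_compose[OF has_derivative_pd[OF assms(2)]
      assms(1)[unfolded has_field_derivative_def]], of \<alpha>]
  by (simp add: pd_def)

lemma pd_component: "pd \<alpha> (\<lambda>x. x $ i) = (\<lambda>x. axis \<alpha> 1 $ i)"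
  by (rule ext, subst pd_eqI[OF bounded_linear_imp_has_derivative]) (auto intro: bounded_linear_vec_nth)

lemma C_k_Suc_D: "C_k (Suc k) f \<Longrightarrow> C_k k f"
proof (induction k arbitrary: f)
  case 0
  then show ?case
    by (auto simp: continuous_on_eq_continuous_at differentiable_imp_continuous_within)
next
  case (Suc k)
  then show ?case by (metis C_k.simps(2))
qed

lemma C_k_const: "C_k k (\<lambda>x. c)"
  by (induction k arbitrary: c) auto

lemma C_k_component: "C_k k (\<lambda>x. x $ i)"
proof (cases k)
  case (Suc j)
  have "(\<lambda>x::real^'a. x $ i) differentiable (at x)" for x
    using bounded_linear_imp_differentiable bounded_linear_vec_nth by blast
  with Suc show ?thesis by (auto simp: C_k_const pd_component)
qed (auto intro!: continuous_intros)

lemma C_k_add: "C_k k f \<Longrightarrow> C_k k g \<Longrightarrow> C_k k (\<lambda>x. f x + g x)"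
proof (induction k arbitrary: f g)
  case (Suc k)
  then have "pd \<alpha> (\<lambda>x. f x + g x) = (\<lambda>x. pd \<alpha> f x + pd \<alpha> g x)" for \<alpha>
    by (auto simp: pd_add)
  with Suc show ?case by auto
qed (auto intro: continuous_intros)

lemma C_k_mult: "C_k k f \<Longrightarrow> C_k k g \<Longrightarrow> C_k k (\<lambda>x. f x * g x)"
proof (induction k arbitrary: f g)
  case (Suc k)
  then have "pd \<alpha> (\<lambda>x. f x * g x) = (\<lambda>x. f x * pd \<alpha> g x + pd \<alpha> f x * g x)" for \<alpha>
    by (auto simp: pd_mult)
  with Suc show ?case
    by (auto intro!: C_k_add dest: C_k_Suc_D[of k f] C_k_Suc_D[of k g])
      (metis C_k.simps(2) C_k_Suc_D)+
qed (auto intro: continuous_intros)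

text \<open>The sequence \<open>g\<close> consists of a function and all its successive derivatives, and the claim is
  general in \<open>j\<close> because differentiating \<open>g j \<circ> f\<close> produces \<open>g (Suc j) \<circ> f\<close>.\<close>

lemma C_k_comp:
  assumes "\<And>j t. (g j has_real_derivative g (Suc j) t) (at t)"
  shows "C_k k f \<Longrightarrow> C_k k (\<lambda>x. g j (f x))"
proof (induction k arbitrary: j)
  case 0
  have "continuous_on UNIV (g j)"
    using assms by (meson DERIV_isCont continuous_at_imp_continuous_on)
  with 0 show ?case
    using continuous_on_compose2[of UNIV "g j" UNIV f] by auto
next
  case (Suc k)
  have *: "pd \<alpha> (\<lambda>x. g j (f x)) = (\<lambda>x. g (Suc j) (f x) * pd \<alpha> f x)" for \<alpha>
    using Suc.prems by (auto intro!: pd_comp assms)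
  have "(\<lambda>x. g j (f x)) differentiable (at x)" for x
    using differentiable_compose[of "g j" f x UNIV] Suc.prems assms
    by (auto simp: differentiable_def has_field_derivative_def)
  then show ?case
    using Suc.IH[OF C_k_Suc_D[OF Suc.prems]] Suc.prems by (auto simp: * intro!: C_k_mult)
qed

lemma smooth_const: "smooth (\<lambda>x. c)"
  and smooth_component: "smooth (\<lambda>x. x $ i)"
  and smooth_add: "smooth f \<Longrightarrow> smooth g \<Longrightarrow> smooth (\<lambda>x. f x + g x)"
  and smooth_mult: "smooth f \<Longrightarrow> smooth g \<Longrightarrow> smooth (\<lambda>x. f x * g x)"
  by (auto simp: smooth_def C_k_const C_k_component C_k_add C_k_mult)

lemma smooth_diff: "smooth f \<Longrightarrow> smooth g \<Longrightarrow> smooth (\<lambda>x. f x - g x)"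
  using smooth_add[of f "\<lambda>x. (-1) * g x"] smooth_mult[OF smooth_const[of "-1"], of g] by simp

lemma smooth_sum: "(\<And>i. i \<in> I \<Longrightarrow> smooth (f i)) \<Longrightarrow> smooth (\<lambda>x. \<Sum>i\<in>I. f i x)"
  by (induction I rule: infinite_finite_induct) (auto intro: smooth_const smooth_add)

lemma smooth_prod: "(\<And>i. i \<in> I \<Longrightarrow> smooth (f i)) \<Longrightarrow> smooth (\<lambda>x. \<Prod>i\<in>I. f i x)"
  by (induction I rule: infinite_finite_induct) (auto intro: smooth_const smooth_mult)

lemma smooth_differentiable: "smooth f \<Longrightarrow> f differentiable (at x)"
  unfolding smooth_def by (metis C_k.simps(2))

lemma smooth_pd: "smooth f \<Longrightarrow> smooth (pd \<alpha> f)"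
  unfolding smooth_def by (metis C_k.simps(2))

lemma smooth_continuous: "smooth f \<Longrightarrow> continuous_on S f"
  unfolding smooth_def by (metis C_k.simps(1) continuous_on_subset subset_UNIV)

text \<open>Products of a polynomial in \<open>1 / t\<close> with \<open>exp (- 1 / t)\<close>, extended by zero. This class is
  closed under differentiation, also at the origin, and so all of its members are smooth.\<close>

definition flat :: "real poly \<Rightarrow> real \<Rightarrow> real" where
  "flat P t = (if t \<le> 0 then 0 else poly P (inverse t) * exp (- inverse t))"

lemma poly_times_exp_minus_tendsto_0: "((\<lambda>s. poly P s * exp (- s)) \<longlongrightarrow> (0::real)) at_top"
proof -
  have "((\<lambda>s. coeff P i * (s ^ i / exp s)) \<longlongrightarrow> 0) at_top" for i
    using tendsto_mult_right_zero[OF tendsto_power_div_exp_0] .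
  then have "((\<lambda>s. \<Sum>i\<le>degree P. coeff P i * (s ^ i / exp s)) \<longlongrightarrow> (\<Sum>i\<le>degree P. 0)) at_top"
    by (intro tendsto_sum)
  moreover have "poly P s * exp (- s) = (\<Sum>i\<le>degree P. coeff P i * (s ^ i / exp s))" for s
    by (simp add: poly_altdef sum_distrib_right exp_minus divide_inverse mult.assoc)
  ultimately show ?thesis by simp
qed

lemma flat_tendsto_0: "(flat P \<longlongrightarrow> 0) (at 0)"
proof -
  have "((\<lambda>t. poly P (inverse t) * exp (- inverse t)) \<longlongrightarrow> 0) (at_right 0)"
    by (rule filterlim_compose[OF poly_times_exp_minus_tendsto_0 filterlim_inverse_at_top_right])
  then have "(flat P \<longlongrightarrow> 0) (at_right 0)"
    by (rule Lim_transform_eventually) (auto simp: flat_def eventually_at_filter)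
  moreover have "(flat P \<longlongrightarrow> 0) (at_left 0)"
    by (rule tendsto_eventually) (auto simp: flat_def eventually_at_filter)
  ultimately show ?thesis
    by (simp add: filterlim_at_split)
qed

lemma DERIV_flat: "(flat P has_real_derivative flat ([:0, 0, 1:] * (P - pderiv P)) t) (at t)"
proof -
  consider "t < 0" | "t = 0" | "t > 0" by linarith
  then show ?thesis
  proof cases
    case 1
    have "((\<lambda>_. 0) has_real_derivative flat ([:0, 0, 1:] * (P - pderiv P)) t) (at t)"
      using 1 by (auto simp: flat_def)
    then show ?thesis
      by (rule has_field_derivative_transform_within_open[of _ _ _ "{..<0}"])
        (use 1 in \<open>auto simp: flat_def\<close>)
  next
    case 2
    have "((\<lambda>h. (flat P (0 + h) - flat P 0) / h) \<longlongrightarrow> 0) (at 0)"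
      by (rule Lim_transform_eventually[OF flat_tendsto_0[of "[:0, 1:] * P"]])
        (auto simp: flat_def divide_inverse eventually_at_filter)
    then have "(flat P has_real_derivative 0) (at 0)"
      by (simp add: DERIV_def)
    with 2 show ?thesis by (simp add: flat_def)
  next
    case 3
    have "((\<lambda>t. poly P (inverse t) * exp (- inverse t)) has_real_derivative
        flat ([:0, 0, 1:] * (P - pderiv P)) t) (at t)"
      using 3 by (auto intro!: derivative_eq_intros poly_DERIV[THEN DERIV_chain2]
        simp: flat_def algebra_simps power2_eq_square)
    then show ?thesis
      by (rule has_field_derivative_transform_within_open[of _ _ _ "{0<..}"])
        (use 3 in \<open>auto simp: flat_def\<close>)
  qed
qed

lemma smooth_flat_comp:
  assumes "smooth f"
  shows "smooth (\<lambda>x. flat P (f x))"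
proof -
  define g where "g j = flat (((\<lambda>Q. [:0, 0, 1:] * (Q - pderiv Q)) ^^ j) P)" for j
  have "(g j has_real_derivative g (Suc j) t) (at t)" for j t
    unfolding g_def by (simp only: funpow.simps o_def) (rule DERIV_flat)
  from C_k_comp[of g, OF this, of _ f 0] assms show ?thesis
    by (auto simp: smooth_def g_def)
qed

definition hump :: "real \<Rightarrow> real" where "hump = flat 1"

lemma hump_eq: "hump t = (if t \<le> 0 then 0 else exp (- inverse t))"
  by (simp add: hump_def flat_def)

lemma hump_bounds: "0 \<le> hump t" "hump t \<le> 1"
  by (auto simp: hump_eq)

lemma smooth_hump_comp: "smooth f \<Longrightarrow> smooth (\<lambda>x. hump (f x))"
  unfolding hump_def by (rule smooth_flat_comp)

lemma smooth_dist_sq: "smooth (\<lambda>x. (norm (x - c))\<^sup>2)"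
proof -
  have "(norm (x - c))\<^sup>2 = (\<Sum>i\<in>UNIV. (x $ i - c $ i) * (x $ i - c $ i))" for x
    by (simp add: power2_norm_eq_inner inner_vec_def)
  then show ?thesis
    by (auto intro!: smooth_sum smooth_mult smooth_diff smooth_component smooth_const)
qed

lemma pd_zero_if_locally_zero:
  assumes "x \<notin> closure {x. f x \<noteq> 0}"
  shows "pd \<alpha> f x = 0"
proof -
  have "(f has_derivative (\<lambda>_. 0)) (at x)"
  proof (rule has_derivative_transform_within_open[of "\<lambda>_. 0" _ _ _ "- closure {x. f x \<noteq> 0}"])
    show "0 = f y" if "y \<in> - closure {x. f x \<noteq> 0}" for y
      using that closure_subset[of "{x. f x \<noteq> 0}"] by auto
  qed (use assms in auto)
  then show ?thesis by (rule pd_eqI)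
qed

lemma not_in_closure_support: "x \<notin> closure {x. f x \<noteq> 0} \<Longrightarrow> f x = 0"
  using closure_subset[of "{x. f x \<noteq> 0}"] by auto

lemma Cc_infD:
  assumes "\<phi> \<in> Cc_inf U"
  shows "smooth \<phi>" "compact (closure {x. \<phi> x \<noteq> 0})" "closure {x. \<phi> x \<noteq> 0} \<subseteq> U"
  using assms by (auto simp: Cc_inf_def)

lemma Cc_inf_mono: "\<phi> \<in> Cc_inf U \<Longrightarrow> U \<subseteq> V \<Longrightarrow> \<phi> \<in> Cc_inf V"
  by (auto simp: Cc_inf_def)

lemma Cc_infI:
  assumes "smooth \<phi>" "compact K" "K \<subseteq> U" "\<And>x. x \<notin> K \<Longrightarrow> \<phi> x = 0"
  shows "\<phi> \<in> Cc_inf U"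
proof -
  have "closure {x. \<phi> x \<noteq> 0} \<subseteq> K"
    using assms by (intro closure_minimal compact_imp_closed) auto
  with assms show ?thesis
    using compact_imp_bounded[of K] bounded_subset[of K "{x. \<phi> x \<noteq> 0}"]
    by (auto simp: Cc_inf_def)
qed

lemma Cc_inf_zero: "(\<lambda>x. 0) \<in> Cc_inf U"
  by (rule Cc_infI[where K = "{}"]) (auto intro: smooth_const)

lemma Cc_inf_eq_0: "\<phi> \<in> Cc_inf U \<Longrightarrow> x \<notin> U \<Longrightarrow> \<phi> x = 0"
  using closure_subset[of "{x. \<phi> x \<noteq> 0}"] by (auto dest: Cc_infD(3))

lemma Cc_inf_pd_eq_0: "\<phi> \<in> Cc_inf U \<Longrightarrow> x \<notin> U \<Longrightarrow> pd \<alpha> \<phi> x = 0"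
  by (rule pd_zero_if_locally_zero) (auto dest: Cc_infD(3))

lemma Cc_inf_pd:
  assumes "\<phi> \<in> Cc_inf U"
  shows "pd \<alpha> \<phi> \<in> Cc_inf U"
  using smooth_pd[OF Cc_infD(1)[OF assms]] Cc_infD(2,3)[OF assms] pd_zero_if_locally_zero
  by (rule Cc_infI)

lemma Cc_inf_mult:
  assumes "\<phi> \<in> Cc_inf U" "smooth f"
  shows "(\<lambda>x. f x * \<phi> x) \<in> Cc_inf U"
proof (rule Cc_infI[OF smooth_mult Cc_infD(2,3)[OF assms(1)]])
  show "f x * \<phi> x = 0" if "x \<notin> closure {x. \<phi> x \<noteq> 0}" for x
    using not_in_closure_support[OF that] by simp
qed (rule assms(2) Cc_infD(1)[OF assms(1)])+

text \<open>Applying the flat function twice turns the bump \<open>hump (\<rho>\<^sup>2 - |x - y|\<^sup>2)\<close> into a plateau: the inner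
  bump exceeds the threshold \<open>t\<^sub>0\<close> near \<open>y\<close>, and there the outer function vanishes identically.\<close>

lemma cutoff_exists:
  fixes y :: "real^'n"
  assumes "0 < \<rho>" "cball y \<rho> \<subseteq> U"
  obtains \<zeta> \<epsilon> where "\<zeta> \<in> Cc_inf U" "0 < \<epsilon>" "\<And>x. x \<in> ball y \<epsilon> \<Longrightarrow> \<zeta> x = 1"
    "\<And>x. x \<notin> cball y \<rho> \<Longrightarrow> \<zeta> x = 0"
proof
  define t\<^sub>0 where "t\<^sub>0 = hump (\<rho>\<^sup>2 / 2)"
  define s where "s x = \<rho>\<^sup>2 - (norm (x - y))\<^sup>2" for x
  define \<zeta> where "\<zeta> x = 1 - inverse (hump t\<^sub>0) * hump (t\<^sub>0 - hump (s x))" for x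
  have t0: "t\<^sub>0 > 0" "hump t\<^sub>0 > 0"
    using assms by (auto simp: t\<^sub>0_def hump_eq)
  show z: "\<zeta> x = 0" if "x \<notin> cball y \<rho>" for x
  proof -
    have "\<rho> < norm (x - y)" using that by (auto simp: dist_norm norm_minus_commute)
    then have "s x \<le> 0"
      unfolding s_def using assms(1) power_strict_mono[of \<rho> "norm (x - y)" 2] by simp
    then show ?thesis using t0 by (simp add: \<zeta>_def hump_eq[of "s x"])
  qed
  have "smooth \<zeta>"
    unfolding \<zeta>_def s_def
    by (intro smooth_diff smooth_mult smooth_hump_comp smooth_const smooth_dist_sq)
  then show "\<zeta> \<in> Cc_inf U"
    by (rule Cc_infI[where K = "cball y \<rho>"]) (use assms z in auto)
  show "0 < \<rho> / 2" using assms by simp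
  show "\<zeta> x = 1" if "x \<in> ball y (\<rho> / 2)" for x
  proof -
    have "norm (x - y) < \<rho> / 2" using that by (auto simp: dist_norm norm_minus_commute)
    then have "(norm (x - y))\<^sup>2 \<le> (\<rho> / 2)\<^sup>2"
      by (intro power_mono) auto
    moreover have "(\<rho> / 2)\<^sup>2 = \<rho>\<^sup>2 / 4" by (simp add: power_divide)
    ultimately have *: "\<rho>\<^sup>2 / 2 \<le> s x"
      using zero_le_power2[of \<rho>] unfolding s_def by linarith
    have "0 < \<rho>\<^sup>2" using assms by simp
    moreover from * this have "0 < s x" by linarith
    ultimately have "t\<^sub>0 \<le> hump (s x)"
      using * le_imp_inverse_le[OF *] by (auto simp: t\<^sub>0_def hump_eq)
    then show ?thesis by (simp add: \<zeta>_def hump_eq[of "t\<^sub>0 - hump (s x)"])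
  qed
qed

text \<open>An open set is a countable union of balls, and \<open>1 - \<Prod>(1 - \<psi>)\<close> over bumps \<open>\<psi>\<close> of finitely many
  of these balls vanishes off their union and tends to \<open>1\<close> on it.\<close>

lemma smooth_approximation_of_open_set:
  fixes W :: "(real^'n) set"
  assumes "open W"
  obtains \<psi> where "\<And>k. \<psi> k \<in> Cc_inf W" "\<And>k x. 0 \<le> \<psi> k x" "\<And>k x. \<psi> k x \<le> 1"
    "\<And>x. (\<lambda>k. \<psi> k x) \<longlonglongrightarrow> indicator W x"
proof -
  define I where "I = {(c::real^'n, \<rho>::real). 0 < \<rho> \<and> cball c \<rho> \<subseteq> W}"
  have W: "W = (\<Union>p\<in>I. ball (fst p) (snd p))"
  proof safe
    fix x assume "x \<in> W"
    then obtain e where "0 < e" "cball x e \<subseteq> W" using assms open_contains_cball by blast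
    then show "x \<in> (\<Union>p\<in>I. ball (fst p) (snd p))" by (auto simp: I_def intro!: exI[of _ x] exI[of _ e])
  qed (auto simp: I_def intro: ball_subset_cball[THEN subsetD])
  obtain J where J: "J \<subseteq> I" "countable J" "W = (\<Union>p\<in>J. ball (fst p) (snd p))"
  proof -
    obtain F where F: "F \<subseteq> (\<lambda>p. ball (fst p) (snd p)) ` I" "countable F" "\<Union>F = W"
    proof -
      have "open S" if "S \<in> (\<lambda>p. ball (fst p) (snd p)) ` I" for S
        using that by (elim imageE) simp
      then obtain F where F: "F \<subseteq> (\<lambda>p. ball (fst p) (snd p)) ` I" "countable F"
          "\<Union>F = \<Union> ((\<lambda>p. ball (fst p) (snd p)) ` I)"
        by (rule Lindelof)
      show ?thesis by (rule that[OF F(1,2)]) (simp only: F(3) W[symmetric])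
    qed
    obtain J where "countable J" "J \<subseteq> I" "F = (\<lambda>p. ball (fst p) (snd p)) ` J"
      using F(1,2) countable_subset_image[of F "\<lambda>p. ball (fst p) (snd p)" I] by blast
    with F(3) show ?thesis by (intro that[of J]) auto
  qed
  show ?thesis
  proof (cases "J = {}")
    case True
    then have "W = {}" using J by auto
    then show ?thesis
      by (intro that[of "\<lambda>_ _. 0"]) (auto intro: Cc_inf_zero)
  next
    case False
    define e where "e = from_nat_into J"
    have e: "e j \<in> J" for j using False by (auto simp: e_def from_nat_into)
    have eI: "0 < snd (e j)" "cball (fst (e j)) (snd (e j)) \<subseteq> W" for j
      using subsetD[OF J(1) e[of j]] by (simp_all add: I_def case_prod_beta)
    define s where "s j x = (snd (e j))\<^sup>2 - (norm (x - fst (e j)))\<^sup>2" for j x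
    define \<psi> where "\<psi> k x = 1 - (\<Prod>j<k. 1 - hump (real k * s j x))" for k x
    have fac: "0 \<le> 1 - hump t" "1 - hump t \<le> 1" for t using hump_bounds[of t] by auto
    have s_pos: "0 < s j x \<longleftrightarrow> x \<in> ball (fst (e j)) (snd (e j))" for j x
    proof -
      have "0 < s j x \<longleftrightarrow> norm (x - fst (e j)) < snd (e j)"
        using abs_le_square_iff[of "snd (e j)" "norm (x - fst (e j))"] eI(1)[of j]
        unfolding s_def by (smt (verit) norm_ge_zero)
      then show ?thesis by (simp add: dist_norm norm_minus_commute)
    qed
    have zero: "\<psi> k x = 0" if out: "x \<notin> (\<Union>j<k. cball (fst (e j)) (snd (e j)))" for k x
    proof -
      have "s j x \<le> 0" if "j < k" for j
      proof -
        have "x \<notin> ball (fst (e j)) (snd (e j))"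
          using that out ball_subset_cball by blast
        then show ?thesis using s_pos[of j x] by linarith
      qed
      then have "hump (real k * s j x) = 0" if "j < k" for j
        using that by (simp add: hump_eq mult_nonneg_nonpos)
      then show ?thesis by (simp add: \<psi>_def)
    qed
    show ?thesis
    proof (rule that[of \<psi>])
      show "\<psi> k \<in> Cc_inf W" for k
      proof (rule Cc_infI[where K = "\<Union>j<k. cball (fst (e j)) (snd (e j))"])
        show "smooth (\<psi> k)" unfolding \<psi>_def s_def
          by (intro smooth_diff smooth_prod smooth_mult smooth_hump_comp smooth_const smooth_dist_sq)
      qed (use eI zero in auto)
      show bounds: "0 \<le> \<psi> k x" "\<psi> k x \<le> 1" for k x
        using prod_le_1[of "{..<k}" "\<lambda>j. 1 - hump (real k * s j x)"]
          prod_nonneg[of "{..<k}" "\<lambda>j. 1 - hump (real k * s j x)"] fac by (auto simp: \<psi>_def)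
      fix x
      show "(\<lambda>k. \<psi> k x) \<longlonglongrightarrow> indicator W x"
      proof (cases "x \<in> W")
        case True
        then obtain p where "p \<in> J" "x \<in> ball (fst p) (snd p)" using J(3) by auto
        then obtain i where i: "x \<in> ball (fst (e i)) (snd (e i))"
          using from_nat_into_surj[OF J(2)] unfolding e_def by metis
        then have si: "0 < s i x" using s_pos by simp
        have "((\<lambda>k. 1 - exp (- (inverse (s i x) * inverse (real k)))) \<longlonglongrightarrow> 1 - exp (- (inverse (s i x) * 0)))"
          by (intro tendsto_intros tendsto_inverse_0_at_top filterlim_real_sequentially)
        then have lim: "((\<lambda>k. 1 - exp (- (inverse (s i x) * inverse (real k)))) \<longlonglongrightarrow> 0)" by simp
        have ev: "\<forall>\<^sub>F k in sequentially. 1 - \<psi> k x \<le> 1 - exp (- (inverse (s i x) * inverse (real k)))"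
        proof (rule eventually_sequentiallyI[of "Suc i"])
          fix k assume k: "Suc i \<le> k"
          have "1 - \<psi> k x = (1 - hump (real k * s i x)) * (\<Prod>j\<in>{..<k}-{i}. 1 - hump (real k * s j x))"
            using k prod.remove[of "{..<k}" i "\<lambda>j. 1 - hump (real k * s j x)"]
            by (simp add: \<psi>_def)
          also have "\<dots> \<le> (1 - hump (real k * s i x)) * 1"
            using fac by (intro mult_left_mono prod_le_1) auto
          also have "hump (real k * s i x) = exp (- (inverse (s i x) * inverse (real k)))"
          proof -
            have "\<not> real k * s i x \<le> 0"
              using mult_pos_pos[OF _ si, of "real k"] k by linarith
            then show ?thesis by (simp only: hump_eq if_False inverse_mult_distrib mult.commute)
          qed
          finally show "1 - \<psi> k x \<le> 1 - exp (- (inverse (s i x) * inverse (real k)))"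
            by simp
        qed
        have "(\<lambda>k. 1 - \<psi> k x) \<longlonglongrightarrow> 0"
          by (rule tendsto_sandwich[OF _ ev tendsto_const lim])
            (simp add: bounds)
        from tendsto_diff[OF tendsto_const[of 1] this] True show ?thesis by simp
      next
        case False
        then have "\<psi> k x = 0" for k using eI(2) by (intro zero) blast
        with False show ?thesis by simp
      qed
    qed
  qed
qed

section \<open>Integrals over subsets\<close>

lemma open_sets_lebesgue: "open U \<Longrightarrow> U \<in> sets lebesgue"
  by (simp add: borel_open)

lemma integral_lebesgue_on_eq:
  fixes f :: "real^'n \<Rightarrow> 'b::{banach, second_countable_topology}"
  assumes "U \<in> sets lebesgue" "\<And>x. x \<notin> U \<Longrightarrow> f x = 0"
  shows "(LINT x|lebesgue_on U. f x) = (LINT x|lebesgue. f x)"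
  using assms by (subst integral_restrict_space) (auto intro!: Bochner_Integration.integral_cong simp: indicator_def)

lemma integrable_lebesgue_on_eq:
  fixes f :: "real^'n \<Rightarrow> 'b::{banach, second_countable_topology}"
  assumes "U \<in> sets lebesgue" "\<And>x. x \<notin> U \<Longrightarrow> f x = 0"
  shows "integrable (lebesgue_on U) f \<longleftrightarrow> integrable lebesgue f"
  using assms by (subst integrable_restrict_space)
    (auto intro!: Bochner_Integration.integrable_cong simp: indicator_def)

lemma integrable_lebesgue_on_subset:
  fixes f :: "real^'n \<Rightarrow> 'b::{banach, second_countable_topology}"
  assumes "integrable (lebesgue_on V) f" "U \<subseteq> V" "U \<in> sets lebesgue" "V \<in> sets lebesgue"
  shows "integrable (lebesgue_on U) f"
proof -
  have "integrable lebesgue (\<lambda>x. indicator V x *\<^sub>R f x)"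
    using assms(1,4) by (simp add: integrable_restrict_space)
  with assms(3) have "integrable lebesgue (\<lambda>x. indicator U x *\<^sub>R (indicator V x *\<^sub>R f x))"
    by (rule integrable_mult_indicator)
  moreover have "(\<lambda>x. indicator U x *\<^sub>R (indicator V x *\<^sub>R f x)) = (\<lambda>x. indicator U x *\<^sub>R f x)"
    using assms(2) by (auto simp: fun_eq_iff indicator_def)
  ultimately show ?thesis using assms by (simp add: integrable_restrict_space)
qed

lemma integral_lebesgue_on_mono_set:
  fixes f :: "real^'n \<Rightarrow> real"
  assumes "integrable (lebesgue_on V) f" "U \<subseteq> V" "U \<in> sets lebesgue" "V \<in> sets lebesgue"
    and "\<And>x. x \<in> V \<Longrightarrow> 0 \<le> f x"
  shows "(LINT x|lebesgue_on U. f x) \<le> (LINT x|lebesgue_on V. f x)"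
proof -
  have "integrable lebesgue (\<lambda>x. indicator U x *\<^sub>R f x)" "integrable lebesgue (\<lambda>x. indicator V x *\<^sub>R f x)"
    using assms integrable_lebesgue_on_subset[OF assms(1-4)] by (simp_all add: integrable_restrict_space)
  then have "(LINT x|lebesgue. indicator U x *\<^sub>R f x) \<le> (LINT x|lebesgue. indicator V x *\<^sub>R f x)"
    using assms by (intro integral_mono) (auto simp: indicator_def)
  then show ?thesis using assms by (simp add: integral_restrict_space)
qed

lemma AE_lebesgue_on_iff:
  "U \<in> sets lebesgue \<Longrightarrow> (AE x in lebesgue_on U. P x) \<longleftrightarrow> (AE x in lebesgue. x \<in> U \<longrightarrow> P x)"
  by (simp add: AE_restrict_space_iff)

lemma AE_lebesgue_on_subset:
  assumes "AE x in lebesgue_on V. P x" "U \<subseteq> V" "U \<in> sets lebesgue" "V \<in> sets lebesgue"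
  shows "AE x in lebesgue_on U. P x"
  using assms by (auto simp: AE_lebesgue_on_iff elim!: eventually_mono)

text \<open>By the Lindelof property, countably many of the given neighbourhoods suffice.\<close>

lemma AE_lebesgue_on_local:
  fixes U :: "(real^'n) set"
  assumes "open U"
    and "\<And>x. x \<in> U \<Longrightarrow> \<exists>V. open V \<and> x \<in> V \<and> (AE z in lebesgue_on (U \<inter> V). P z)"
  shows "AE z in lebesgue_on U. P z"
proof -
  obtain V where V: "\<And>x. x \<in> U \<Longrightarrow> open (V x)" "\<And>x. x \<in> U \<Longrightarrow> x \<in> V x"
      "\<And>x. x \<in> U \<Longrightarrow> AE z in lebesgue_on (U \<inter> V x). P z"
    using assms(2) by metis
  have "open S" if "S \<in> V ` U" for S
    using that V(1) by (elim imageE) simp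
  then obtain F where F: "F \<subseteq> V ` U" "countable F" "\<Union>F = \<Union> (V ` U)"
    by (rule Lindelof)
  have "\<forall>S\<in>F. AE z in lebesgue. z \<in> U \<inter> S \<longrightarrow> P z"
  proof
    fix S assume "S \<in> F"
    then obtain x where x: "x \<in> U" "S = V x" using F(1) by blast
    then have "U \<inter> S \<in> sets lebesgue" using V(1) assms(1) by (intro open_sets_lebesgue open_Int) auto
    then show "AE z in lebesgue. z \<in> U \<inter> S \<longrightarrow> P z"
      using V(3)[OF x(1)] x(2) by (simp only: AE_lebesgue_on_iff)
  qed
  then have "AE z in lebesgue. \<forall>S\<in>F. z \<in> U \<inter> S \<longrightarrow> P z"
    using F(2) by (simp only: AE_ball_countable)
  moreover have "U \<subseteq> \<Union>F" using V(2) F(3) by blast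
  ultimately have "AE z in lebesgue. z \<in> U \<longrightarrow> P z"
    by (auto elim!: eventually_mono)
  then show ?thesis using assms(1) by (simp add: AE_lebesgue_on_iff)
qed

lemma integrable_continuous_compact_support:
  fixes f :: "real^'n \<Rightarrow> 'b::{banach, second_countable_topology}"
  assumes "continuous_on UNIV f" "compact K" "\<And>x. x \<notin> K \<Longrightarrow> f x = 0"
  shows "integrable lborel f" "integrable lebesgue f"
proof -
  have "integrable lborel (\<lambda>x. indicator K x *\<^sub>R f x)"
    using assms by (intro borel_integrable_compact) (auto intro: continuous_on_subset)
  moreover have "(\<lambda>x. indicator K x *\<^sub>R f x) = f"
    using assms(3) by (auto simp: fun_eq_iff indicator_def)
  ultimately show "integrable lborel f" by simp
  then show "integrable lebesgue f"
    using integrable_completion[of f lborel] by auto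
qed

lemma integrable_continuous_on_compact:
  fixes f :: "real^'n \<Rightarrow> 'b::{banach, second_countable_topology}"
  assumes "continuous_on K f" "compact K"
  shows "integrable (lebesgue_on K) f"
proof -
  have "integrable lborel (\<lambda>x. indicator K x *\<^sub>R f x)"
    using assms by (intro borel_integrable_compact)
  then have "integrable lebesgue (\<lambda>x. indicator K x *\<^sub>R f x)"
    using integrable_completion[of "\<lambda>x. indicator K x *\<^sub>R f x" lborel] by auto
  moreover have "K \<in> sets lebesgue"
    using assms(2) by (simp add: borel_compact)
  ultimately show ?thesis by (simp add: integrable_restrict_space)
qed

lemma Cc_inf_integrable:
  assumes "\<phi> \<in> Cc_inf U"
  shows "integrable lebesgue \<phi>"
  by (rule integrable_continuous_compact_support(2)[OF smooth_continuous[OF Cc_infD(1)[OF assms]]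
      Cc_infD(2)[OF assms]]) (rule not_in_closure_support)

section \<open>Integration by parts and the Hardy inequality\<close>

text \<open>The difference quotients of \<open>F\<close> have integral zero by translation invariance, and they converge
  boundedly to the partial derivative.\<close>

lemma integral_pd_eq_0:
  fixes F :: "real^'n \<Rightarrow> real"
  assumes F: "\<And>x. F differentiable (at x)" and cont: "continuous_on UNIV (pd \<alpha> F)"
    and K: "compact K" "\<And>x. x \<notin> K \<Longrightarrow> F x = 0"
  shows "(LINT x|lebesgue. pd \<alpha> F x) = 0"
proof -
  let ?e = "axis \<alpha> 1 :: real^'n"
  define q where "q n x = real (Suc n) * (F (x + inverse (real (Suc n)) *\<^sub>R ?e) - F x)" for n x
  have F_cont: "continuous_on UNIV F"
    using F by (simp add: continuous_at_imp_continuous_on differentiable_imp_continuous_within)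
  have deriv: "((\<lambda>t. F (x + t *\<^sub>R ?e)) has_real_derivative pd \<alpha> F (x + t *\<^sub>R ?e)) (at t)" for x t
  proof -
    have "((\<lambda>t. x + t *\<^sub>R ?e) has_derivative (\<lambda>t. t *\<^sub>R ?e)) (at t)"
      by (auto intro!: derivative_eq_intros)
    from has_derivative_compose[OF this has_derivative_pd[OF F]]
    have "((\<lambda>t. F (x + t *\<^sub>R ?e)) has_derivative
        (\<lambda>s. frechet_derivative F (at (x + t *\<^sub>R ?e)) (s *\<^sub>R ?e))) (at t)" .
    moreover have "frechet_derivative F (at (x + t *\<^sub>R ?e)) (s *\<^sub>R ?e)
        = pd \<alpha> F (x + t *\<^sub>R ?e) * s" for s
      using linear_scale[OF linear_frechet_derivative[OF F]] by (simp add: pd_def)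
    ultimately show ?thesis by (simp add: has_field_derivative_def)
  qed
  have closed: "closure {x. F x \<noteq> 0} \<subseteq> K"
    using K by (intro closure_minimal compact_imp_closed) auto
  have pd0: "pd \<alpha> F x = 0" if "x \<notin> K" for x
    using that closed by (intro pd_zero_if_locally_zero) auto
  obtain B where B: "\<And>x. \<bar>pd \<alpha> F x\<bar> \<le> B"
  proof -
    have "bounded (pd \<alpha> F ` K)"
      using K(1) cont by (intro compact_imp_bounded compact_continuous_image) (auto intro: continuous_on_subset)
    then obtain b where b: "\<And>x. x \<in> K \<Longrightarrow> \<bar>pd \<alpha> F x\<bar> \<le> b" by (auto simp: bounded_iff)
    have "\<bar>pd \<alpha> F x\<bar> \<le> max b 0" for x
      by (cases "x \<in> K") (use b[of x] pd0[of x] in auto)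
    then show ?thesis by (rule that)
  qed
  obtain r where r: "K \<subseteq> ball 0 r"
    using compact_imp_bounded[OF K(1)] bounded_subset_ballD by blast
  have q_bound: "\<bar>q n x\<bar> \<le> B * indicator (cball 0 (r + 1)) x" for n x
  proof (cases "x \<in> cball 0 (r + 1)")
    case True
    let ?h = "inverse (real (Suc n))"
    obtain z where "F (x + ?h *\<^sub>R ?e) - F (x + 0 *\<^sub>R ?e) = (?h - 0) * pd \<alpha> F (x + z *\<^sub>R ?e)"
      using MVT2[of 0 ?h "\<lambda>t. F (x + t *\<^sub>R ?e)" "\<lambda>t. pd \<alpha> F (x + t *\<^sub>R ?e)"] deriv by auto
    then have "q n x = pd \<alpha> F (x + z *\<^sub>R ?e)"
      by (simp add: q_def field_simps)
    with B True show ?thesis by simp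
  next
    case False
    let ?h = "inverse (real (Suc n))"
    have "norm (?h *\<^sub>R ?e) \<le> 1" by (simp add: norm_axis_1 inverse_le_1_iff)
    moreover have "norm x > r + 1" using False by (simp add: dist_norm)
    ultimately have "norm (x + ?h *\<^sub>R ?e) > r"
      using norm_triangle_ineq2[of x "- (?h *\<^sub>R ?e)"] by simp
    then have "x + ?h *\<^sub>R ?e \<notin> K" "x \<notin> K"
      using r \<open>norm x > r + 1\<close> by (auto simp: subset_iff)
    then show ?thesis using K(2) False by (simp add: q_def)
  qed
  have "(\<lambda>n. LINT x|lborel. q n x) \<longlonglongrightarrow> (LINT x|lborel. pd \<alpha> F x)"
  proof (rule integral_dominated_convergence[where w = "\<lambda>x. B * indicator (cball 0 (r + 1)) x"])
    show "pd \<alpha> F \<in> borel_measurable lborel"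
      using cont by (simp add: borel_measurable_continuous_onI)
    have "continuous_on UNIV (q n)" for n
      unfolding q_def
      by (intro continuous_intros continuous_on_compose2[OF F_cont]) auto
    then show "q n \<in> borel_measurable lborel" for n
      by (simp add: borel_measurable_continuous_onI)
    show "integrable lborel (\<lambda>x::real^'n. B * indicator (cball 0 (r + 1)) x)"
      using emeasure_bounded_finite[of "cball 0 (r + 1) :: (real^'n) set"] by simp
    show "AE x in lborel. norm (q n x) \<le> B * indicator (cball 0 (r + 1)) x" for n
      using q_bound by simp
    show "AE x in lborel. (\<lambda>n. q n x) \<longlonglongrightarrow> pd \<alpha> F x"
    proof (rule AE_I2)
      fix x
      have "((\<lambda>h. (F (x + (0 + h) *\<^sub>R ?e) - F (x + 0 *\<^sub>R ?e)) / h) \<longlongrightarrow> pd \<alpha> F (x + 0 *\<^sub>R ?e)) (at 0)"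
        using deriv[of x 0] by (simp only: DERIV_def)
      then have "((\<lambda>h. (F (x + h *\<^sub>R ?e) - F x) / h) \<longlongrightarrow> pd \<alpha> F x) (at 0)" by simp
      moreover have "filterlim (\<lambda>n. inverse (real (Suc n))) (at 0) sequentially"
        using LIMSEQ_inverse_real_of_nat by (auto simp: filterlim_at)
      ultimately have "(\<lambda>n. (F (x + inverse (real (Suc n)) *\<^sub>R ?e) - F x) / inverse (real (Suc n)))
          \<longlonglongrightarrow> pd \<alpha> F x"
        by (rule filterlim_compose)
      then show "(\<lambda>n. q n x) \<longlonglongrightarrow> pd \<alpha> F x"
        by (simp add: q_def divide_inverse mult.commute)
    qed
  qed
  moreover have "(LINT x|lborel. q n x) = 0" for n
  proof -
    let ?c = "inverse (real (Suc n)) *\<^sub>R ?e"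
    have int: "integrable lborel F"
      by (rule integrable_continuous_compact_support(1)[OF F_cont K])
    have F_borel: "F \<in> borel_measurable borel"
      using F_cont by (rule borel_measurable_continuous_onI)
    have "integrable (distr lborel borel ((+) ?c)) F" using int by (simp add: lborel_distr_plus)
    then have int': "integrable lborel (\<lambda>x. F (?c + x))"
      by (subst (asm) integrable_distr_eq) (auto simp: F_borel)
    have "(LINT x|lborel. F x) = (LINT x|distr lborel borel ((+) ?c). F x)"
      by (simp add: lborel_distr_plus)
    also have "\<dots> = (LINT x|lborel. F (?c + x))"
      by (rule integral_distr) (auto simp: F_borel)
    finally show ?thesis
      unfolding q_def using int int' by (simp add: add.commute)
  qed
  ultimately have "(LINT x|lborel. pd \<alpha> F x) = 0"
    by (simp add: LIMSEQ_const_iff)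
  moreover have "pd \<alpha> F \<in> borel_measurable lborel"
    using cont by (simp add: borel_measurable_continuous_onI)
  ultimately show ?thesis
    by (simp add: integral_completion)
qed

lemma integral_by_parts:
  assumes "smooth f" "\<phi> \<in> Cc_inf U"
  shows "(LINT x|lebesgue. f x * pd \<alpha> \<phi> x) = - (LINT x|lebesgue. pd \<alpha> f x * \<phi> x)"
proof -
  have C: "(\<lambda>x. f x * \<phi> x) \<in> Cc_inf U" by (rule Cc_inf_mult[OF assms(2,1)])
  have "(LINT x|lebesgue. pd \<alpha> (\<lambda>x. f x * \<phi> x) x) = 0"
    by (rule integral_pd_eq_0[OF smooth_differentiable[OF Cc_infD(1)[OF C]]
          smooth_continuous[OF smooth_pd[OF Cc_infD(1)[OF C]]] Cc_infD(2)[OF C]])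
      (rule not_in_closure_support)
  moreover have "pd \<alpha> (\<lambda>x. f x * \<phi> x) = (\<lambda>x. f x * pd \<alpha> \<phi> x + pd \<alpha> f x * \<phi> x)"
    using pd_mult[OF smooth_differentiable[OF assms(1)] smooth_differentiable[OF Cc_infD(1)[OF assms(2)]]]
    by blast
  moreover have "integrable lebesgue (\<lambda>x. f x * pd \<alpha> \<phi> x)" "integrable lebesgue (\<lambda>x. pd \<alpha> f x * \<phi> x)"
    by (rule Cc_inf_integrable[OF Cc_inf_mult[OF Cc_inf_pd[OF assms(2)] assms(1)]]
      Cc_inf_integrable[OF Cc_inf_mult[OF assms(2) smooth_pd[OF assms(1)]]])+
  ultimately show ?thesis by simp
qed


text \<open>Test the divergence theorem with \<open>\<phi>\<^sup>2 (x - y) / (r\<^sup>2 + |x - y|\<^sup>2)\<close>. The divergence of the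
  vector field is at least \<open>(n - 2) / (r\<^sup>2 + |x - y|\<^sup>2)\<close>, which is where \<open>n \<ge> 3\<close> enters; the term
  with the gradient of \<open>\<phi>\<close> is absorbed by Young's inequality.\<close>

lemma Hardy_inequality:
  fixes \<phi> :: "real^'n \<Rightarrow> real"
  assumes n: "CARD('n) \<ge> 3" and \<phi>: "\<phi> \<in> Cc_inf U" and r: "0 < r"
  shows "(LINT x|lebesgue_on (ball y r). (\<phi> x)\<^sup>2) \<le> 8 * r\<^sup>2 * (LINT x|lebesgue. (norm (grad \<phi> x))\<^sup>2)"
proof -
  note sm = Cc_infD(1)[OF \<phi>]
  define w where "w x = r\<^sup>2 + (norm (x - y))\<^sup>2" for x
  have w_pos: "0 < w x" for x using r by (simp add: w_def add_pos_nonneg)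
  define F where "F \<alpha> x = (\<phi> x)\<^sup>2 * ((x $ \<alpha> - y $ \<alpha>) * inverse (w x))" for \<alpha> x
  define D where "D \<alpha> x = 2 * \<phi> x * pd \<alpha> \<phi> x * (x $ \<alpha> - y $ \<alpha>) * inverse (w x)
     + (\<phi> x)\<^sup>2 * (inverse (w x) - 2 * (x $ \<alpha> - y $ \<alpha>)\<^sup>2 * (inverse (w x))\<^sup>2)" for \<alpha> x
  have w_deriv: "(w has_derivative (\<lambda>h. 2 * inner (x - y) h)) (at x)" for x
    unfolding w_def power2_norm_eq_inner
    by (auto intro!: derivative_eq_intros simp: inner_commute)
  have F_deriv: "(F \<alpha> has_derivative (\<lambda>h. (\<phi> x)\<^sup>2 * ((x $ \<alpha> - y $ \<alpha>)
        * - (inverse (w x) * (2 * inner (x - y) h) * inverse (w x)) + h $ \<alpha> * inverse (w x))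
      + 2 * \<phi> x * frechet_derivative \<phi> (at x) h * ((x $ \<alpha> - y $ \<alpha>) * inverse (w x)))) (at x)" for \<alpha> x
    unfolding F_def
    using w_pos[of x]
    by (auto intro!: derivative_eq_intros has_derivative_pd smooth_differentiable[OF sm] w_deriv
        bounded_linear_imp_has_derivative bounded_linear_vec_nth simp: fun_eq_iff)
  have pd_F: "pd \<alpha> (F \<alpha>) x = D \<alpha> x" for \<alpha> x
    using pd_eqI[OF F_deriv, of \<alpha> \<alpha> x]
    by (simp add: D_def pd_def[symmetric] inner_axis power2_eq_square algebra_simps)
  have D_cont: "continuous_on UNIV (D \<alpha>)" for \<alpha>
    unfolding D_def w_def
    by (intro continuous_intros smooth_continuous sm smooth_pd)
      (use w_pos in \<open>auto simp: w_def less_le\<close>)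
  have int0: "(LINT x|lebesgue. D \<alpha> x) = 0" and D_int: "integrable lebesgue (D \<alpha>)" for \<alpha>
  proof -
    have D: "pd \<alpha> (F \<alpha>) = D \<alpha>" using pd_F by blast
    have F0: "F \<alpha> x = 0" and D0: "D \<alpha> x = 0" if "x \<notin> closure {x. \<phi> x \<noteq> 0}" for x
      using not_in_closure_support[OF that] by (simp_all add: F_def D_def)
    show "(LINT x|lebesgue. D \<alpha> x) = 0"
      unfolding D[symmetric]
      by (rule integral_pd_eq_0[OF differentiableI[OF F_deriv] D_cont[of \<alpha>, folded D] Cc_infD(2)[OF \<phi>] F0])
    show "integrable lebesgue (D \<alpha>)"
      by (rule integrable_continuous_compact_support(2)[OF D_cont Cc_infD(2)[OF \<phi>] D0])
  qed
  have ptw: "indicator (ball y r) x * (\<phi> x)\<^sup>2 / (4 * r\<^sup>2) - 2 * (norm (grad \<phi> x))\<^sup>2 \<le> (\<Sum>\<alpha>\<in>UNIV. D \<alpha> x)" for x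
  proof -
    define v where "v = inverse (w x)"
    have v: "0 < v" "v * w x = 1" using w_pos[of x] by (auto simp: v_def)
    define p where "p = inner (grad \<phi> x) (x - y)"
    have s1: "(\<Sum>\<alpha>\<in>UNIV. pd \<alpha> \<phi> x * (x $ \<alpha> - y $ \<alpha>)) = p"
      by (simp add: p_def inner_vec_def)
    have s2: "(\<Sum>\<alpha>\<in>UNIV. (x $ \<alpha> - y $ \<alpha>)\<^sup>2) = (norm (x - y))\<^sup>2"
      unfolding power2_norm_eq_inner inner_vec_def by (simp add: power2_eq_square)
    have "(\<Sum>\<alpha>\<in>UNIV. D \<alpha> x) = (\<Sum>\<alpha>\<in>UNIV. 2 * \<phi> x * v * (pd \<alpha> \<phi> x * (x $ \<alpha> - y $ \<alpha>))
       + ((\<phi> x)\<^sup>2 * v - 2 * (\<phi> x)\<^sup>2 * v\<^sup>2 * (x $ \<alpha> - y $ \<alpha>)\<^sup>2))"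
      by (intro sum.cong) (auto simp: D_def v_def algebra_simps)
    also have "\<dots> = 2 * \<phi> x * v * p + (real CARD('n) * ((\<phi> x)\<^sup>2 * v) - 2 * (\<phi> x)\<^sup>2 * v\<^sup>2 * (norm (x - y))\<^sup>2)"
      by (simp add: sum.distrib sum_subtractf s1 s2 flip: sum_distrib_left)
    finally have sum_eq: "(\<Sum>\<alpha>\<in>UNIV. D \<alpha> x)
        = 2 * \<phi> x * v * p + (real CARD('n) * ((\<phi> x)\<^sup>2 * v) - 2 * (\<phi> x)\<^sup>2 * v\<^sup>2 * (norm (x - y))\<^sup>2)" .
    have nw: "(norm (x - y))\<^sup>2 = w x - r\<^sup>2" by (simp add: w_def)
    have "v\<^sup>2 * (norm (x - y))\<^sup>2 = v * (v * w x) - v\<^sup>2 * r\<^sup>2"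
      unfolding nw by (simp add: power2_eq_square right_diff_distrib mult.assoc)
    then have "v\<^sup>2 * (norm (x - y))\<^sup>2 = v - v\<^sup>2 * r\<^sup>2"
      by (simp only: v(2) mult_1_right)
    moreover have "0 \<le> v\<^sup>2 * r\<^sup>2" by simp
    ultimately have vn: "v\<^sup>2 * (norm (x - y))\<^sup>2 \<le> v" by linarith
    have "real CARD('n) \<ge> 3" using n by simp
    then have "3 * ((\<phi> x)\<^sup>2 * v) \<le> real CARD('n) * ((\<phi> x)\<^sup>2 * v)"
      using v(1) by (intro mult_right_mono) auto
    moreover have "2 * (\<phi> x)\<^sup>2 * (v\<^sup>2 * (norm (x - y))\<^sup>2) \<le> 2 * (\<phi> x)\<^sup>2 * v"
      using vn by (intro mult_left_mono) auto
    ultimately have part1: "(\<phi> x)\<^sup>2 * v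
        \<le> real CARD('n) * ((\<phi> x)\<^sup>2 * v) - 2 * (\<phi> x)\<^sup>2 * v\<^sup>2 * (norm (x - y))\<^sup>2"
      by (simp add: mult.assoc)
    have "p\<^sup>2 \<le> (norm (grad \<phi> x))\<^sup>2 * (norm (x - y))\<^sup>2"
      using Cauchy_Schwarz_ineq[of "grad \<phi> x" "x - y"] by (simp add: p_def power2_norm_eq_inner)
    then have "v\<^sup>2 * p\<^sup>2 \<le> v\<^sup>2 * ((norm (grad \<phi> x))\<^sup>2 * (norm (x - y))\<^sup>2)"
      by (intro mult_left_mono) auto
    also have "\<dots> \<le> v * (norm (grad \<phi> x))\<^sup>2"
      using mult_right_mono[OF vn, of "(norm (grad \<phi> x))\<^sup>2"] by (simp add: mult_ac)
    finally have vp: "v * p\<^sup>2 \<le> (norm (grad \<phi> x))\<^sup>2"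
      using v(1) by (simp add: power2_eq_square mult.assoc)
    have "0 \<le> v * (\<phi> x + 2 * p)\<^sup>2" using v(1) by simp
    also have "\<dots> = (\<phi> x)\<^sup>2 * v + 2 * (2 * \<phi> x * v * p) + 4 * (v * p\<^sup>2)"
      by (simp add: power2_eq_square algebra_simps)
    finally have part2: "- ((\<phi> x)\<^sup>2 * v / 2) - 2 * (norm (grad \<phi> x))\<^sup>2 \<le> 2 * \<phi> x * v * p"
      using vp by linarith
    have part3: "indicator (ball y r) x * (\<phi> x)\<^sup>2 / (4 * r\<^sup>2) \<le> (\<phi> x)\<^sup>2 * v / 2"
    proof (cases "x \<in> ball y r")
      case True
      then have "norm (x - y) < r" by (simp add: dist_norm norm_minus_commute)
      then have "(norm (x - y))\<^sup>2 \<le> r\<^sup>2" by (intro power_mono) auto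
      then have "w x \<le> 2 * r\<^sup>2" by (simp add: w_def)
      then have "inverse (2 * r\<^sup>2) \<le> v"
        unfolding v_def using w_pos by (rule le_imp_inverse_le)
      then have "(\<phi> x)\<^sup>2 * inverse (2 * r\<^sup>2) \<le> (\<phi> x)\<^sup>2 * v" by (intro mult_left_mono) auto
      with True show ?thesis by (simp add: field_simps)
    next
      case False
      then show ?thesis using v(1) by simp
    qed
    show ?thesis unfolding sum_eq using part1 part2 part3 by linarith
  qed
  have \<phi>2: "integrable lebesgue (\<lambda>x. (\<phi> x)\<^sup>2)" "integrable lebesgue (\<lambda>x. (norm (grad \<phi> x))\<^sup>2)"
  proof -
    show "integrable lebesgue (\<lambda>x. (\<phi> x)\<^sup>2)"
      using Cc_inf_integrable[OF Cc_inf_mult[OF \<phi> sm]] by (simp add: power2_eq_square)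
    have "integrable lebesgue (\<lambda>x. pd \<alpha> \<phi> x * pd \<alpha> \<phi> x)" for \<alpha>
      using Cc_inf_integrable[OF Cc_inf_mult[OF Cc_inf_pd[OF \<phi>] smooth_pd[OF sm]]] by simp
    then show "integrable lebesgue (\<lambda>x. (norm (grad \<phi> x))\<^sup>2)"
      by (simp add: power2_norm_eq_inner inner_vec_def)
  qed
  have int1: "integrable lebesgue (\<lambda>x. indicator (ball y r) x * (\<phi> x)\<^sup>2)"
    using integrable_mult_indicator[OF _ \<phi>2(1), of "ball y r"] by simp
  have "(LINT x|lebesgue. indicator (ball y r) x * (\<phi> x)\<^sup>2 / (4 * r\<^sup>2) - 2 * (norm (grad \<phi> x))\<^sup>2)
     \<le> (LINT x|lebesgue. (\<Sum>\<alpha>\<in>UNIV. D \<alpha> x))"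
    using int1 \<phi>2 D_int ptw by (intro integral_mono) auto
  also have "\<dots> = 0" using D_int int0 by simp
  finally have "(LINT x|lebesgue. indicator (ball y r) x * (\<phi> x)\<^sup>2) / (4 * r\<^sup>2)
      \<le> 2 * (LINT x|lebesgue. (norm (grad \<phi> x))\<^sup>2)"
    using int1 \<phi>2 by simp
  moreover have "(LINT x|lebesgue_on (ball y r). (\<phi> x)\<^sup>2) = (LINT x|lebesgue. indicator (ball y r) x * (\<phi> x)\<^sup>2)"
    by (subst integral_restrict_space) auto
  ultimately show ?thesis using r by (simp add: field_simps)
qed

section \<open>Weak gradients\<close>

lemma L1_locD:
  assumes "u \<in> L1_loc U" "compact K" "K \<subseteq> U"
  shows "integrable (lebesgue_on K) u"
  using assms by (auto simp: L1_loc_def)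

text \<open>In this form outer regularity lets integrals over open sets determine integrals over
  arbitrary measurable sets.\<close>

lemma outer_open_approximation:
  fixes S :: "(real^'n) set"
  assumes "S \<in> sets lebesgue"
  obtains T where "\<And>n::nat. open (T n)" "\<And>n. S \<subseteq> T n"
    "AE x in lebesgue. (\<lambda>n. indicator (T n) x :: real) \<longlonglongrightarrow> indicator S x"
proof -
  have "\<exists>U. open U \<and> S \<subseteq> U \<and> U - S \<in> sets lebesgue \<and> emeasure lebesgue (U - S) < ennreal (inverse (Suc n))" for n
    using sets_lebesgue_outer_open[OF assms, of "inverse (Suc n)"]
    by (metis fmeasurableD inverse_positive_iff_positive of_nat_0_less_iff zero_less_Suc)
  then obtain U where U: "\<And>n::nat. open (U n)" "\<And>n. S \<subseteq> U n" "\<And>n. U n - S \<in> sets lebesgue"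
      "\<And>n. emeasure lebesgue (U n - S) < ennreal (inverse (Suc n))" by metis
  define T where "T n = (\<Inter>j\<le>n. U j)" for n
  let ?N = "(\<Inter>n. U n) - S"
  have N: "?N \<in> sets lebesgue"
    using U(1) assms by (intro sets.Diff sets.countable_INT) (auto intro: open_sets_lebesgue)
  have "emeasure lebesgue ?N \<le> ennreal (inverse (Suc n))" for n
    using emeasure_mono[of ?N "U n - S" lebesgue] U(3,4)[of n] by (auto intro: order_trans less_imp_le)
  moreover have "(\<lambda>n. ennreal (inverse (Suc n))) \<longlonglongrightarrow> ennreal 0"
    using LIMSEQ_inverse_real_of_nat by (intro tendsto_ennrealI)
  ultimately have "emeasure lebesgue ?N \<le> ennreal 0"
    by (intro LIMSEQ_le_const) auto
  then have "?N \<in> null_sets lebesgue" using N by (simp add: null_setsI)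
  show thesis
  proof (rule that[of T])
    show "open (T n)" for n using U(1) by (auto simp: T_def)
    show "S \<subseteq> T n" for n using U(2) by (auto simp: T_def)
    show "AE x in lebesgue. (\<lambda>n. indicator (T n) x :: real) \<longlonglongrightarrow> indicator S x"
      using AE_not_in[OF \<open>?N \<in> null_sets lebesgue\<close>]
    proof (rule AE_mp, intro AE_I2 impI)
      fix x assume x: "x \<notin> ?N"
      show "(\<lambda>n. indicator (T n) x :: real) \<longlonglongrightarrow> indicator S x"
      proof (cases "x \<in> S")
        case True
        then have "x \<in> T n" for n using U(2) by (auto simp: T_def)
        then show ?thesis using True by simp
      next
        case False
        then obtain j where "x \<notin> U j" using x by auto
        then have "x \<notin> T n" if "n \<ge> j" for n using that by (auto simp: T_def)
        then have "\<forall>\<^sub>F n in sequentially. indicator (T n) x = (0::real)"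
          by (intro eventually_sequentiallyI[of j]) simp
        then show ?thesis using False by (simp add: tendsto_eventually)
      qed
    qed
  qed
qed

text \<open>Integrals of \<open>g\<close> against smooth functions determine its integrals over open sets, and these
  determine its integrals over measurable sets.\<close>

lemma fundamental_lemma_of_variations:
  fixes g :: "real^'n \<Rightarrow> real"
  assumes U: "open U" and g: "g \<in> L1_loc U"
    and zero: "\<And>\<phi>. \<phi> \<in> Cc_inf U \<Longrightarrow> (LINT x|lebesgue_on U. g x * \<phi> x) = 0"
  shows "AE x in lebesgue_on U. g x = 0"
proof (rule AE_lebesgue_on_local[OF U])
  fix y assume "y \<in> U"
  then obtain \<rho> where \<rho>: "0 < \<rho>" "cball y \<rho> \<subseteq> U" using U open_contains_cball by blast
  let ?V = "ball y \<rho>" and ?M = "lebesgue_on (ball y \<rho>)"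
  have V: "?V \<subseteq> U" "?V \<in> sets lebesgue" "U \<in> sets lebesgue"
    using \<rho>(2) ball_subset_cball U by (auto intro: open_sets_lebesgue)
  have gV: "integrable ?M g"
    by (rule integrable_lebesgue_on_subset[OF L1_locD[OF g compact_cball \<rho>(2)]])
      (auto simp: ball_subset_cball)
  then have gm: "g \<in> borel_measurable ?M" by simp
  have sigma_finite: "sigma_finite_measure ?M"
    using finite_measure_lebesgue_on[of ?V] by (simp add: finite_measure_def)
  have open_zero: "(LINT x|?M. g x * indicator W x) = 0" if W: "open W" "W \<subseteq> ?V" for W
  proof -
    obtain \<psi> where \<psi>: "\<And>k. \<psi> k \<in> Cc_inf W" "\<And>k x. 0 \<le> \<psi> k x" "\<And>k x. \<psi> k x \<le> 1"
        "\<And>x. (\<lambda>k. \<psi> k x) \<longlonglongrightarrow> indicator W x"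
      using smooth_approximation_of_open_set[OF W(1)] by blast
    have "(\<lambda>k. LINT x|?M. g x * \<psi> k x) \<longlonglongrightarrow> (LINT x|?M. g x * indicator W x)"
    proof (rule integral_dominated_convergence[where w = "\<lambda>x. \<bar>g x\<bar>"])
      have "W \<in> sets ?M" using W V by (auto simp: sets_restrict_space_iff open_sets_lebesgue)
      then show "(\<lambda>x. g x * indicator W x) \<in> borel_measurable ?M" using gm by measurable
      have "\<psi> k \<in> borel_measurable ?M" for k
        using smooth_continuous[OF Cc_infD(1)[OF \<psi>(1)]] V(2)
        by (rule continuous_imp_measurable_on_sets_lebesgue)
      then show "(\<lambda>x. g x * \<psi> k x) \<in> borel_measurable ?M" for k using gm by measurable
      show "integrable ?M (\<lambda>x. \<bar>g x\<bar>)" using gV by simp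
      show "AE x in ?M. (\<lambda>k. g x * \<psi> k x) \<longlonglongrightarrow> g x * indicator W x"
        by (intro AE_I2 tendsto_mult_left \<psi>(4))
      show "AE x in ?M. norm (g x * \<psi> k x) \<le> \<bar>g x\<bar>" for k
        using \<psi>(2,3) by (intro AE_I2) (simp add: abs_mult mult_left_le)
    qed
    moreover have "(LINT x|?M. g x * \<psi> k x) = 0" for k
    proof -
      have C: "\<psi> k \<in> Cc_inf ?V" "\<psi> k \<in> Cc_inf U"
        using \<psi>(1) W(2) V(1) by (blast intro: Cc_inf_mono)+
      have "(LINT x|?M. g x * \<psi> k x) = (LINT x|lebesgue. g x * \<psi> k x)"
        using Cc_inf_eq_0[OF C(1)] V(2) by (intro integral_lebesgue_on_eq) auto
      also have "\<dots> = (LINT x|lebesgue_on U. g x * \<psi> k x)"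
        using Cc_inf_eq_0[OF C(2)] V(3) by (intro integral_lebesgue_on_eq[symmetric]) auto
      finally show ?thesis using zero[OF C(2)] by simp
    qed
    ultimately show ?thesis by (simp add: LIMSEQ_const_iff)
  qed
  have "AE x in ?M. g x = 0"
  proof (rule sigma_finite_measure.density_zero[OF sigma_finite gV])
    fix S assume "S \<in> sets ?M"
    then have S: "S \<in> sets lebesgue" "S \<subseteq> ?V" using V(2) by (auto simp: sets_restrict_space_iff)
    obtain T where T: "\<And>n. open (T n)" "\<And>n. S \<subseteq> T n"
        "AE x in lebesgue. (\<lambda>n. indicator (T n) x :: real) \<longlonglongrightarrow> indicator S x"
      using outer_open_approximation[OF S(1)] by blast
    have TV: "open (T n \<inter> ?V)" for n using T(1) by auto
    have "(\<lambda>n. LINT x|?M. g x * indicator (T n \<inter> ?V) x) \<longlonglongrightarrow> (LINT x|?M. g x * indicator S x)"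
    proof (rule integral_dominated_convergence[where w = "\<lambda>x. \<bar>g x\<bar>"])
      show "(\<lambda>x. g x * indicator S x) \<in> borel_measurable ?M"
        using gm \<open>S \<in> sets ?M\<close> by measurable
      have "T n \<inter> ?V \<in> sets ?M" for n
        using TV V(2) by (auto simp: sets_restrict_space_iff open_sets_lebesgue)
      then show "(\<lambda>x. g x * indicator (T n \<inter> ?V) x) \<in> borel_measurable ?M" for n
        using gm by measurable
      show "integrable ?M (\<lambda>x. \<bar>g x\<bar>)" using gV by simp
      have "AE x in ?M. (\<lambda>n. indicator (T n) x :: real) \<longlonglongrightarrow> indicator S x"
        using T(3) V(2) by (auto simp: AE_lebesgue_on_iff elim!: eventually_mono)
      moreover have "AE x in ?M. x \<in> ?V" by (intro AE_I2) simp
      ultimately show "AE x in ?M. (\<lambda>n. g x * indicator (T n \<inter> ?V) x) \<longlonglongrightarrow> g x * indicator S x"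
        by eventually_elim (auto intro!: tendsto_mult_left simp: indicator_inter_arith)
      show "AE x in ?M. norm (g x * indicator (T n \<inter> ?V) x) \<le> \<bar>g x\<bar>" for n
        by (intro AE_I2) (simp add: indicator_def)
    qed
    moreover have "(LINT x|?M. g x * indicator (T n \<inter> ?V) x) = 0" for n
      using TV by (intro open_zero) auto
    ultimately have "(LINT x|?M. g x * indicator S x) = 0" by (simp add: LIMSEQ_const_iff)
    then show "set_lebesgue_integral ?M S g = 0"
      by (simp add: set_lebesgue_integral_def mult.commute)
  qed
  then have "AE z in lebesgue_on (U \<inter> ?V). g z = 0"
    by (simp only: Int_absorb1[OF V(1)])
  then show "\<exists>V. open V \<and> y \<in> V \<and> (AE z in lebesgue_on (U \<inter> V). g z = 0)"
    using \<rho>(1) by (intro exI[of _ ?V]) simp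
qed

lemma L1_loc_component: "g \<in> L1_loc U \<Longrightarrow> (\<lambda>x. g x $ \<alpha>) \<in> L1_loc U"
  unfolding L1_loc_def by (auto intro: integrable_bounded_linear[OF bounded_linear_vec_nth])

lemma L1_loc_subset: "u \<in> L1_loc V \<Longrightarrow> U \<subseteq> V \<Longrightarrow> u \<in> L1_loc U"
  unfolding L1_loc_def by auto

lemma L1_loc_diff: "u \<in> L1_loc U \<Longrightarrow> v \<in> L1_loc U \<Longrightarrow> (\<lambda>x. u x - v x) \<in> L1_loc U"
  unfolding L1_loc_def by auto

lemma L1_loc_continuous: "continuous_on U u \<Longrightarrow> u \<in> L1_loc U"
  unfolding L1_loc_def by (auto intro: integrable_continuous_on_compact continuous_on_subset)

lemma Cc_inf_bounded:
  assumes "\<phi> \<in> Cc_inf U"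
  obtains B where "\<And>x. \<bar>\<phi> x\<bar> \<le> B" "0 \<le> B"
proof -
  let ?K = "closure {x. \<phi> x \<noteq> 0}"
  have "bounded (\<phi> ` ?K)"
    by (intro compact_imp_bounded compact_continuous_image smooth_continuous Cc_infD[OF assms])
  then obtain b where b: "\<And>x. x \<in> ?K \<Longrightarrow> \<bar>\<phi> x\<bar> \<le> b" by (auto simp: bounded_iff)
  have "\<bar>\<phi> x\<bar> \<le> max b 0" for x
    by (cases "x \<in> ?K") (use b[of x] not_in_closure_support[of x \<phi>] in auto)
  then show ?thesis by (rule that) simp
qed

lemma integrable_L1_loc_mult_Cc:
  fixes u :: "real^'n \<Rightarrow> real"
  assumes "open U" "u \<in> L1_loc U" "\<phi> \<in> Cc_inf U"
  shows "integrable (lebesgue_on U) (\<lambda>x. u x * \<phi> x)"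
proof -
  let ?K = "closure {x. \<phi> x \<noteq> 0}"
  note \<phi> = Cc_infD[OF assms(3)]
  have K: "?K \<in> sets lebesgue" by (simp add: borel_closed)
  obtain B where B: "\<And>x. \<bar>\<phi> x\<bar> \<le> B" "0 \<le> B" using Cc_inf_bounded[OF assms(3)] by metis
  have int: "integrable (lebesgue_on ?K) u" by (rule L1_locD[OF assms(2) \<phi>(2,3)])
  have m: "\<phi> \<in> borel_measurable (lebesgue_on ?K)"
    using smooth_continuous[OF \<phi>(1)] K by (rule continuous_imp_measurable_on_sets_lebesgue)
  have "integrable (lebesgue_on ?K) (\<lambda>x. u x * \<phi> x)"
  proof (rule Bochner_Integration.integrable_bound)
    show "integrable (lebesgue_on ?K) (\<lambda>x. B * u x)" using int by simp
    show "(\<lambda>x. u x * \<phi> x) \<in> borel_measurable (lebesgue_on ?K)" using int m by measurable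
    show "AE x in lebesgue_on ?K. norm (u x * \<phi> x) \<le> norm (B * u x)"
      using B by (intro AE_I2) (simp add: abs_mult mult.commute mult_right_mono)
  qed
  moreover have "u x * \<phi> x = 0" if "x \<notin> ?K" for x
    using not_in_closure_support[OF that] by simp
  ultimately have "integrable lebesgue (\<lambda>x. u x * \<phi> x)"
    using integrable_lebesgue_on_eq[OF K, of "\<lambda>x. u x * \<phi> x"] by blast
  then show ?thesis
    using integrable_lebesgue_on_eq[of U "\<lambda>x. u x * \<phi> x"] Cc_inf_eq_0[OF assms(3)] assms(1)
    by (simp add: open_sets_lebesgue)
qed

lemma weak_gradientD:
  assumes "weak_gradient U u g"
  shows "g \<in> L1_loc U" "u \<in> L1_loc U"
    and "\<phi> \<in> Cc_inf U \<Longrightarrow> (LINT x|lebesgue_on U. u x * pd \<alpha> \<phi> x) = - (LINT x|lebesgue_on U. g x $ \<alpha> * \<phi> x)"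
  using assms unfolding weak_gradient_def by blast+

lemma weak_gradient_unique:
  fixes u :: "real^'n \<Rightarrow> real"
  assumes U: "open U" and g: "weak_gradient U u g" and h: "weak_gradient U u h"
  shows "AE x in lebesgue_on U. g x = h x"
proof -
  have L1: "(\<lambda>x. g x $ \<alpha>) \<in> L1_loc U" "(\<lambda>x. h x $ \<alpha>) \<in> L1_loc U" for \<alpha>
    by (rule L1_loc_component, rule weak_gradientD[OF g] weak_gradientD[OF h])+
  have "AE x in lebesgue_on U. g x $ \<alpha> - h x $ \<alpha> = 0" for \<alpha>
  proof (rule fundamental_lemma_of_variations[OF U L1_loc_diff[OF L1]])
    fix \<phi> :: "real^'n \<Rightarrow> real" assume \<phi>: "\<phi> \<in> Cc_inf U"
    have "(LINT x|lebesgue_on U. g x $ \<alpha> * \<phi> x) = (LINT x|lebesgue_on U. h x $ \<alpha> * \<phi> x)"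
      using weak_gradientD(3)[OF g \<phi>, of \<alpha>] weak_gradientD(3)[OF h \<phi>, of \<alpha>] by linarith
    then show "(LINT x|lebesgue_on U. (g x $ \<alpha> - h x $ \<alpha>) * \<phi> x) = 0"
      using integrable_L1_loc_mult_Cc[OF U L1(1) \<phi>] integrable_L1_loc_mult_Cc[OF U L1(2) \<phi>]
      by (simp add: left_diff_distrib)
  qed
  then have "AE x in lebesgue_on U. \<forall>\<alpha>. g x $ \<alpha> - h x $ \<alpha> = 0"
    by (subst AE_all_countable) blast
  then show ?thesis by (auto simp: vec_eq_iff elim!: eventually_mono)
qed

lemma weak_gradient_cong:
  assumes "\<And>x. x \<in> U \<Longrightarrow> u x = v x"
  shows "weak_gradient U u g \<longleftrightarrow> weak_gradient U v g"
proof -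
  have "integrable (lebesgue_on K) u \<longleftrightarrow> integrable (lebesgue_on K) v" if "K \<subseteq> U" for K
    using that assms by (intro Bochner_Integration.integrable_cong) auto
  then have "u \<in> L1_loc U \<longleftrightarrow> v \<in> L1_loc U" by (auto simp: L1_loc_def)
  moreover have "(LINT x|lebesgue_on U. u x * f x) = (LINT x|lebesgue_on U. v x * f x)" for f
    using assms by (intro Bochner_Integration.integral_cong) auto
  ultimately show ?thesis by (simp add: weak_gradient_def)
qed

lemma wgrad_cong:
  assumes "\<And>x. x \<in> U \<Longrightarrow> u x = v x"
  shows "wgrad U u = wgrad U v"
proof -
  have "weak_gradient U u = weak_gradient U v"
    using weak_gradient_cong[of U u v] assms by blast
  then show ?thesis by (simp add: wgrad_def)
qed

lemma W11_locI: "weak_gradient U u g \<Longrightarrow> u \<in> W11_loc U"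
  unfolding W11_loc_def by blast

lemma W11_loc_weak_gradient:
  assumes "u \<in> W11_loc U"
  shows "weak_gradient U u (wgrad U u)"
proof -
  have "\<exists>g. weak_gradient U u g" using assms by (simp add: W11_loc_def)
  then show ?thesis unfolding wgrad_def by (rule someI_ex)
qed

lemma wgrad_eq_AE:
  "open U \<Longrightarrow> weak_gradient U u g \<Longrightarrow> AE x in lebesgue_on U. wgrad U u x = g x"
  by (rule weak_gradient_unique[OF _ W11_loc_weak_gradient[OF W11_locI]])

lemma weak_gradient_smooth:
  fixes f :: "real^'n \<Rightarrow> real"
  assumes "open U" "smooth f"
  shows "weak_gradient U f (grad f)"
  unfolding weak_gradient_def
proof (intro conjI ballI allI)
  show "f \<in> L1_loc U" using assms by (intro L1_loc_continuous smooth_continuous)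
  have "continuous_on U (grad f)"
    unfolding grad_def using assms by (intro continuous_on_vec_lambda smooth_continuous smooth_pd)
  then show "grad f \<in> L1_loc U" by (rule L1_loc_continuous)
next
  fix \<phi> :: "real^'n \<Rightarrow> real" and \<alpha> assume \<phi>: "\<phi> \<in> Cc_inf U"
  note U = open_sets_lebesgue[OF assms(1)]
  have "(LINT x|lebesgue_on U. f x * pd \<alpha> \<phi> x) = (LINT x|lebesgue. f x * pd \<alpha> \<phi> x)"
    using Cc_inf_pd_eq_0[OF \<phi>] U by (intro integral_lebesgue_on_eq) auto
  also have "\<dots> = - (LINT x|lebesgue. grad f x $ \<alpha> * \<phi> x)"
    using integral_by_parts[OF assms(2) \<phi>] by simp
  also have "(LINT x|lebesgue. grad f x $ \<alpha> * \<phi> x) = (LINT x|lebesgue_on U. grad f x $ \<alpha> * \<phi> x)"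
    using Cc_inf_eq_0[OF \<phi>] U by (intro integral_lebesgue_on_eq[symmetric]) auto
  finally show "(LINT x|lebesgue_on U. f x * pd \<alpha> \<phi> x) = - (LINT x|lebesgue_on U. grad f x $ \<alpha> * \<phi> x)" .
qed

lemma weak_gradient_diff:
  fixes u v :: "real^'n \<Rightarrow> real"
  assumes U: "open U" and u: "weak_gradient U u g" and v: "weak_gradient U v h"
  shows "weak_gradient U (\<lambda>x. u x - v x) (\<lambda>x. g x - h x)"
  unfolding weak_gradient_def
proof (intro conjI ballI allI)
  note L1 = weak_gradientD(2)[OF u] weak_gradientD(2)[OF v] weak_gradientD(1)[OF u] weak_gradientD(1)[OF v]
  show "(\<lambda>x. u x - v x) \<in> L1_loc U" "(\<lambda>x. g x - h x) \<in> L1_loc U"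
    by (rule L1_loc_diff[OF L1(1,2)] L1_loc_diff[OF L1(3,4)])+
  fix \<phi> :: "real^'n \<Rightarrow> real" and \<alpha> assume \<phi>: "\<phi> \<in> Cc_inf U"
  note i = integrable_L1_loc_mult_Cc[OF U L1(1) Cc_inf_pd[OF \<phi>]]
    integrable_L1_loc_mult_Cc[OF U L1(2) Cc_inf_pd[OF \<phi>]]
    integrable_L1_loc_mult_Cc[OF U L1_loc_component[OF L1(3)] \<phi>]
    integrable_L1_loc_mult_Cc[OF U L1_loc_component[OF L1(4)] \<phi>]
  show "(LINT x|lebesgue_on U. (u x - v x) * pd \<alpha> \<phi> x) = - (LINT x|lebesgue_on U. (g x - h x) $ \<alpha> * \<phi> x)"
    using i weak_gradientD(3)[OF u \<phi>, of \<alpha>] weak_gradientD(3)[OF v \<phi>, of \<alpha>]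
    by (simp add: left_diff_distrib)
qed

lemma weak_gradient_subset:
  assumes "weak_gradient V u g" "U \<subseteq> V" "open U" "open V"
  shows "weak_gradient U u g"
  unfolding weak_gradient_def
proof (intro conjI ballI allI)
  show "u \<in> L1_loc U" "g \<in> L1_loc U"
    by (rule L1_loc_subset[OF weak_gradientD(2)[OF assms(1)] assms(2)]
        L1_loc_subset[OF weak_gradientD(1)[OF assms(1)] assms(2)])+
  fix \<phi> \<alpha> assume \<phi>: "\<phi> \<in> Cc_inf U"
  then have \<phi>V: "\<phi> \<in> Cc_inf V" using assms(2) by (rule Cc_inf_mono)
  have *: "(LINT x|lebesgue_on U. f x * \<psi> x) = (LINT x|lebesgue_on V. f x * \<psi> x)"
    if "\<psi> \<in> Cc_inf U" for f \<psi>
    using Cc_inf_eq_0[OF that] Cc_inf_eq_0[OF Cc_inf_mono[OF that assms(2)]] assms(3,4)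
    by (subst (1 2) integral_lebesgue_on_eq) (auto intro: open_sets_lebesgue)
  show "(LINT x|lebesgue_on U. u x * pd \<alpha> \<phi> x) = - (LINT x|lebesgue_on U. g x $ \<alpha> * \<phi> x)"
    unfolding *[OF \<phi>] *[OF Cc_inf_pd[OF \<phi>]]
    by (rule weak_gradientD(3)[OF assms(1) \<phi>V])
qed

section \<open>Lebesgue spaces\<close>

lemma borel_measurable_lebesgue_on_AE:
  fixes f g :: "real^'n \<Rightarrow> 'b::euclidean_space"
  assumes "f \<in> borel_measurable (lebesgue_on U)" "AE x in lebesgue_on U. f x = g x" "U \<in> sets lebesgue"
  shows "g \<in> borel_measurable (lebesgue_on U)"
proof -
  have "AE x in lebesgue. indicator U x *\<^sub>R f x = indicator U x *\<^sub>R g x"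
    using assms(2,3) by (auto simp: AE_lebesgue_on_iff indicator_def elim!: eventually_mono)
  then show ?thesis
    using borel_measurable_AE[of "\<lambda>x. indicator U x *\<^sub>R f x" "\<lambda>x. indicator U x *\<^sub>R g x"] assms(1,3)
    by (simp add: borel_measurable_restrict_space_iff)
qed

lemma Lp2_iff:
  "u \<in> Lp 2 U \<longleftrightarrow> u \<in> borel_measurable (lebesgue_on U) \<and> integrable (lebesgue_on U) (\<lambda>x. (norm (u x))\<^sup>2)"
  by (simp add: Lp_def)

lemma Lp2_norm_eq: "Lp_norm 2 U u = sqrt (LINT x|lebesgue_on U. (norm (u x))\<^sup>2)"
  by (simp add: Lp_norm_def powr_half_sqrt)

lemma Lp_subset:
  assumes "u \<in> Lp p V" "U \<subseteq> V" "U \<in> sets lebesgue" "V \<in> sets lebesgue"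
  shows "u \<in> Lp p U"
proof -
  have "u \<in> borel_measurable (lebesgue_on V)" using assms(1) by (simp add: Lp_def)
  then have "u \<in> borel_measurable (restrict_space (lebesgue_on V) U)"
    by (rule measurable_restrict_space1)
  moreover have "restrict_space (lebesgue_on V) U = lebesgue_on U"
    using assms by (subst restrict_restrict_space) (auto simp: Int_absorb1)
  ultimately show ?thesis
    using assms integrable_lebesgue_on_subset[OF _ assms(2-4)] by (auto simp: Lp_def)
qed

lemma Lp_cong_AE:
  assumes "u \<in> Lp p U" "AE x in lebesgue_on U. u x = v x" "U \<in> sets lebesgue"
  shows "v \<in> Lp p U"
proof -
  have u: "u \<in> borel_measurable (lebesgue_on U)" "integrable (lebesgue_on U) (\<lambda>x. norm (u x) powr p)"
    using assms(1) by (auto simp: Lp_def)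
  have v: "v \<in> borel_measurable (lebesgue_on U)"
    using borel_measurable_lebesgue_on_AE[OF u(1) assms(2,3)] .
  have "integrable (lebesgue_on U) (\<lambda>x. norm (v x) powr p)"
    by (rule integrable_cong_AE_imp[OF u(2)]) (use assms(2) v in auto)
  with v show ?thesis by (simp add: Lp_def)
qed

lemma Lp_norm_cong_AE:
  assumes "u \<in> Lp p U" "AE x in lebesgue_on U. u x = v x" "U \<in> sets lebesgue"
  shows "Lp_norm p U u = Lp_norm p U v"
proof -
  have "u \<in> borel_measurable (lebesgue_on U)" "v \<in> borel_measurable (lebesgue_on U)"
    using assms(1) Lp_cong_AE[OF assms] by (auto simp: Lp_def)
  then have "(LINT x|lebesgue_on U. norm (u x) powr p) = (LINT x|lebesgue_on U. norm (v x) powr p)"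
    using assms(2) by (intro integral_cong_AE) auto
  then show ?thesis by (simp add: Lp_norm_def)
qed

lemma Lp_norm_nonneg: "0 \<le> Lp_norm p U u"
  by (simp add: Lp_norm_def)

lemma Lp_norm_subset:
  assumes "u \<in> Lp p V" "U \<subseteq> V" "U \<in> sets lebesgue" "V \<in> sets lebesgue" "0 < p"
  shows "Lp_norm p U u \<le> Lp_norm p V u"
  unfolding Lp_norm_def
  using assms integral_lebesgue_on_mono_set[OF _ assms(2-4), of "\<lambda>x. norm (u x) powr p"]
  by (intro powr_mono2) (auto simp: Lp_def)

lemma Lp_norm_tendsto_0_imp_integral:
  assumes "0 < p" "(\<lambda>k. Lp_norm p U (v k)) \<longlonglongrightarrow> 0"
  shows "(\<lambda>k. LINT x|lebesgue_on U. norm (v k x) powr p) \<longlonglongrightarrow> 0"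
proof -
  have "(\<lambda>k. Lp_norm p U (v k) powr p) \<longlonglongrightarrow> 0 powr p"
    using assms by (intro tendsto_powr') (auto simp: Lp_norm_nonneg)
  moreover have "Lp_norm p U (v k) powr p = (LINT x|lebesgue_on U. norm (v k x) powr p)" for k
    using assms(1) by (simp add: Lp_norm_def powr_powr)
  ultimately show ?thesis using assms(1) by simp
qed

lemma Lp_diff:
  assumes "u \<in> Lp p U" "v \<in> Lp p U" "0 < p"
  shows "(\<lambda>x. u x - v x) \<in> Lp p U"
proof -
  have u: "u \<in> borel_measurable (lebesgue_on U)" "integrable (lebesgue_on U) (\<lambda>x. norm (u x) powr p)"
    and v: "v \<in> borel_measurable (lebesgue_on U)" "integrable (lebesgue_on U) (\<lambda>x. norm (v x) powr p)"
    using assms by (auto simp: Lp_def)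
  have "integrable (lebesgue_on U) (\<lambda>x. norm (u x - v x) powr p)"
  proof (rule Bochner_Integration.integrable_bound)
    show "integrable (lebesgue_on U) (\<lambda>x. 2 powr p * (norm (u x) powr p + norm (v x) powr p))"
      using u v by simp
    show "(\<lambda>x. norm (u x - v x) powr p) \<in> borel_measurable (lebesgue_on U)"
      using u v by measurable
    have "norm (u x - v x) powr p \<le> 2 powr p * (norm (u x) powr p + norm (v x) powr p)" for x
    proof -
      have "norm (u x - v x) powr p \<le> (2 * max (norm (u x)) (norm (v x))) powr p"
        using norm_triangle_ineq4[of "u x" "v x"] assms(3) by (intro powr_mono2) auto
      also have "\<dots> = 2 powr p * max (norm (u x)) (norm (v x)) powr p"
        by (rule powr_mult)
      also have "\<dots> \<le> 2 powr p * (norm (u x) powr p + norm (v x) powr p)"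
        by (intro mult_left_mono) (auto simp: max_def)
      finally show ?thesis .
    qed
    then show "AE x in lebesgue_on U. norm (norm (u x - v x) powr p)
        \<le> norm (2 powr p * (norm (u x) powr p + norm (v x) powr p))"
      by (intro AE_I2) (simp add: abs_of_nonneg)
  qed
  then show ?thesis using u v by (simp add: Lp_def)
qed

lemma continuous_compact_support_in_Lp:
  fixes f :: "real^'n \<Rightarrow> 'b::euclidean_space"
  assumes "continuous_on UNIV f" "compact K" "\<And>x. x \<notin> K \<Longrightarrow> f x = 0" "0 < p" "U \<in> sets lebesgue"
  shows "f \<in> Lp p U"
proof -
  have "continuous_on UNIV (\<lambda>x. norm (f x) powr p)"
    using assms(4) by (intro continuous_on_powr' continuous_intros assms(1)) auto
  then have "integrable lebesgue (\<lambda>x. norm (f x) powr p)"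
    by (rule integrable_continuous_compact_support(2)[OF _ assms(2)]) (simp add: assms(3))
  moreover have "f \<in> borel_measurable lebesgue"
    using assms(1) by (intro measurable_completion) (simp add: borel_measurable_continuous_onI)
  ultimately have "f \<in> Lp p UNIV" by (simp add: Lp_def lebesgue_on_UNIV_eq)
  then show ?thesis by (rule Lp_subset) (use assms(5) in auto)
qed

lemma Cc_inf_Lp:
  assumes "\<phi> \<in> Cc_inf V" "0 < p" "U \<in> sets lebesgue"
  shows "\<phi> \<in> Lp p U" "grad \<phi> \<in> Lp p U"
proof -
  note \<phi> = Cc_infD[OF assms(1)]
  show "\<phi> \<in> Lp p U"
    by (rule continuous_compact_support_in_Lp[OF smooth_continuous[OF \<phi>(1)] \<phi>(2) _ assms(2,3)])
      (rule not_in_closure_support)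
  have "continuous_on UNIV (grad \<phi>)"
    unfolding grad_def using \<phi>(1) by (intro continuous_on_vec_lambda smooth_continuous smooth_pd)
  then show "grad \<phi> \<in> Lp p U"
    by (rule continuous_compact_support_in_Lp[OF _ \<phi>(2) _ assms(2,3)])
      (simp add: vec_eq_iff pd_zero_if_locally_zero)
qed

lemma Lp2_mult_integrable:
  fixes f g :: "real^'n \<Rightarrow> real"
  assumes "f \<in> Lp 2 U" "g \<in> Lp 2 U"
  shows "integrable (lebesgue_on U) (\<lambda>x. f x * g x)"
proof (rule Bochner_Integration.integrable_bound)
  show "integrable (lebesgue_on U) (\<lambda>x. (f x)\<^sup>2 + (g x)\<^sup>2)"
    using assms by (simp add: Lp2_iff)
  show "(\<lambda>x. f x * g x) \<in> borel_measurable (lebesgue_on U)"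
    using assms by (intro borel_measurable_times) (simp_all add: Lp2_iff)
  have "\<bar>f x * g x\<bar> \<le> (f x)\<^sup>2 + (g x)\<^sup>2" for x
  proof -
    have "2 * \<bar>f x\<bar> * \<bar>g x\<bar> \<le> (f x)\<^sup>2 + (g x)\<^sup>2"
      using sum_squares_bound[of "\<bar>f x\<bar>" "\<bar>g x\<bar>"] by simp
    moreover have "0 \<le> \<bar>f x\<bar> * \<bar>g x\<bar>" by simp
    ultimately show ?thesis unfolding abs_mult mult.assoc by linarith
  qed
  then show "AE x in lebesgue_on U. norm (f x * g x) \<le> norm ((f x)\<^sup>2 + (g x)\<^sup>2)"
    by (intro AE_I2) simp
qed

lemma Cauchy_Schwarz_L2:
  fixes f g :: "real^'n \<Rightarrow> real"
  assumes f: "f \<in> Lp 2 U" and g: "g \<in> Lp 2 U"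
  shows "\<bar>LINT x|lebesgue_on U. f x * g x\<bar>
    \<le> sqrt (LINT x|lebesgue_on U. (f x)\<^sup>2) * sqrt (LINT x|lebesgue_on U. (g x)\<^sup>2)"
proof -
  let ?M = "lebesgue_on U"
  define a where "a = (LINT x|?M. (f x)\<^sup>2)"
  define b where "b = (LINT x|?M. (g x)\<^sup>2)"
  define c where "c = (LINT x|?M. f x * g x)"
  have i: "integrable ?M (\<lambda>x. (f x)\<^sup>2)" "integrable ?M (\<lambda>x. (g x)\<^sup>2)" "integrable ?M (\<lambda>x. f x * g x)"
    using f g Lp2_mult_integrable[OF f g] by (auto simp: Lp2_iff)
  have m: "g \<in> borel_measurable ?M" using g by (simp add: Lp2_iff)
  have nonneg: "0 \<le> a" "0 \<le> b" by (simp_all add: a_def b_def)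
  have "c\<^sup>2 \<le> a * b"
  proof (cases "b = 0")
    case True
    then have "AE x in ?M. (g x)\<^sup>2 = 0"
      using integral_nonneg_eq_0_iff_AE[OF i(2)] by (simp add: b_def)
    then have "AE x in ?M. f x * g x = 0" by (auto elim!: eventually_mono)
    then have "c = 0" unfolding c_def by (rule integral_eq_zero_AE)
    then show ?thesis using nonneg by simp
  next
    case False
    have "0 \<le> (LINT x|?M. (b * f x - c * g x)\<^sup>2)" by simp
    also have "(\<lambda>x. (b * f x - c * g x)\<^sup>2) = (\<lambda>x. b\<^sup>2 * (f x)\<^sup>2 - 2 * b * c * (f x * g x) + c\<^sup>2 * (g x)\<^sup>2)"
      by (simp add: fun_eq_iff power2_eq_square algebra_simps)
    also have "(LINT x|?M. \<dots> x) = b\<^sup>2 * a - 2 * b * c * c + c\<^sup>2 * b"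
      using i by (simp add: a_def b_def c_def)
    finally have "0 \<le> b * (a * b - c\<^sup>2)" by (simp add: power2_eq_square algebra_simps)
    then show ?thesis using False nonneg by (simp add: zero_le_mult_iff)
  qed
  then have "\<bar>c\<bar> \<le> sqrt (a * b)" by (simp add: real_le_rsqrt)
  then show ?thesis by (simp add: real_sqrt_mult a_def b_def c_def)
qed

lemma L2_pairing_tendsto:
  fixes g h :: "real^'n \<Rightarrow> real"
  assumes g: "g \<in> Lp 2 U" and h: "h \<in> Lp 2 U" and hk: "\<And>k. (\<lambda>x. h x - hk k x) \<in> Lp 2 U"
    and lim: "(\<lambda>k. LINT x|lebesgue_on U. (h x - hk k x)\<^sup>2) \<longlonglongrightarrow> 0"
  shows "(\<lambda>k. LINT x|lebesgue_on U. g x * hk k x) \<longlonglongrightarrow> (LINT x|lebesgue_on U. g x * h x)"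
proof -
  have "(\<lambda>k. LINT x|lebesgue_on U. g x * (h x - hk k x)) \<longlonglongrightarrow> 0"
  proof (rule Lim_null_comparison)
    show "\<forall>\<^sub>F k in sequentially. norm (LINT x|lebesgue_on U. g x * (h x - hk k x))
        \<le> sqrt (LINT x|lebesgue_on U. (g x)\<^sup>2) * sqrt (LINT x|lebesgue_on U. (h x - hk k x)\<^sup>2)"
      using Cauchy_Schwarz_L2[OF g hk] by (intro always_eventually) simp
    show "(\<lambda>k. sqrt (LINT x|lebesgue_on U. (g x)\<^sup>2) * sqrt (LINT x|lebesgue_on U. (h x - hk k x)\<^sup>2)) \<longlonglongrightarrow> 0"
      using tendsto_mult_right_zero[OF tendsto_real_sqrt[OF lim, simplified]] .
  qed
  from tendsto_diff[OF tendsto_const[of "LINT x|lebesgue_on U. g x * h x"] this]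
  have "(\<lambda>k. (LINT x|lebesgue_on U. g x * h x) - (LINT x|lebesgue_on U. g x * (h x - hk k x)))
      \<longlonglongrightarrow> (LINT x|lebesgue_on U. g x * h x)" by simp
  moreover have "(LINT x|lebesgue_on U. g x * h x) - (LINT x|lebesgue_on U. g x * (h x - hk k x))
      = (LINT x|lebesgue_on U. g x * hk k x)" for k
    using Bochner_Integration.integral_diff[OF Lp2_mult_integrable[OF g h] Lp2_mult_integrable[OF g hk[of k]]]
    by (simp add: right_diff_distrib)
  ultimately show ?thesis by simp
qed

text \<open>The elementary form of the embedding of \<open>L\<^sup>p\<close> into \<open>L\<^sup>2\<close> on sets of finite measure.\<close>

lemma square_le_powr:
  assumes "2 \<le> p" "0 < \<delta>" "0 \<le> (t::real)"
  shows "t\<^sup>2 \<le> \<delta>\<^sup>2 + \<delta> powr (2 - p) * t powr p"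
proof (cases "t \<le> \<delta>")
  case True
  then have "t\<^sup>2 \<le> \<delta>\<^sup>2" using assms by (intro power_mono) auto
  then show ?thesis by (simp add: add_increasing2)
next
  case False
  have "t\<^sup>2 = t powr (2 - p) * t powr p"
    using assms False by (simp flip: powr_add)
  also have "\<dots> \<le> \<delta> powr (2 - p) * t powr p"
    using assms False by (intro mult_right_mono powr_mono2') auto
  finally show ?thesis by (simp add: add_increasing)
qed

lemma Lp_imp_L2_finite_measure:
  fixes v :: "real^'n \<Rightarrow> real"
  assumes v: "v \<in> Lp p B" and p: "2 \<le> p" and B: "B \<in> lmeasurable" and \<delta>: "0 < \<delta>"
  shows "v \<in> Lp 2 B"
    "(LINT x|lebesgue_on B. (v x)\<^sup>2)
      \<le> \<delta>\<^sup>2 * measure lebesgue B + \<delta> powr (2 - p) * (LINT x|lebesgue_on B. \<bar>v x\<bar> powr p)"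
proof -
  interpret finite_measure "lebesgue_on B" using B by (rule finite_measure_lebesgue_on)
  have i: "integrable (lebesgue_on B) (\<lambda>x. \<delta>\<^sup>2 + \<delta> powr (2 - p) * \<bar>v x\<bar> powr p)"
    and m: "v \<in> borel_measurable (lebesgue_on B)"
    using v by (auto simp: Lp_def)
  have le: "(v x)\<^sup>2 \<le> \<delta>\<^sup>2 + \<delta> powr (2 - p) * \<bar>v x\<bar> powr p" for x
    using square_le_powr[OF p \<delta>, of "\<bar>v x\<bar>"] by simp
  have i2: "integrable (lebesgue_on B) (\<lambda>x. (v x)\<^sup>2)"
    by (rule Bochner_Integration.integrable_bound[OF i]) (use m le in auto)
  then show "v \<in> Lp 2 B" using m by (simp add: Lp2_iff)
  have "(LINT x|lebesgue_on B. (v x)\<^sup>2) \<le> (LINT x|lebesgue_on B. \<delta>\<^sup>2 + \<delta> powr (2 - p) * \<bar>v x\<bar> powr p)"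
    using i i2 le by (intro integral_mono) auto
  also have "\<dots> = \<delta>\<^sup>2 * measure lebesgue B + \<delta> powr (2 - p) * (LINT x|lebesgue_on B. \<bar>v x\<bar> powr p)"
    using v B by (simp add: Lp_def measure_restrict_space)
  finally show "(LINT x|lebesgue_on B. (v x)\<^sup>2)
      \<le> \<delta>\<^sup>2 * measure lebesgue B + \<delta> powr (2 - p) * (LINT x|lebesgue_on B. \<bar>v x\<bar> powr p)" .
qed

lemma Lp_tendsto_imp_L2_tendsto:
  fixes v :: "nat \<Rightarrow> real^'n \<Rightarrow> real"
  assumes v: "\<And>k. v k \<in> Lp p B" and p: "2 < p" and B: "B \<in> lmeasurable"
    and lim: "(\<lambda>k. LINT x|lebesgue_on B. \<bar>v k x\<bar> powr p) \<longlonglongrightarrow> 0"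
  shows "(\<lambda>k. LINT x|lebesgue_on B. (v k x)\<^sup>2) \<longlonglongrightarrow> 0"
proof (rule LIMSEQ_I)
  fix e :: real assume e: "0 < e"
  define \<mu> where "\<mu> = measure lebesgue B"
  have \<mu>: "0 \<le> \<mu>" by (simp add: \<mu>_def)
  define \<delta> where "\<delta> = sqrt (e / (2 * (\<mu> + 1)))"
  have \<delta>: "0 < \<delta>" "\<delta>\<^sup>2 = e / (2 * (\<mu> + 1))" using e \<mu> by (auto simp: \<delta>_def)
  have d\<mu>: "\<delta>\<^sup>2 * \<mu> \<le> e / 2"
    using e \<mu> by (simp add: \<delta>(2) field_simps)
  have "(\<lambda>k. \<delta> powr (2 - p) * (LINT x|lebesgue_on B. \<bar>v k x\<bar> powr p)) \<longlonglongrightarrow> 0"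
    using tendsto_mult_right_zero[OF lim] .
  then obtain N where N: "\<And>k. k \<ge> N \<Longrightarrow> \<bar>\<delta> powr (2 - p) * (LINT x|lebesgue_on B. \<bar>v k x\<bar> powr p)\<bar> < e / 2"
    using LIMSEQ_D[of _ 0 "e / 2"] e by fastforce
  show "\<exists>N. \<forall>k\<ge>N. norm ((LINT x|lebesgue_on B. (v k x)\<^sup>2) - 0) < e"
  proof (intro exI allI impI)
    fix k assume "N \<le> k"
    then have "(LINT x|lebesgue_on B. (v k x)\<^sup>2) < e"
      using Lp_imp_L2_finite_measure(2)[OF v less_imp_le[OF p] B \<delta>(1), of k] N[of k] d\<mu>
      unfolding \<mu>_def by linarith
    then show "norm ((LINT x|lebesgue_on B. (v k x)\<^sup>2) - 0) < e" by simp
  qed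
qed


section \<open>Limits of test functions\<close>

lemma sobolev_exp_gt_2:
  assumes "CARD('n::finite) \<ge> 3"
  shows "2 < sobolev_exp TYPE('n)"
  using assms by (simp add: sobolev_exp_def field_simps)

lemma Y12_weak_gradient: "u \<in> Y12 U \<Longrightarrow> weak_gradient U u (wgrad U u)"
  unfolding Y12_def by (blast intro: W11_loc_weak_gradient)

lemma wgrad_diff_smooth_AE:
  assumes "open U" "weak_gradient U u g" "smooth \<phi>"
  shows "AE x in lebesgue_on U. wgrad U (\<lambda>x. u x - \<phi> x) x = g x - grad \<phi> x"
  by (rule wgrad_eq_AE[OF assms(1) weak_gradient_diff[OF assms(1,2) weak_gradient_smooth[OF assms(1,3)]]])

lemma Y12_norm_diff_tendsto_0D:
  fixes u :: "real^'n \<Rightarrow> real"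
  assumes n: "CARD('n) \<ge> 3" and U: "open U" and u: "u \<in> Y12 U" and \<phi>: "\<And>k. \<phi> k \<in> Cc_inf U"
    and lim: "(\<lambda>k. Y12_norm U (\<lambda>x. u x - \<phi> k x)) \<longlonglongrightarrow> 0"
  shows "(\<lambda>k. LINT x|lebesgue_on U. \<bar>u x - \<phi> k x\<bar> powr sobolev_exp TYPE('n)) \<longlonglongrightarrow> 0"
    "(\<lambda>k. LINT x|lebesgue_on U. (norm (wgrad U u x - grad (\<phi> k) x))\<^sup>2) \<longlonglongrightarrow> 0"
proof -
  let ?p = "sobolev_exp TYPE('n)"
  have p: "0 < ?p" using sobolev_exp_gt_2[OF n] by linarith
  have "(\<lambda>k. Lp_norm ?p U (\<lambda>x. u x - \<phi> k x)) \<longlonglongrightarrow> 0"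
    by (rule tendsto_sandwich[OF _ _ tendsto_const lim])
      (auto intro!: always_eventually simp: Lp_norm_nonneg Y12_norm_def)
  from Lp_norm_tendsto_0_imp_integral[OF p this]
  show "(\<lambda>k. LINT x|lebesgue_on U. \<bar>u x - \<phi> k x\<bar> powr ?p) \<longlonglongrightarrow> 0" by simp
  have eq: "Lp_norm 2 U (wgrad U (\<lambda>x. u x - \<phi> k x)) = Lp_norm 2 U (\<lambda>x. wgrad U u x - grad (\<phi> k) x)" for k
  proof (rule Lp_norm_cong_AE[symmetric])
    have "wgrad U u \<in> Lp 2 U" using u by (simp add: Y12_def)
    then show "(\<lambda>x. wgrad U u x - grad (\<phi> k) x) \<in> Lp 2 U"
      by (rule Lp_diff[OF _ Cc_inf_Lp(2)[OF \<phi>]]) (use U in \<open>auto intro: open_sets_lebesgue\<close>)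
    show "AE x in lebesgue_on U. wgrad U u x - grad (\<phi> k) x = wgrad U (\<lambda>x. u x - \<phi> k x) x"
      using wgrad_diff_smooth_AE[OF U Y12_weak_gradient[OF u] Cc_infD(1)[OF \<phi>], of k]
      by (auto elim!: eventually_mono)
  qed (use U in \<open>auto intro: open_sets_lebesgue\<close>)
  have "(\<lambda>k. Lp_norm 2 U (wgrad U (\<lambda>x. u x - \<phi> k x))) \<longlonglongrightarrow> 0"
    by (rule tendsto_sandwich[OF _ _ tendsto_const lim])
      (auto intro!: always_eventually simp: Lp_norm_nonneg Y12_norm_def)
  then have "(\<lambda>k. Lp_norm 2 U (\<lambda>x. wgrad U u x - grad (\<phi> k) x)) \<longlonglongrightarrow> 0"
    by (simp only: eq)
  from Lp_norm_tendsto_0_imp_integral[OF _ this]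
  show "(\<lambda>k. LINT x|lebesgue_on U. (norm (wgrad U u x - grad (\<phi> k) x))\<^sup>2) \<longlonglongrightarrow> 0" by simp
qed

lemma Y12_0E:
  assumes "u \<in> Y12_0 U"
  obtains \<phi> where "u \<in> Y12 U" "\<And>k. \<phi> k \<in> Cc_inf U"
    "(\<lambda>k. Y12_norm U (\<lambda>x. u x - \<phi> k x)) \<longlonglongrightarrow> 0"
  using assms by (auto simp: Y12_0_def Y12_limit_of_def)

lemma Y12_norm_diff_tendsto_0_imp_L2:
  fixes u :: "real^'n \<Rightarrow> real"
  assumes n: "CARD('n) \<ge> 3" and U: "open U" and UY: "u \<in> Y12 U" and \<phi>: "\<And>k. \<phi> k \<in> Cc_inf U"
    and lim: "(\<lambda>k. Y12_norm U (\<lambda>x. u x - \<phi> k x)) \<longlonglongrightarrow> 0"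
    and B: "B \<subseteq> U" "B \<in> lmeasurable"
  shows "(\<lambda>k. LINT x|lebesgue_on B. (u x - \<phi> k x)\<^sup>2) \<longlonglongrightarrow> 0"
proof -
  let ?p = "sobolev_exp TYPE('n)"
  have p: "2 < ?p" "0 < ?p" using sobolev_exp_gt_2[OF n] by linarith+
  note L = Y12_norm_diff_tendsto_0D[OF n U UY \<phi> lim]
  have US: "U \<in> sets lebesgue" using U by (rule open_sets_lebesgue)
  have d: "(\<lambda>x. u x - \<phi> k x) \<in> Lp ?p U" for k
    by (rule Lp_diff[OF _ Cc_inf_Lp(1)[OF \<phi>]]) (use UY p US in \<open>auto simp: Y12_def\<close>)
  have BS: "B \<in> sets lebesgue" using B by (simp add: fmeasurableD)
  have "(\<lambda>k. LINT x|lebesgue_on B. \<bar>u x - \<phi> k x\<bar> powr ?p) \<longlonglongrightarrow> 0"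
  proof (rule tendsto_sandwich[OF _ _ tendsto_const L(1)])
    show "\<forall>\<^sub>F k in sequentially. (LINT x|lebesgue_on B. \<bar>u x - \<phi> k x\<bar> powr ?p)
          \<le> (LINT x|lebesgue_on U. \<bar>u x - \<phi> k x\<bar> powr ?p)"
        using d by (intro always_eventually allI integral_lebesgue_on_mono_set[OF _ B(1) BS US])
          (auto simp: Lp_def)
  qed simp
  then show ?thesis
    by (rule Lp_tendsto_imp_L2_tendsto[OF Lp_subset[OF d B(1) BS US] p(1) B(2)])
qed

lemma Y12_L2_on_finite_measure:
  fixes u :: "real^'n \<Rightarrow> real"
  assumes n: "CARD('n) \<ge> 3" and "open U" "u \<in> Y12 U" "B \<subseteq> U" "B \<in> lmeasurable"
  shows "u \<in> Lp 2 B"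
proof -
  have "u \<in> Lp (sobolev_exp TYPE('n)) B"
    by (rule Lp_subset[OF _ assms(4) fmeasurableD[OF assms(5)] open_sets_lebesgue[OF assms(2)]])
      (use assms(3) in \<open>simp add: Y12_def\<close>)
  then show ?thesis
    by (rule Lp_imp_L2_finite_measure(1)[OF _ less_imp_le[OF sobolev_exp_gt_2[OF n]] assms(5) zero_less_one])
qed

lemma L2_norm_sq_le_twice:
  fixes a b :: "real^'n \<Rightarrow> 'b::euclidean_space"
  assumes "a \<in> Lp 2 U" "b \<in> Lp 2 U"
  shows "(LINT x|lebesgue_on U. (norm (a x))\<^sup>2)
    \<le> 2 * (LINT x|lebesgue_on U. (norm (b x))\<^sup>2) + 2 * (LINT x|lebesgue_on U. (norm (a x - b x))\<^sup>2)"
proof -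
  have i: "integrable (lebesgue_on U) (\<lambda>x. (norm (a x))\<^sup>2)" "integrable (lebesgue_on U) (\<lambda>x. (norm (b x))\<^sup>2)"
    "integrable (lebesgue_on U) (\<lambda>x. (norm (a x - b x))\<^sup>2)"
    using assms Lp_diff[OF assms] by (auto simp: Lp2_iff)
  have "(norm (a x))\<^sup>2 \<le> 2 * (norm (b x))\<^sup>2 + 2 * (norm (a x - b x))\<^sup>2" for x
  proof -
    have "(norm (a x))\<^sup>2 \<le> (norm (b x) + norm (a x - b x))\<^sup>2"
      using norm_triangle_sub[of "a x" "b x"] by (intro power_mono) auto
    also have "\<dots> \<le> 2 * (norm (b x))\<^sup>2 + 2 * (norm (a x - b x))\<^sup>2"
      using sum_squares_bound[of "norm (b x)" "norm (a x - b x)"] by (simp add: power2_sum)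
    finally show ?thesis .
  qed
  then have "(LINT x|lebesgue_on U. (norm (a x))\<^sup>2)
      \<le> (LINT x|lebesgue_on U. 2 * (norm (b x))\<^sup>2 + 2 * (norm (a x - b x))\<^sup>2)"
    using i by (intro integral_mono) auto
  then show ?thesis using i by simp
qed

text \<open>The Hardy inequality passes to the limit; the two applications of
  \<open>(s + t)\<^sup>2 \<le> 2 s\<^sup>2 + 2 t\<^sup>2\<close> turn the constant \<open>8\<close> into \<open>32\<close>.\<close>

lemma Hardy_inequality_Y12_0:
  fixes u :: "real^'n \<Rightarrow> real"
  assumes n: "CARD('n) \<ge> 3" and U: "open U" and u: "u \<in> Y12_0 U" and r: "0 < r"
  shows "(LINT x|lebesgue_on (U \<inter> ball y r). (u x)\<^sup>2)
    \<le> 32 * r\<^sup>2 * (LINT x|lebesgue_on U. (norm (wgrad U u x))\<^sup>2)"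
proof -
  let ?B = "U \<inter> ball y r"
  obtain \<phi> where UY: "u \<in> Y12 U" and \<phi>: "\<And>k. \<phi> k \<in> Cc_inf U"
    and lim: "(\<lambda>k. Y12_norm U (\<lambda>x. u x - \<phi> k x)) \<longlonglongrightarrow> 0"
    using Y12_0E[OF u] by blast
  have US: "U \<in> sets lebesgue" using U by (rule open_sets_lebesgue)
  have B: "?B \<subseteq> U" "?B \<in> lmeasurable"
    using fmeasurable_Int_fmeasurable[OF lmeasurable_ball[of y r] US] by (simp_all add: Int_commute)
  have BS: "?B \<in> sets lebesgue" using B(2) by (simp add: fmeasurableD)
  note L1 = Y12_norm_diff_tendsto_0D(2)[OF n U UY \<phi> lim]
  note L2 = Y12_norm_diff_tendsto_0_imp_L2[OF n U UY \<phi> lim B]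
  have gU: "wgrad U u \<in> Lp 2 U" using UY by (simp add: Y12_def)
  define E where "E = (LINT x|lebesgue_on U. (norm (wgrad U u x))\<^sup>2)"
  define a where "a k = (LINT x|lebesgue_on U. (norm (wgrad U u x - grad (\<phi> k) x))\<^sup>2)" for k
  define b where "b k = (LINT x|lebesgue_on ?B. (u x - \<phi> k x)\<^sup>2)" for k
  have le: "(LINT x|lebesgue_on ?B. (u x)\<^sup>2) \<le> 2 * (8 * r\<^sup>2 * (2 * E + 2 * a k)) + 2 * b k" for k
  proof -
    have \<phi>L: "\<phi> k \<in> Lp 2 ?B" "grad (\<phi> k) \<in> Lp 2 U" "\<phi> k \<in> Lp 2 (ball y r)"
      by (rule Cc_inf_Lp[OF \<phi>]; use BS US in simp)+
    have "(LINT x|lebesgue_on ?B. (norm (u x))\<^sup>2)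
        \<le> 2 * (LINT x|lebesgue_on ?B. (norm (\<phi> k x))\<^sup>2) + 2 * (LINT x|lebesgue_on ?B. (norm (u x - \<phi> k x))\<^sup>2)"
      by (rule L2_norm_sq_le_twice[OF Y12_L2_on_finite_measure[OF n U UY B] \<phi>L(1)])
    moreover have "(LINT x|lebesgue_on ?B. (\<phi> k x)\<^sup>2) \<le> (LINT x|lebesgue_on (ball y r). (\<phi> k x)\<^sup>2)"
      using \<phi>L(3) BS by (intro integral_lebesgue_on_mono_set) (auto simp: Lp2_iff)
    moreover have "(LINT x|lebesgue_on (ball y r). (\<phi> k x)\<^sup>2) \<le> 8 * r\<^sup>2 * (LINT x|lebesgue. (norm (grad (\<phi> k) x))\<^sup>2)"
      by (rule Hardy_inequality[OF n \<phi> r])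
    moreover have "(LINT x|lebesgue. (norm (grad (\<phi> k) x))\<^sup>2) = (LINT x|lebesgue_on U. (norm (grad (\<phi> k) x))\<^sup>2)"
    proof (rule integral_lebesgue_on_eq[OF US, symmetric])
      fix x assume "x \<notin> U"
      then have "grad (\<phi> k) x = 0" by (simp add: vec_eq_iff Cc_inf_pd_eq_0[OF \<phi>])
      then show "(norm (grad (\<phi> k) x))\<^sup>2 = 0" by simp
    qed
    moreover have "(LINT x|lebesgue_on U. (norm (grad (\<phi> k) x))\<^sup>2) \<le> 2 * E + 2 * a k"
      using L2_norm_sq_le_twice[OF \<phi>L(2) gU] by (simp add: E_def a_def norm_minus_commute)
    then have "8 * r\<^sup>2 * (LINT x|lebesgue_on U. (norm (grad (\<phi> k) x))\<^sup>2) \<le> 8 * r\<^sup>2 * (2 * E + 2 * a k)"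
      by (intro mult_left_mono) auto
    ultimately show ?thesis unfolding b_def by simp
  qed
  have "(\<lambda>k. 2 * (8 * r\<^sup>2 * (2 * E + 2 * a k)) + 2 * b k) \<longlonglongrightarrow> 2 * (8 * r\<^sup>2 * (2 * E + 2 * 0)) + 2 * 0"
    by (intro tendsto_intros) (use L1 L2 in \<open>simp_all add: a_def b_def\<close>)
  then have "(LINT x|lebesgue_on ?B. (u x)\<^sup>2) \<le> 2 * (8 * r\<^sup>2 * (2 * E + 2 * 0)) + 2 * 0"
    by (rule LIMSEQ_le_const) (use le in blast)
  then show ?thesis by (simp add: E_def)
qed

lemma Cc_inf_closure_minus_frontier:
  assumes "\<phi> \<in> Cc_inf \<Omega>" "open \<Omega>" "U \<subseteq> \<Omega>" "S \<subseteq> frontier \<Omega>" "bounded U"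
  shows "\<phi> \<in> Cc_inf_closure_minus U S"
proof -
  note \<phi> = Cc_infD[OF assms(1)]
  have c: "closure {x \<in> closure U. \<phi> x \<noteq> 0} \<subseteq> closure U"
    by (intro closure_minimal) auto
  have "closure {x \<in> closure U. \<phi> x \<noteq> 0} \<subseteq> closure {x. \<phi> x \<noteq> 0}"
    by (intro closure_mono) auto
  then have "closure {x \<in> closure U. \<phi> x \<noteq> 0} \<subseteq> \<Omega>" using \<phi>(3) by (rule order_trans)
  moreover have "S \<inter> \<Omega> = {}"
    using assms(2,4) frontier_disjoint_eq[of \<Omega>] by blast
  ultimately have disj: "closure {x \<in> closure U. \<phi> x \<noteq> 0} \<subseteq> closure U - S" using c by blast
  have "bounded {x \<in> closure U. \<phi> x \<noteq> 0}"
    by (rule bounded_subset[OF bounded_closure[OF assms(5)]]) blast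
  then have "compact (closure {x \<in> closure U. \<phi> x \<noteq> 0})" by (simp only: compact_closure)
  with \<phi>(1) disj show ?thesis
    unfolding Cc_inf_closure_minus_def by blast
qed

text \<open>Test functions on \<open>\<Omega>\<close> vanish near \<open>frontier \<Omega>\<close>, so the same approximating sequence shows that
  the restriction vanishes on \<open>S\<close>.\<close>

lemma Y12_0_restrict:
  fixes u :: "real^'n \<Rightarrow> real"
  assumes n: "CARD('n) \<ge> 3" and \<Omega>: "open \<Omega>" and u: "u \<in> Y12_0 \<Omega>"
    and U: "open U" "bounded U" "U \<subseteq> \<Omega>" and S: "S \<subseteq> frontier \<Omega>"
  shows "AE x in lebesgue_on U. wgrad U u x = wgrad \<Omega> u x" "u \<in> W12 U" "vanishes_on U S u"
proof -
  let ?p = "sobolev_exp TYPE('n)"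
  have p: "2 < ?p" "0 < ?p" using sobolev_exp_gt_2[OF n] by linarith+
  obtain \<phi> where UY: "u \<in> Y12 \<Omega>" and \<phi>: "\<And>k. \<phi> k \<in> Cc_inf \<Omega>"
    and lim: "(\<lambda>k. Y12_norm \<Omega> (\<lambda>x. u x - \<phi> k x)) \<longlonglongrightarrow> 0"
    using Y12_0E[OF u] by blast
  have US: "U \<in> sets lebesgue" "\<Omega> \<in> sets lebesgue" using U \<Omega> by (auto intro: open_sets_lebesgue)
  have w\<Omega>: "weak_gradient \<Omega> u (wgrad \<Omega> u)" by (rule Y12_weak_gradient[OF UY])
  have wU: "weak_gradient U u (wgrad \<Omega> u)" by (rule weak_gradient_subset[OF w\<Omega> U(3,1) \<Omega>])
  show AE: "AE x in lebesgue_on U. wgrad U u x = wgrad \<Omega> u x" by (rule wgrad_eq_AE[OF U(1) wU])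
  have gL: "wgrad \<Omega> u \<in> Lp 2 U"
    by (rule Lp_subset[OF _ U(3) US]) (use UY in \<open>simp add: Y12_def\<close>)
  have g: "wgrad U u \<in> Lp 2 U"
    by (rule Lp_cong_AE[OF gL _ US(1)]) (use AE in \<open>auto elim!: eventually_mono\<close>)
  have UM: "U \<in> lmeasurable" using U(1,2) by (simp add: lmeasurable_open)
  show "u \<in> W12 U"
    using W11_locI[OF wU] g Y12_L2_on_finite_measure[OF n \<Omega> UY U(3) UM] by (simp add: W12_def)
  have uL: "u \<in> Lp ?p U"
    by (rule Lp_subset[OF _ U(3) US]) (use UY in \<open>simp add: Y12_def\<close>)
  have Y: "u \<in> Y12 U" using W11_locI[OF wU] g uL by (simp add: Y12_def)
  have le: "Y12_norm U (\<lambda>x. u x - \<phi> k x) \<le> Y12_norm \<Omega> (\<lambda>x. u x - \<phi> k x)" for k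
  proof -
    note sm = Cc_infD(1)[OF \<phi>[of k]]
    have d: "(\<lambda>x. u x - \<phi> k x) \<in> Lp ?p \<Omega>"
      by (rule Lp_diff[OF _ Cc_inf_Lp(1)[OF \<phi>]]) (use UY p US in \<open>auto simp: Y12_def\<close>)
    have dg: "(\<lambda>x. wgrad \<Omega> u x - grad (\<phi> k) x) \<in> Lp 2 \<Omega>"
      by (rule Lp_diff[OF _ Cc_inf_Lp(2)[OF \<phi>]]) (use UY US in \<open>auto simp: Y12_def\<close>)
    have "Lp_norm 2 U (wgrad U (\<lambda>x. u x - \<phi> k x)) = Lp_norm 2 U (\<lambda>x. wgrad \<Omega> u x - grad (\<phi> k) x)"
      by (rule Lp_norm_cong_AE[OF Lp_subset[OF dg U(3) US] _ US(1), symmetric])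
        (use wgrad_diff_smooth_AE[OF U(1) wU sm] in \<open>auto elim!: eventually_mono\<close>)
    also have "\<dots> \<le> Lp_norm 2 \<Omega> (\<lambda>x. wgrad \<Omega> u x - grad (\<phi> k) x)"
      by (rule Lp_norm_subset[OF dg U(3) US]) simp
    also have "\<dots> = Lp_norm 2 \<Omega> (wgrad \<Omega> (\<lambda>x. u x - \<phi> k x))"
      by (rule Lp_norm_cong_AE[OF dg _ US(2)])
        (use wgrad_diff_smooth_AE[OF \<Omega> w\<Omega> sm] in \<open>auto elim!: eventually_mono\<close>)
    finally show ?thesis
      using Lp_norm_subset[OF d U(3) US p(2)] by (simp add: Y12_norm_def)
  qed
  have nonneg: "0 \<le> Y12_norm U v" for v by (simp add: Y12_norm_def Lp_norm_nonneg)
  have "(\<lambda>k. Y12_norm U (\<lambda>x. u x - \<phi> k x)) \<longlonglongrightarrow> 0"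
    by (rule tendsto_sandwich[OF _ _ tendsto_const lim])
      (use le nonneg in \<open>auto intro!: always_eventually\<close>)
  then show "vanishes_on U S u"
    unfolding vanishes_on_def Y12_limit_of_def
    using Y Cc_inf_closure_minus_frontier[OF \<phi> \<Omega> U(3) S U(2)] by blast
qed

section \<open>The energy estimate\<close>

lemma elliptic_adjoint_coeffs:
  fixes A :: "('n::finite, 'm::finite) coeffs"
  assumes "elliptic_coeffs \<nu> A"
  shows "elliptic_coeffs \<nu> (adjoint_coeffs A)"
proof -
  have swap: "(\<Sum>i\<in>UNIV. \<Sum>j\<in>UNIV. \<Sum>\<alpha>\<in>UNIV. \<Sum>\<beta>\<in>UNIV. T j i \<beta> \<alpha>)
      = (\<Sum>i\<in>UNIV. \<Sum>j\<in>UNIV. \<Sum>\<alpha>\<in>UNIV. \<Sum>\<beta>\<in>UNIV. T i j \<alpha> \<beta>)"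
    for T :: "'m \<Rightarrow> 'm \<Rightarrow> 'n \<Rightarrow> 'n \<Rightarrow> real"
    by (subst sum.swap, subst (2) sum.swap) (rule refl)
  have cont: "continuous_on UNIV (transpose :: real^'m^'m \<Rightarrow> real^'m^'m)"
    unfolding transpose_def by (intro continuous_on_vec_lambda continuous_intros)
  show ?thesis
    unfolding elliptic_coeffs_def adjoint_coeffs_def
  proof (intro conjI allI)
    fix \<alpha> \<beta>
    have "A \<beta> \<alpha> \<in> borel_measurable lebesgue" using assms by (simp add: elliptic_coeffs_def)
    then show "(\<lambda>x. transpose (A \<beta> \<alpha> x)) \<in> borel_measurable lebesgue"
      using measurable_compose borel_measurable_continuous_onI[OF cont] by blast
  next
    fix x and \<xi> :: "real^'n^'m"
    have "\<nu> * (norm \<xi>)\<^sup>2 \<le> (\<Sum>i\<in>UNIV. \<Sum>j\<in>UNIV. \<Sum>\<alpha>\<in>UNIV. \<Sum>\<beta>\<in>UNIV. A \<alpha> \<beta> x $ i $ j * \<xi> $ j $ \<beta> * \<xi> $ i $ \<alpha>)"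
      using assms by (simp add: elliptic_coeffs_def)
    also have "\<dots> = (\<Sum>i\<in>UNIV. \<Sum>j\<in>UNIV. \<Sum>\<alpha>\<in>UNIV. \<Sum>\<beta>\<in>UNIV. A \<beta> \<alpha> x $ j $ i * \<xi> $ i $ \<alpha> * \<xi> $ j $ \<beta>)"
      by (rule swap[symmetric])
    finally show "\<nu> * (norm \<xi>)\<^sup>2 \<le> (\<Sum>i\<in>UNIV. \<Sum>j\<in>UNIV. \<Sum>\<alpha>\<in>UNIV. \<Sum>\<beta>\<in>UNIV.
        transpose (A \<beta> \<alpha> x) $ i $ j * \<xi> $ j $ \<beta> * \<xi> $ i $ \<alpha>)"
      by (simp add: transpose_def mult.assoc mult.left_commute mult.commute)
  next
    fix x
    show "(\<Sum>i\<in>UNIV. \<Sum>j\<in>UNIV. \<Sum>\<alpha>\<in>UNIV. \<Sum>\<beta>\<in>UNIV. \<bar>transpose (A \<beta> \<alpha> x) $ i $ j\<bar>\<^sup>2) \<le> 1 / \<nu>\<^sup>2"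
      using assms swap[of "\<lambda>i j \<alpha> \<beta>. \<bar>A \<alpha> \<beta> x $ i $ j\<bar>\<^sup>2"]
      by (simp add: elliptic_coeffs_def transpose_def)
  qed
qed

lemma elliptic_coeffs_entry_bound:
  fixes A :: "('n::finite, 'm::finite) coeffs"
  assumes "elliptic_coeffs \<nu> A" "0 < \<nu>"
  shows "\<bar>A \<alpha> \<beta> x $ i $ j\<bar> \<le> 1 / \<nu>"
proof -
  have "\<bar>A \<alpha> \<beta> x $ i $ j\<bar>\<^sup>2 \<le> (\<Sum>\<beta>\<in>UNIV. \<bar>A \<alpha> \<beta> x $ i $ j\<bar>\<^sup>2)"
    by (rule member_le_sum) auto
  also have "\<dots> \<le> (\<Sum>\<alpha>\<in>UNIV. \<Sum>\<beta>\<in>UNIV. \<bar>A \<alpha> \<beta> x $ i $ j\<bar>\<^sup>2)"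
    by (rule member_le_sum[of \<alpha> UNIV "\<lambda>\<alpha>. \<Sum>\<beta>\<in>UNIV. \<bar>A \<alpha> \<beta> x $ i $ j\<bar>\<^sup>2"]) (auto intro!: sum_nonneg)
  also have "\<dots> \<le> (\<Sum>j\<in>UNIV. \<Sum>\<alpha>\<in>UNIV. \<Sum>\<beta>\<in>UNIV. \<bar>A \<alpha> \<beta> x $ i $ j\<bar>\<^sup>2)"
    by (rule member_le_sum[of j UNIV "\<lambda>j. \<Sum>\<alpha>\<in>UNIV. \<Sum>\<beta>\<in>UNIV. \<bar>A \<alpha> \<beta> x $ i $ j\<bar>\<^sup>2"]) (auto intro!: sum_nonneg)
  also have "\<dots> \<le> (\<Sum>i\<in>UNIV. \<Sum>j\<in>UNIV. \<Sum>\<alpha>\<in>UNIV. \<Sum>\<beta>\<in>UNIV. \<bar>A \<alpha> \<beta> x $ i $ j\<bar>\<^sup>2)"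
    by (rule member_le_sum[of i UNIV "\<lambda>i. \<Sum>j\<in>UNIV. \<Sum>\<alpha>\<in>UNIV. \<Sum>\<beta>\<in>UNIV. \<bar>A \<alpha> \<beta> x $ i $ j\<bar>\<^sup>2"])
      (auto intro!: sum_nonneg)
  also have "\<dots> \<le> (1 / \<nu>)\<^sup>2" using assms(1) by (simp add: elliptic_coeffs_def power_divide)
  finally show ?thesis
    using assms(2) abs_le_square_iff[of "A \<alpha> \<beta> x $ i $ j" "1 / \<nu>"] by simp
qed

lemma coeff_entry_measurable:
  fixes A :: "('n::finite, 'm::finite) coeffs"
  assumes "elliptic_coeffs \<nu> A"
  shows "(\<lambda>x. A \<alpha> \<beta> x $ i $ j) \<in> borel_measurable (lebesgue_on U)"
proof -
  have "A \<alpha> \<beta> \<in> borel_measurable lebesgue" using assms by (simp add: elliptic_coeffs_def)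
  then have "A \<alpha> \<beta> \<in> borel_measurable (lebesgue_on U)" by (rule measurable_restrict_space1)
  moreover have "(\<lambda>M :: real^'m^'m. M $ i $ j) \<in> borel_measurable borel"
    by (intro borel_measurable_continuous_onI continuous_intros)
  ultimately show ?thesis by (rule measurable_compose)
qed

lemma Lp2_component:
  fixes g :: "real^'n \<Rightarrow> real^'k"
  assumes "g \<in> Lp 2 U"
  shows "(\<lambda>x. g x $ \<alpha>) \<in> Lp 2 U"
proof -
  have g: "g \<in> borel_measurable (lebesgue_on U)" "integrable (lebesgue_on U) (\<lambda>x. (norm (g x))\<^sup>2)"
    using assms by (auto simp: Lp2_iff)
  have "(\<lambda>v :: real^'k. v $ \<alpha>) \<in> borel_measurable borel"
    by (intro borel_measurable_continuous_onI continuous_intros)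
  with g(1) have m: "(\<lambda>x. g x $ \<alpha>) \<in> borel_measurable (lebesgue_on U)" by (rule measurable_compose)
  have "integrable (lebesgue_on U) (\<lambda>x. (g x $ \<alpha>)\<^sup>2)"
  proof (rule Bochner_Integration.integrable_bound[OF g(2)])
    show "AE x in lebesgue_on U. norm ((g x $ \<alpha>)\<^sup>2) \<le> norm ((norm (g x))\<^sup>2)"
      using component_le_norm_cart[of "g _" \<alpha>] by (intro AE_I2) (simp add: abs_le_square_iff[symmetric])
  qed (use m in simp)
  with m show ?thesis by (simp add: Lp2_iff)
qed

lemma Lp2_bounded_mult:
  fixes a g :: "real^'n \<Rightarrow> real"
  assumes "g \<in> Lp 2 U" "a \<in> borel_measurable (lebesgue_on U)" "\<And>x. \<bar>a x\<bar> \<le> c"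
  shows "(\<lambda>x. a x * g x) \<in> Lp 2 U"
proof -
  have g: "g \<in> borel_measurable (lebesgue_on U)" "integrable (lebesgue_on U) (\<lambda>x. (g x)\<^sup>2)"
    using assms by (auto simp: Lp2_iff)
  have m: "(\<lambda>x. a x * g x) \<in> borel_measurable (lebesgue_on U)"
    using g(1) assms(2) by (intro borel_measurable_times)
  have "integrable (lebesgue_on U) (\<lambda>x. (a x * g x)\<^sup>2)"
  proof (rule Bochner_Integration.integrable_bound)
    show "integrable (lebesgue_on U) (\<lambda>x. c\<^sup>2 * (g x)\<^sup>2)" using g(2) by simp
    have "(a x)\<^sup>2 \<le> c\<^sup>2" for x
      using power_mono[OF assms(3)[of x] abs_ge_zero, of 2] by simp
    then show "AE x in lebesgue_on U. norm ((a x * g x)\<^sup>2) \<le> norm (c\<^sup>2 * (g x)\<^sup>2)"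
      by (intro AE_I2) (simp add: power_mult_distrib mult_right_mono)
  qed (use m in simp)
  with m show ?thesis by (simp add: Lp2_iff)
qed

lemma norm_sq_component_le:
  fixes g :: "real^'n \<Rightarrow> real^'k"
  assumes "g \<in> Lp 2 U"
  shows "(LINT x|lebesgue_on U. (g x $ \<alpha>)\<^sup>2) \<le> (LINT x|lebesgue_on U. (norm (g x))\<^sup>2)"
  using Lp2_component[OF assms, of \<alpha>] assms
proof (intro integral_mono)
  show "(g x $ \<alpha>)\<^sup>2 \<le> (norm (g x))\<^sup>2" for x
    using power_mono[OF component_le_norm_cart[of "g x" \<alpha>], of 2] by simp
qed (auto simp: Lp2_iff)

text \<open>Testing the equation with (approximations of) the solution itself. The right-hand side is only
  integrated over the ball that carries it, where the Hardy inequality controls the solution by its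
  energy.\<close>

lemma energy_estimate:
  fixes B :: "('n::finite, 'm::finite) coeffs" and u :: "real^'n \<Rightarrow> real^'m" and f :: "real^'n \<Rightarrow> real"
  assumes n: "CARD('n) \<ge> 3" and \<Omega>: "open \<Omega>" and \<nu>: "0 < \<nu>" and B: "elliptic_coeffs \<nu> B"
    and u: "\<And>i. (\<lambda>z. u z $ i) \<in> Y12_0 \<Omega>" and sol: "weak_solution B \<Omega> u (\<lambda>x. axis l (f x))"
    and r: "0 < r" and f: "f \<in> Lp 2 \<Omega>" "\<And>x. x \<notin> ball x0 r \<Longrightarrow> f x = 0"
  shows "\<nu>\<^sup>2 * (\<Sum>i\<in>UNIV. LINT x|lebesgue_on \<Omega>. (norm (wgrad \<Omega> (\<lambda>z. u z $ i) x))\<^sup>2)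
    \<le> 32 * r\<^sup>2 * (LINT x|lebesgue_on \<Omega>. (f x)\<^sup>2)"
proof -
  have "\<exists>\<phi>. (\<lambda>z. u z $ i) \<in> Y12 \<Omega> \<and> (\<forall>k. \<phi> k \<in> Cc_inf \<Omega>) \<and>
      (\<lambda>k. Y12_norm \<Omega> (\<lambda>x. u x $ i - \<phi> k x)) \<longlonglongrightarrow> 0" for i
    using Y12_0E[OF u[of i]] by blast
  then obtain \<psi> where uY: "\<And>i. (\<lambda>z. u z $ i) \<in> Y12 \<Omega>" and \<psi>: "\<And>i k. \<psi> i k \<in> Cc_inf \<Omega>"
    and lim: "\<And>i. (\<lambda>k. Y12_norm \<Omega> (\<lambda>x. u x $ i - \<psi> i k x)) \<longlonglongrightarrow> 0"
    by metis
  have \<Omega>S: "\<Omega> \<in> sets lebesgue" using \<Omega> by (rule open_sets_lebesgue)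
  define w where "w i = wgrad \<Omega> (\<lambda>z. u z $ i)" for i
  have wL: "w i \<in> Lp 2 \<Omega>" for i using uY[of i] by (simp add: Y12_def w_def)
  define S where "S = (\<Sum>i\<in>UNIV. LINT x|lebesgue_on \<Omega>. (norm (w i x))\<^sup>2)"
  define F where "F = (LINT x|lebesgue_on \<Omega>. (f x)\<^sup>2)"
  define g where "g i j \<alpha> \<beta> x = B \<alpha> \<beta> x $ i $ j * w j x $ \<beta>" for i j \<alpha> \<beta> x
  have gL: "g i j \<alpha> \<beta> \<in> Lp 2 \<Omega>" for i j \<alpha> \<beta>
    unfolding g_def
    by (rule Lp2_bounded_mult[OF Lp2_component[OF wL] coeff_entry_measurable[OF B]
          elliptic_coeffs_entry_bound[OF B \<nu>]])
  have pdL: "pd \<alpha> (\<psi> i k) \<in> Lp 2 \<Omega>" for \<alpha> i k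
    by (rule Cc_inf_Lp(1)[OF Cc_inf_pd[OF \<psi>] _ \<Omega>S]) simp
  have pairing: "(\<lambda>k. LINT x|lebesgue_on \<Omega>. g i j \<alpha> \<beta> x * pd \<alpha> (\<psi> i k) x)
      \<longlonglongrightarrow> (LINT x|lebesgue_on \<Omega>. g i j \<alpha> \<beta> x * w i x $ \<alpha>)" for i j \<alpha> \<beta>
  proof (rule L2_pairing_tendsto[OF gL Lp2_component[OF wL] Lp_diff[OF Lp2_component[OF wL] pdL]])
    have d: "(\<lambda>x. w i x - grad (\<psi> i k) x) \<in> Lp 2 \<Omega>" for k
      by (rule Lp_diff[OF wL Cc_inf_Lp(2)[OF \<psi> _ \<Omega>S]]) simp_all
    have lim2: "(\<lambda>k. LINT x|lebesgue_on \<Omega>. (norm (w i x - grad (\<psi> i k) x))\<^sup>2) \<longlonglongrightarrow> 0"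
      unfolding w_def by (rule Y12_norm_diff_tendsto_0D(2)[OF n \<Omega> uY \<psi> lim])
    show "(\<lambda>k. LINT x|lebesgue_on \<Omega>. (w i x $ \<alpha> - pd \<alpha> (\<psi> i k) x)\<^sup>2) \<longlonglongrightarrow> 0"
    proof (rule tendsto_sandwich[OF _ _ tendsto_const lim2])
      show "\<forall>\<^sub>F k in sequentially. (LINT x|lebesgue_on \<Omega>. (w i x $ \<alpha> - pd \<alpha> (\<psi> i k) x)\<^sup>2)
          \<le> (LINT x|lebesgue_on \<Omega>. (norm (w i x - grad (\<psi> i k) x))\<^sup>2)"
        using norm_sq_component_le[OF d, where \<alpha> = \<alpha>] by (intro always_eventually) simp
    qed simp
  qed simp
  have form_k: "weak_form B \<Omega> u (\<lambda>x. \<chi> i. \<psi> i k x)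
      = (\<Sum>i\<in>UNIV. \<Sum>j\<in>UNIV. \<Sum>\<alpha>\<in>UNIV. \<Sum>\<beta>\<in>UNIV. LINT x|lebesgue_on \<Omega>. g i j \<alpha> \<beta> x * pd \<alpha> (\<psi> i k) x)" for k
    using Lp2_mult_integrable[OF gL pdL]
    by (simp add: weak_form_def g_def w_def eta_contract_eq Bochner_Integration.integral_sum)
  have lim_form: "(\<lambda>k. weak_form B \<Omega> u (\<lambda>x. \<chi> i. \<psi> i k x)) \<longlonglongrightarrow>
      (\<Sum>i\<in>UNIV. \<Sum>j\<in>UNIV. \<Sum>\<alpha>\<in>UNIV. \<Sum>\<beta>\<in>UNIV. LINT x|lebesgue_on \<Omega>. g i j \<alpha> \<beta> x * w i x $ \<alpha>)"
    unfolding form_k by (intro tendsto_sum pairing)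
  let ?D = "\<Omega> \<inter> ball x0 r"
  have D: "?D \<subseteq> \<Omega>" "?D \<in> lmeasurable"
    using fmeasurable_Int_fmeasurable[OF lmeasurable_ball[of x0 r] \<Omega>S] by (simp_all add: Int_commute)
  have DS: "?D \<in> sets lebesgue" using D(2) by (simp add: fmeasurableD)
  have fD: "f \<in> Lp 2 ?D" by (rule Lp_subset[OF f(1) D(1) DS \<Omega>S])
  have to_D: "(LINT x|lebesgue_on \<Omega>. f x * v x) = (LINT x|lebesgue_on ?D. f x * v x)" for v
  proof -
    have "(LINT x|lebesgue_on \<Omega>. f x * v x) = (LINT x|lebesgue. indicator \<Omega> x * (f x * v x))"
      using \<Omega>S by (simp add: integral_restrict_space)
    also have "\<dots> = (LINT x|lebesgue. indicator ?D x * (f x * v x))"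
      using f(2) by (intro Bochner_Integration.integral_cong) (auto simp: indicator_def)
    also have "\<dots> = (LINT x|lebesgue_on ?D. f x * v x)"
      using DS by (simp add: integral_restrict_space)
    finally show ?thesis .
  qed
  have uD: "(\<lambda>x. u x $ l) \<in> Lp 2 ?D" by (rule Y12_L2_on_finite_measure[OF n \<Omega> uY D])
  have "weak_form B \<Omega> u (\<lambda>x. \<chi> i. \<psi> i k x) = (LINT x|lebesgue_on ?D. f x * \<psi> l k x)" for k
  proof -
    have "weak_form B \<Omega> u (\<lambda>x. \<chi> i. \<psi> i k x) = (LINT x|lebesgue_on \<Omega>. axis l (f x) \<bullet> (\<chi> i. \<psi> i k x))"
      using sol \<psi> unfolding weak_solution_def vec_all_def by (simp add: eta_contract_eq)
    then show ?thesis by (simp add: inner_axis' to_D)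
  qed
  moreover have "(\<lambda>k. LINT x|lebesgue_on ?D. f x * \<psi> l k x) \<longlonglongrightarrow> (LINT x|lebesgue_on ?D. f x * u x $ l)"
    by (rule L2_pairing_tendsto[OF fD uD Lp_diff[OF uD Cc_inf_Lp(1)[OF \<psi> _ DS]]])
      (use Y12_norm_diff_tendsto_0_imp_L2[OF n \<Omega> uY \<psi> lim D] in simp_all)
  ultimately have form_eq: "(\<Sum>i\<in>UNIV. \<Sum>j\<in>UNIV. \<Sum>\<alpha>\<in>UNIV. \<Sum>\<beta>\<in>UNIV. LINT x|lebesgue_on \<Omega>. g i j \<alpha> \<beta> x * w i x $ \<alpha>)
      = (LINT x|lebesgue_on ?D. f x * u x $ l)"
    using LIMSEQ_unique[OF lim_form] by simp
  have wi: "integrable (lebesgue_on \<Omega>) (\<lambda>x. (norm (w i x))\<^sup>2)" for i using wL by (simp add: Lp2_iff)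
  have gw: "integrable (lebesgue_on \<Omega>) (\<lambda>x. g i j \<alpha> \<beta> x * w i x $ \<alpha>)" for i j \<alpha> \<beta>
    by (rule Lp2_mult_integrable[OF gL Lp2_component[OF wL]])
  have "\<nu> * S = (LINT x|lebesgue_on \<Omega>. \<nu> * (\<Sum>i\<in>UNIV. (norm (w i x))\<^sup>2))"
    using wi by (simp add: S_def)
  also have "\<dots> \<le> (LINT x|lebesgue_on \<Omega>. (\<Sum>i\<in>UNIV. \<Sum>j\<in>UNIV. \<Sum>\<alpha>\<in>UNIV. \<Sum>\<beta>\<in>UNIV. g i j \<alpha> \<beta> x * w i x $ \<alpha>))"
  proof (rule integral_mono)
    fix x
    have ell: "\<nu> * (norm \<xi>)\<^sup>2 \<le> (\<Sum>i\<in>UNIV. \<Sum>j\<in>UNIV. \<Sum>\<alpha>\<in>UNIV. \<Sum>\<beta>\<in>UNIV.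
        B \<alpha> \<beta> x $ i $ j * \<xi> $ j $ \<beta> * \<xi> $ i $ \<alpha>)" for \<xi> :: "real^'n^'m"
      using B unfolding elliptic_coeffs_def by blast
    have nrm: "(norm (\<chi> i. w i x))\<^sup>2 = (\<Sum>i\<in>UNIV. (norm (w i x))\<^sup>2)"
      by (simp add: norm_vec_def L2_set_def sum_nonneg)
    show "\<nu> * (\<Sum>i\<in>UNIV. (norm (w i x))\<^sup>2)
        \<le> (\<Sum>i\<in>UNIV. \<Sum>j\<in>UNIV. \<Sum>\<alpha>\<in>UNIV. \<Sum>\<beta>\<in>UNIV. g i j \<alpha> \<beta> x * w i x $ \<alpha>)"
      using ell[of "\<chi> i. w i x"] unfolding nrm g_def vec_lambda_beta .
  qed (use wi gw in \<open>auto intro!: Bochner_Integration.integrable_sum\<close>)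
  also have "\<dots> = (LINT x|lebesgue_on ?D. f x * u x $ l)"
    using gw by (simp add: Bochner_Integration.integral_sum flip: form_eq)
  also have "\<dots> \<le> sqrt (LINT x|lebesgue_on ?D. (f x)\<^sup>2) * sqrt (LINT x|lebesgue_on ?D. (u x $ l)\<^sup>2)"
    using Cauchy_Schwarz_L2[OF fD uD] by linarith
  also have "\<dots> \<le> sqrt F * sqrt (32 * r\<^sup>2 * S)"
  proof (intro mult_mono real_sqrt_le_mono)
    show "(LINT x|lebesgue_on ?D. (f x)\<^sup>2) \<le> F"
      unfolding F_def using f(1) by (intro integral_lebesgue_on_mono_set[OF _ D(1) DS \<Omega>S]) (auto simp: Lp2_iff)
    have "(LINT x|lebesgue_on ?D. (u x $ l)\<^sup>2) \<le> 32 * r\<^sup>2 * (LINT x|lebesgue_on \<Omega>. (norm (w l x))\<^sup>2)"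
      unfolding w_def by (rule Hardy_inequality_Y12_0[OF n \<Omega> u r])
    also have "\<dots> \<le> 32 * r\<^sup>2 * S"
      unfolding S_def by (intro mult_left_mono member_le_sum) auto
    finally show "(LINT x|lebesgue_on ?D. (u x $ l)\<^sup>2) \<le> 32 * r\<^sup>2 * S" .
  qed (auto simp: F_def)
  finally have "\<nu> * S \<le> sqrt (F * (32 * r\<^sup>2 * S))" by (simp add: real_sqrt_mult)
  moreover have S0: "0 \<le> S" and F0: "0 \<le> F" by (auto simp: S_def F_def intro: sum_nonneg)
  ultimately have "(\<nu> * S)\<^sup>2 \<le> F * (32 * r\<^sup>2 * S)"
    using \<nu> power_mono[of "\<nu> * S" "sqrt (F * (32 * r\<^sup>2 * S))" 2] by simp
  then have "S * (\<nu>\<^sup>2 * S) \<le> S * (32 * r\<^sup>2 * F)"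
    by (simp add: power2_eq_square mult_ac)
  then have "\<nu>\<^sup>2 * S \<le> 32 * r\<^sup>2 * F"
    using S0 F0 by (cases "S = 0") (auto simp: mult_le_cancel_left)
  then show ?thesis by (simp add: S_def F_def w_def)
qed

section \<open>Consequences of local boundedness\<close>

text \<open>Off \<open>U\<close> the integrand vanishes together with the gradient of \<open>\<phi>\<close>, and on \<open>U\<close> the two weak
  gradients of \<open>u\<close> agree almost everywhere.\<close>

lemma weak_form_subset:
  fixes B :: "('n::finite, 'm::finite) coeffs" and u :: "real^'n \<Rightarrow> real^'m"
  assumes B: "elliptic_coeffs \<nu> B" and U: "open U" "open \<Omega>" "U \<subseteq> \<Omega>"
    and w: "\<And>j. wgrad U (\<lambda>z. u z $ j) \<in> Lp 2 U"
    and AE: "\<And>j. AE x in lebesgue_on U. wgrad U (\<lambda>z. u z $ j) x = wgrad \<Omega> (\<lambda>z. u z $ j) x"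
    and \<phi>: "vec_all (\<lambda>\<psi>. \<psi> \<in> Cc_inf U) \<phi>"
  shows "weak_form B U u \<phi> = weak_form B \<Omega> u \<phi>"
proof -
  have \<phi>i: "(\<lambda>z. \<phi> z $ i) \<in> Cc_inf U" for i using \<phi> by (simp add: vec_all_def)
  have US: "U \<in> sets lebesgue" "\<Omega> \<in> sets lebesgue" using U by (auto intro: open_sets_lebesgue)
  define h where "h v x = (\<Sum>i\<in>UNIV. \<Sum>j\<in>UNIV. \<Sum>\<alpha>\<in>UNIV. \<Sum>\<beta>\<in>UNIV.
      B \<alpha> \<beta> x $ i $ j * v j x $ \<beta> * pd \<alpha> (\<lambda>z. \<phi> z $ i) x)" for v :: "'m \<Rightarrow> real^'n \<Rightarrow> real^'n" and x
  let ?w\<Omega> = "\<lambda>j. wgrad \<Omega> (\<lambda>z. u z $ j)" and ?wU = "\<lambda>j. wgrad U (\<lambda>z. u z $ j)"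
  have meas: "h v \<in> borel_measurable (lebesgue_on U)"
    if v: "\<And>j. v j \<in> borel_measurable (lebesgue_on U)" for v
  proof -
    have "pd \<alpha> (\<lambda>z. \<phi> z $ i) \<in> borel_measurable (lebesgue_on U)" for \<alpha> i
      by (rule continuous_imp_measurable_on_sets_lebesgue[OF smooth_continuous[OF smooth_pd[OF Cc_infD(1)[OF \<phi>i]]] US(1)])
    moreover have "(\<lambda>x. v j x $ \<beta>) \<in> borel_measurable (lebesgue_on U)" for j \<beta>
      by (rule measurable_compose[OF v]) (intro borel_measurable_continuous_onI continuous_intros)
    ultimately show ?thesis
      unfolding h_def
      by (intro borel_measurable_sum borel_measurable_times coeff_entry_measurable[OF B])
  qed
  have wU: "?wU j \<in> borel_measurable (lebesgue_on U)" for j using w[of j] by (simp add: Lp2_iff)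
  have w\<Omega>: "?w\<Omega> j \<in> borel_measurable (lebesgue_on U)" for j
    by (rule borel_measurable_lebesgue_on_AE[OF wU AE US(1)])
  have "AE x in lebesgue_on U. \<forall>j. ?wU j x = ?w\<Omega> j x"
    using AE by (subst AE_all_countable) blast
  then have "AE x in lebesgue_on U. h ?wU x = h ?w\<Omega> x"
    by eventually_elim (simp add: h_def)
  then have "(LINT x|lebesgue_on U. h ?wU x) = (LINT x|lebesgue_on U. h ?w\<Omega> x)"
    by (rule integral_cong_AE[OF meas[of ?wU, OF wU] meas[of ?w\<Omega>, OF w\<Omega>]])
  also have "\<dots> = (LINT x|lebesgue. h ?w\<Omega> x)"
    using Cc_inf_pd_eq_0[OF \<phi>i] by (intro integral_lebesgue_on_eq US) (simp add: h_def)
  also have "\<dots> = (LINT x|lebesgue_on \<Omega>. h ?w\<Omega> x)"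
    using Cc_inf_pd_eq_0[OF Cc_inf_mono[OF \<phi>i U(3)]]
    by (intro integral_lebesgue_on_eq[symmetric] US) (simp add: h_def)
  finally show ?thesis by (simp add: weak_form_def h_def)
qed

lemma Linf_AE_le_norm:
  fixes u :: "real^'n \<Rightarrow> 'b::euclidean_space"
  assumes "u \<in> Linf V"
  shows "AE x in lebesgue_on V. norm (u x) \<le> Linf_norm V u"
proof -
  let ?E = "esssup (lebesgue_on V) (\<lambda>x. ereal (norm (u x)))"
  obtain c where "u \<in> borel_measurable (lebesgue_on V)" and c: "AE x in lebesgue_on V. norm (u x) \<le> c"
    using assms by (auto simp: Linf_def)
  then have m: "(\<lambda>x. ereal (norm (u x))) \<in> borel_measurable (lebesgue_on V)" by measurable
  have "?E \<le> ereal c" using m c by (intro esssup_I) auto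
  moreover have "AE x in lebesgue_on V. ereal (norm (u x)) \<le> ?E" by (rule esssup_AE)
  ultimately show ?thesis
    by (cases ?E) (auto simp: Linf_norm_def elim!: eventually_mono)
qed

lemma Linf_norm_zero:
  assumes "open V" "V \<noteq> {}"
  shows "Linf_norm V (\<lambda>x. 0 :: 'b::euclidean_space) = 0"
proof -
  have "V \<notin> null_sets lebesgue"
    using assms open_not_negligible negligible_iff_null_sets by blast
  then have "emeasure (lebesgue_on V) (space (lebesgue_on V)) \<noteq> 0"
    using open_sets_lebesgue[OF assms(1)] by (auto simp: emeasure_restrict_space null_sets_def)
  then show ?thesis by (simp add: Linf_norm_def esssup_const)
qed

text \<open>For functions in \<open>Y12_0 \<Omega>\<close> the boundary condition in the definition of local boundedness holds
  on every ball.\<close>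

lemma local_boundedness_homogeneous:
  fixes A :: "('n::finite, 'm::finite) coeffs" and v :: "real^'n \<Rightarrow> real^'m"
  assumes n: "CARD('n) \<ge> 3" and \<Omega>: "open \<Omega>" and lb: "local_boundedness A \<Omega> Rmax N\<^sub>0"
    and x: "x \<in> \<Omega>" and R: "0 < R" "ereal R < Rmax"
    and v: "\<And>i. (\<lambda>z. v z $ i) \<in> Y12_0 \<Omega>"
    and sol: "weak_solution A (\<Omega> \<inter> ball x R) v (\<lambda>z. 0)
      \<or> weak_solution (adjoint_coeffs A) (\<Omega> \<inter> ball x R) v (\<lambda>z. 0)"
  shows "AE z in lebesgue_on (\<Omega> \<inter> ball x (R / 2)).
    norm (v z) \<le> N\<^sub>0 * (R powr (- real CARD('n) / 2) * sqrt (\<Sum>i\<in>UNIV. LINT z|lebesgue_on (\<Omega> \<inter> ball x R). (v z $ i)\<^sup>2))"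
proof -
  let ?U = "\<Omega> \<inter> ball x R"
  have U: "open ?U" "bounded ?U" "?U \<subseteq> \<Omega>" "?U \<noteq> {}" using \<Omega> x R(1) by auto
  have S: "frontier \<Omega> \<inter> ball x R \<subseteq> frontier \<Omega>" by blast
  have W: "vec_all (\<lambda>w. w \<in> W12 ?U) v" "vec_all (vanishes_on ?U (frontier \<Omega> \<inter> ball x R)) v"
    unfolding vec_all_def using Y12_0_restrict(2,3)[OF n \<Omega> v U(1-3) S] by blast+
  have "(\<lambda>z::real^'n. 0 :: real^'m) \<in> Linf ?U" by (auto simp: Linf_def)
  with lb x R W sol have "v \<in> Linf (\<Omega> \<inter> ball x (R / 2))"
    and le: "Linf_norm (\<Omega> \<inter> ball x (R / 2)) v \<le> N\<^sub>0 * (R powr (- real CARD('n) / 2) * Lp_norm 2 ?U v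
        + R\<^sup>2 * Linf_norm ?U (\<lambda>z. 0 :: real^'m))"
    unfolding local_boundedness_def by blast+
  have "(LINT z|lebesgue_on ?U. (norm (v z))\<^sup>2) = (\<Sum>i\<in>UNIV. LINT z|lebesgue_on ?U. (v z $ i)\<^sup>2)"
  proof -
    have "integrable (lebesgue_on ?U) (\<lambda>z. (v z $ i)\<^sup>2)" for i
      using W(1) by (simp add: vec_all_def W12_def Lp2_iff)
    moreover have "(norm (v z))\<^sup>2 = (\<Sum>i\<in>UNIV. (v z $ i)\<^sup>2)" for z
      by (simp add: norm_vec_def L2_set_def sum_nonneg)
    ultimately show ?thesis by simp
  qed
  then have "Lp_norm 2 ?U v = sqrt (\<Sum>i\<in>UNIV. LINT z|lebesgue_on ?U. (v z $ i)\<^sup>2)"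
    by (simp add: Lp2_norm_eq)
  with le have "Linf_norm (\<Omega> \<inter> ball x (R / 2)) v
      \<le> N\<^sub>0 * (R powr (- real CARD('n) / 2) * sqrt (\<Sum>i\<in>UNIV. LINT z|lebesgue_on ?U. (v z $ i)\<^sup>2))"
    by (simp add: Linf_norm_zero[OF U(1,4)])
  with Linf_AE_le_norm[OF \<open>v \<in> Linf _\<close>] show ?thesis
    by (auto elim!: eventually_mono)
qed

section \<open>A countable norming family of step functions\<close>

lemma nonneg_le_tendsto_0:
  fixes a b :: "nat \<Rightarrow> real"
  assumes "\<And>k. 0 \<le> a k" "\<And>k. a k \<le> b k" "b \<longlonglongrightarrow> 0"
  shows "a \<longlonglongrightarrow> 0"
  by (rule tendsto_sandwich[OF always_eventually[OF allI] always_eventually[OF allI] tendsto_const assms(3)])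
    (rule assms)+

text \<open>Finite unions of rational boxes. Compactness lets a step function over members that lie in an
  open set have compact support in that set.\<close>

lemma countable_compact_exhausting_family:
  obtains \<D> :: "(real^'n) set set" where "countable \<D>" "\<And>D. D \<in> \<D> \<Longrightarrow> compact D"
    "\<And>V. open V \<Longrightarrow> \<exists>D. (\<forall>k::nat. D k \<in> \<D> \<and> D k \<subseteq> V) \<and> (\<forall>x\<in>V. \<exists>k. \<forall>j\<ge>k. x \<in> D j)"
proof -
  define a :: "(real^'n \<Rightarrow> real \<times> real) \<Rightarrow> real^'n" where "a f = (\<Sum>i\<in>Basis. fst (f i) *\<^sub>R i)" for f
  define b :: "(real^'n \<Rightarrow> real \<times> real) \<Rightarrow> real^'n" where "b f = (\<Sum>i\<in>Basis. snd (f i) *\<^sub>R i)" for f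
  define \<B> where "\<B> = (\<lambda>f. cbox (a f) (b f)) ` (Basis \<rightarrow>\<^sub>E \<rat> \<times> \<rat>)"
  have cB: "countable \<B>"
    unfolding \<B>_def
    by (rule countable_image, rule countable_PiE[OF finite_Basis], rule countable_SIGMA) (rule countable_rat)+
  have union: "\<exists>B\<in>\<B>. x \<in> B \<and> B \<subseteq> V" if "open V" "x \<in> V" for V x
  proof -
    have "V = (\<Union>f\<in>{f \<in> Basis \<rightarrow>\<^sub>E \<rat> \<times> \<rat>. cbox (a f) (b f) \<subseteq> V}. cbox (a f) (b f))"
      using open_UNION_cbox[OF that(1)] by (simp only: a_def b_def)
    then have "x \<in> (\<Union>f\<in>{f \<in> Basis \<rightarrow>\<^sub>E \<rat> \<times> \<rat>. cbox (a f) (b f) \<subseteq> V}. cbox (a f) (b f))"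
      using that(2) by (rule subst)
    then obtain f where "f \<in> Basis \<rightarrow>\<^sub>E \<rat> \<times> \<rat>" "cbox (a f) (b f) \<subseteq> V" "x \<in> cbox (a f) (b f)"
      by (elim UN_E CollectE conjE)
    then show ?thesis unfolding \<B>_def by (intro bexI[of _ "cbox (a f) (b f)"] conjI imageI)
  qed
  have "\<B> \<noteq> {}" using union[OF open_UNIV, of 0] by auto
  define e where "e = from_nat_into \<B>"
  have e: "range e = \<B>" unfolding e_def using \<open>\<B> \<noteq> {}\<close> cB by (rule range_from_nat_into)
  define \<D> where "\<D> = \<Union> ` {F. finite F \<and> F \<subseteq> \<B>}"
  show thesis
  proof (rule that[of \<D>])
    show "countable \<D>"
      unfolding \<D>_def using cB by (intro countable_image countable_Collect_finite_subset)
    show "compact D" if "D \<in> \<D>" for D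
      using that unfolding \<D>_def \<B>_def by (auto intro!: compact_Union)
    fix V :: "(real^'n) set" assume V: "open V"
    define D where "D k = \<Union> (e ` {i. i < k \<and> e i \<subseteq> V})" for k :: nat
    have "D k \<in> \<D>" for k
      unfolding \<D>_def D_def using e by (intro imageI) auto
    moreover have "D k \<subseteq> V" for k by (auto simp: D_def)
    moreover have "\<exists>k. \<forall>j\<ge>k. x \<in> D j" if x: "x \<in> V" for x
    proof -
      obtain B where B: "B \<in> \<B>" "x \<in> B" "B \<subseteq> V" using union[OF V x] by blast
      then obtain i where i: "B = e i" using e by (metis imageE)
      have "x \<in> D j" if "j \<ge> Suc i" for j
        using that B i by (auto simp: D_def intro!: exI[of _ i])
      then show ?thesis by blast
    qed
    ultimately show "\<exists>D. (\<forall>k::nat. D k \<in> \<D> \<and> D k \<subseteq> V) \<and> (\<forall>x\<in>V. \<exists>k. \<forall>j\<ge>k. x \<in> D j)"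
      by blast
  qed
qed

definition step_fun :: "(real \<times> 'a set) list \<Rightarrow> 'a \<Rightarrow> real" where
  "step_fun L x = (\<Sum>(q, D)\<leftarrow>L. q * indicator D x)"

lemma step_fun_Nil [simp]: "step_fun [] x = 0"
  and step_fun_Cons [simp]: "step_fun ((q, D) # L) x = q * indicator D x + step_fun L x"
  and step_fun_append: "step_fun (L @ M) x = step_fun L x + step_fun M x"
  by (simp_all add: step_fun_def)

lemma step_fun_scale: "step_fun (map (\<lambda>(q, D). (c * q, D)) L) x = c * step_fun L x"
  by (induction L) (auto simp: algebra_simps)

lemma step_fun_support: "L \<in> lists (Q \<times> {D. D \<subseteq> V}) \<Longrightarrow> x \<notin> V \<Longrightarrow> step_fun L x = 0"
  by (induction L rule: list.induct) (auto simp: indicator_def)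

lemma step_fun_bounded: "\<exists>c. \<forall>x. \<bar>step_fun L x\<bar> \<le> c"
proof (induction L)
  case (Cons p L)
  then obtain c where c: "\<forall>x. \<bar>step_fun L x\<bar> \<le> c" by blast
  obtain q D where p: "p = (q, D)" by (cases p)
  have "\<bar>step_fun (p # L) x\<bar> \<le> \<bar>q\<bar> + c" for x
  proof -
    have "\<bar>q * indicator D x\<bar> \<le> \<bar>q\<bar>" by (simp add: indicator_def)
    then show ?thesis using c[rule_format, of x] by (simp add: p)
  qed
  then show ?case by blast
qed auto

lemma step_fun_measurable:
  "(\<And>q D. (q, D) \<in> set L \<Longrightarrow> D \<in> sets M) \<Longrightarrow> step_fun L \<in> borel_measurable M"
proof (induction L)
  case (Cons p L)
  obtain q D where p: "p = (q, D)" by (cases p)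
  have "D \<in> sets M" using Cons.prems[of q D] p by simp
  moreover have "D' \<in> sets M" if "(q', D') \<in> set L" for q' D'
    using Cons.prems[of q' D'] that by simp
  then have "step_fun L \<in> borel_measurable M" by (rule Cons.IH)
  ultimately have "(\<lambda>x. q * indicator D x + step_fun L x) \<in> borel_measurable M" by measurable
  then show ?case by (simp add: p)
next
  case Nil
  have "step_fun [] = (\<lambda>x :: 'a. 0)" by (simp add: fun_eq_iff)
  then show ?case by simp
qed

lemma bounded_in_Lp2:
  fixes f :: "real^'n \<Rightarrow> real"
  assumes "V \<in> lmeasurable" "f \<in> borel_measurable (lebesgue_on V)" "\<And>x. \<bar>f x\<bar> \<le> c"
  shows "f \<in> Lp 2 V"
proof -
  interpret finite_measure "lebesgue_on V" using assms(1) by (rule finite_measure_lebesgue_on)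
  have "integrable (lebesgue_on V) (\<lambda>x. (f x)\<^sup>2)"
  proof (rule integrable_const_bound[where B = "c\<^sup>2"])
    have "(f x)\<^sup>2 \<le> c\<^sup>2" for x using power_mono[OF assms(3)[of x] abs_ge_zero, of 2] by simp
    then show "AE x in lebesgue_on V. norm ((f x)\<^sup>2) \<le> c\<^sup>2" by (intro AE_I2) simp
  qed (use assms(2) in simp)
  then show ?thesis using assms(2) by (simp add: Lp2_iff)
qed

lemma L2_dominated_tendsto:
  fixes f :: "real^'n \<Rightarrow> real"
  assumes h: "h \<in> Lp 2 V" and m: "f \<in> borel_measurable (lebesgue_on V)" "\<And>k. F k \<in> borel_measurable (lebesgue_on V)"
    and lim: "AE x in lebesgue_on V. (\<lambda>k. F k x) \<longlonglongrightarrow> f x"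
    and bound: "\<And>k x. x \<in> V \<Longrightarrow> \<bar>f x - F k x\<bar> \<le> \<bar>h x\<bar>"
  shows "(\<lambda>k. LINT x|lebesgue_on V. (f x - F k x)\<^sup>2) \<longlonglongrightarrow> 0"
proof -
  have "(\<lambda>k. LINT x|lebesgue_on V. (f x - F k x)\<^sup>2) \<longlonglongrightarrow> (LINT x|lebesgue_on V. 0)"
  proof (rule integral_dominated_convergence[where w = "\<lambda>x. (h x)\<^sup>2"])
    show "integrable (lebesgue_on V) (\<lambda>x. (h x)\<^sup>2)" using h by (simp add: Lp2_iff)
    show "(\<lambda>x. (f x - F k x)\<^sup>2) \<in> borel_measurable (lebesgue_on V)" for k using m by measurable
    show "AE x in lebesgue_on V. (\<lambda>k. (f x - F k x)\<^sup>2) \<longlonglongrightarrow> 0"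
      using lim
    proof eventually_elim
      case (elim x)
      have "(\<lambda>k. (f x - F k x)\<^sup>2) \<longlonglongrightarrow> (f x - f x)\<^sup>2" by (intro tendsto_intros elim)
      then show ?case by simp
    qed
    have "(f x - F k x)\<^sup>2 \<le> (h x)\<^sup>2" if "x \<in> V" for k x
      using power_mono[OF bound[OF that, of k] abs_ge_zero, of 2] by simp
    then show "AE x in lebesgue_on V. norm ((f x - F k x)\<^sup>2) \<le> (h x)\<^sup>2" for k
      by (intro AE_I2) simp
  qed simp
  then show ?thesis by simp
qed

definition L2_approximable :: "(real^'n) set set \<Rightarrow> (real^'n) set \<Rightarrow> (real^'n \<Rightarrow> real) \<Rightarrow> bool" where
  "L2_approximable \<D> V f \<longleftrightarrow> f \<in> Lp 2 V \<and>
     (\<exists>L. (\<forall>k::nat. L k \<in> lists (\<rat> \<times> {D\<in>\<D>. D \<subseteq> V})) \<and>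
          (\<lambda>k. LINT x|lebesgue_on V. (f x - step_fun (L k) x)\<^sup>2) \<longlonglongrightarrow> 0)"

lemma L2_approximableI:
  assumes "f \<in> Lp 2 V" "\<And>k::nat. L k \<in> lists (\<rat> \<times> {D\<in>\<D>. D \<subseteq> V})"
    and "(\<lambda>k. LINT x|lebesgue_on V. (f x - step_fun (L k) x)\<^sup>2) \<longlonglongrightarrow> 0"
  shows "L2_approximable \<D> V f"
  unfolding L2_approximable_def using assms by (intro conjI exI[of _ L] allI)

lemma step_fun_measurable_lebesgue_on:
  fixes \<D> :: "(real^'n) set set"
  assumes "\<And>D. D \<in> \<D> \<Longrightarrow> compact D" "L \<in> lists (\<rat> \<times> {D\<in>\<D>. D \<subseteq> V})"
  shows "step_fun L \<in> borel_measurable (lebesgue_on T)"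
proof (rule measurable_restrict_space1, rule step_fun_measurable)
  fix q D assume "(q, D) \<in> set L"
  then have "D \<in> \<D>" using assms(2) by (auto simp: lists_eq_set)
  then show "D \<in> sets lebesgue" using assms(1)[of D] by (simp add: borel_compact)
qed

lemma step_fun_Lp2:
  fixes \<D> :: "(real^'n) set set"
  assumes "\<And>D. D \<in> \<D> \<Longrightarrow> compact D" "L \<in> lists (\<rat> \<times> {D\<in>\<D>. D \<subseteq> V})" "T \<in> lmeasurable"
  shows "step_fun L \<in> Lp 2 T"
  using step_fun_bounded[of L] bounded_in_Lp2[OF assms(3) step_fun_measurable_lebesgue_on[OF assms(1,2)]]
  by blast

text \<open>The closure of the rational step functions contains the indicators of open sets, which are
  exhausted by members of \<open>\<D>\<close>; hence by outer regularity those of measurable sets; hence the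
  simple functions.\<close>

lemma step_functions_dense_in_L2:
  fixes V :: "(real^'n) set"
  assumes V: "open V" "V \<in> lmeasurable" and \<D>: "\<And>D. D \<in> \<D> \<Longrightarrow> compact D"
    and exh: "\<And>V. open V \<Longrightarrow> \<exists>D. (\<forall>k::nat. D k \<in> \<D> \<and> D k \<subseteq> V) \<and> (\<forall>x\<in>V. \<exists>k. \<forall>j\<ge>k. x \<in> D j)"
    and f: "f \<in> Lp 2 V"
  shows "L2_approximable \<D> V f"
proof -
  let ?M = "lebesgue_on V" and ?\<L> = "lists (\<rat> \<times> {D\<in>\<D>. D \<subseteq> V}) :: (real \<times> (real^'n) set) list set"
  have VS: "V \<in> sets lebesgue" using V(1) by (rule open_sets_lebesgue)
  have meas: "step_fun L \<in> borel_measurable ?M" if "L \<in> ?\<L>" for L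
    by (rule step_fun_measurable_lebesgue_on[OF \<D> that])
  have stepL: "step_fun L \<in> Lp 2 V" if "L \<in> ?\<L>" for L
    by (rule step_fun_Lp2[OF \<D> that V(2)])
  have twice: "(LINT x|?M. (a x)\<^sup>2) \<le> 2 * (LINT x|?M. (b x)\<^sup>2) + 2 * (LINT x|?M. (a x - b x)\<^sup>2)"
    if "a \<in> Lp 2 V" "b \<in> Lp 2 V" for a b :: "real^'n \<Rightarrow> real"
    using L2_norm_sq_le_twice[OF that] by simp
  have ind_meas: "(indicator S :: real^'n \<Rightarrow> real) \<in> borel_measurable ?M" if "S \<in> sets lebesgue" for S
    using that by (intro measurable_restrict_space1 borel_measurable_indicator)
  have indL: "(indicator S :: real^'n \<Rightarrow> real) \<in> Lp 2 V" if "S \<in> sets lebesgue" for S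
    by (rule bounded_in_Lp2[OF V(2) ind_meas[OF that], of 1]) (simp add: indicator_def)
  have oneL: "(\<lambda>x. 1 :: real) \<in> Lp 2 V"
    by (rule bounded_in_Lp2[OF V(2), of _ 1]) auto
  have app_limit: "L2_approximable \<D> V f"
    if f: "f \<in> Lp 2 V" and F: "\<And>k::nat. L2_approximable \<D> V (F k)"
      and lim: "(\<lambda>k. LINT x|?M. (f x - F k x)\<^sup>2) \<longlonglongrightarrow> 0" for f F
  proof -
    have FL: "F k \<in> Lp 2 V" for k using F by (simp add: L2_approximable_def)
    have "\<exists>L. L \<in> ?\<L> \<and> (LINT x|?M. (F k x - step_fun L x)\<^sup>2) < inverse (Suc k)" for k
    proof -
      obtain L where "\<forall>k::nat. L k \<in> ?\<L>"
        and "(\<lambda>j. LINT x|?M. (F k x - step_fun (L j) x)\<^sup>2) \<longlonglongrightarrow> 0"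
        using F[of k] unfolding L2_approximable_def by blast
      moreover from this(2) have "\<forall>\<^sub>F j in sequentially. (LINT x|?M. (F k x - step_fun (L j) x)\<^sup>2) < inverse (Suc k)"
        by (rule order_tendstoD(2)) simp
      ultimately show ?thesis by (meson eventually_sequentially le_refl)
    qed
    then have "\<exists>L. \<forall>k. L k \<in> ?\<L> \<and> (LINT x|?M. (F k x - step_fun (L k) x)\<^sup>2) < inverse (Suc k)"
      by (intro choice allI)
    then obtain L where L': "\<forall>k. L k \<in> ?\<L> \<and> (LINT x|?M. (F k x - step_fun (L k) x)\<^sup>2) < inverse (Suc k)" ..
    have L: "L k \<in> ?\<L>" and Llt: "(LINT x|?M. (F k x - step_fun (L k) x)\<^sup>2) < inverse (Suc k)" for k
      by (rule conjunct1[OF spec[OF L']] conjunct2[OF spec[OF L']])+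
    have le: "(LINT x|?M. (f x - step_fun (L k) x)\<^sup>2) \<le> 2 * (LINT x|?M. (f x - F k x)\<^sup>2) + 2 * inverse (Suc k)" for k
      using twice[OF Lp_diff[OF f stepL[OF L[of k]]] Lp_diff[OF f FL[of k]]] Llt[of k] by simp
    have "(\<lambda>k. 2 * (LINT x|?M. (f x - F k x)\<^sup>2) + 2 * inverse (real (Suc k))) \<longlonglongrightarrow> 2 * 0 + 2 * 0"
      by (intro tendsto_intros lim LIMSEQ_inverse_real_of_nat)
    then have "(\<lambda>k. 2 * (LINT x|?M. (f x - F k x)\<^sup>2) + 2 * inverse (real (Suc k))) \<longlonglongrightarrow> 0" by simp
    then have "(\<lambda>k. LINT x|?M. (f x - step_fun (L k) x)\<^sup>2) \<longlonglongrightarrow> 0"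
      by (rule nonneg_le_tendsto_0[rotated 2, OF _ _ le]) (rule Bochner_Integration.integral_nonneg, simp)
    then show ?thesis by (rule L2_approximableI[OF f L])
  qed
  have app_add: "L2_approximable \<D> V (\<lambda>x. f x + g x)"
    if app: "L2_approximable \<D> V f" "L2_approximable \<D> V g" for f g
  proof -
    obtain L M where L: "\<And>k::nat. L k \<in> ?\<L>" "(\<lambda>k. LINT x|?M. (f x - step_fun (L k) x)\<^sup>2) \<longlonglongrightarrow> 0"
      and M: "\<And>k::nat. M k \<in> ?\<L>" "(\<lambda>k. LINT x|?M. (g x - step_fun (M k) x)\<^sup>2) \<longlonglongrightarrow> 0"
      and fg: "f \<in> Lp 2 V" "g \<in> Lp 2 V"
      using app unfolding L2_approximable_def by blast
    have "(\<lambda>x. 0) \<in> Lp 2 V" by (simp add: Lp2_iff)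
    from Lp_diff[OF fg(1) Lp_diff[OF this fg(2)]] have sumL: "(\<lambda>x. f x + g x) \<in> Lp 2 V" by simp
    have LM: "L k @ M k \<in> ?\<L>" for k using L(1)[of k] M(1)[of k] by simp
    have le: "(LINT x|?M. (f x + g x - step_fun (L k @ M k) x)\<^sup>2)
        \<le> 2 * (LINT x|?M. (f x - step_fun (L k) x)\<^sup>2) + 2 * (LINT x|?M. (g x - step_fun (M k) x)\<^sup>2)" for k
    proof -
      have "f x + g x - step_fun (L k @ M k) x - (f x - step_fun (L k) x) = g x - step_fun (M k) x" for x
        by (simp add: step_fun_append)
      then show ?thesis
        using twice[OF Lp_diff[OF sumL stepL[OF LM[of k]]] Lp_diff[OF fg(1) stepL[OF L(1)[of k]]]] by simp
    qed
    have "(\<lambda>k. 2 * (LINT x|?M. (f x - step_fun (L k) x)\<^sup>2) + 2 * (LINT x|?M. (g x - step_fun (M k) x)\<^sup>2)) \<longlonglongrightarrow> 2 * 0 + 2 * 0"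
      by (intro tendsto_intros L M)
    then have "(\<lambda>k. 2 * (LINT x|?M. (f x - step_fun (L k) x)\<^sup>2) + 2 * (LINT x|?M. (g x - step_fun (M k) x)\<^sup>2)) \<longlonglongrightarrow> 0"
      by simp
    then have "(\<lambda>k. LINT x|?M. (f x + g x - step_fun (L k @ M k) x)\<^sup>2) \<longlonglongrightarrow> 0"
      by (rule nonneg_le_tendsto_0[rotated 2, OF _ _ le]) (rule Bochner_Integration.integral_nonneg, simp)
    then show ?thesis by (rule L2_approximableI[OF sumL LM])
  qed
  have scaleL: "(\<lambda>x. c * f x) \<in> Lp 2 V" if "f \<in> Lp 2 V" for c and f :: "real^'n \<Rightarrow> real"
    using Lp2_bounded_mult[OF that, of "\<lambda>x. c" "\<bar>c\<bar>"] by simp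
  have app_rat: "L2_approximable \<D> V (\<lambda>x. q * f x)" if f: "L2_approximable \<D> V f" and q: "q \<in> \<rat>" for f q
  proof -
    obtain L where L: "\<And>k::nat. L k \<in> ?\<L>" "(\<lambda>k. LINT x|?M. (f x - step_fun (L k) x)\<^sup>2) \<longlonglongrightarrow> 0"
      and fL: "f \<in> Lp 2 V"
      using f unfolding L2_approximable_def by blast
    define L' where "L' k = map (\<lambda>(r, D). (q * r, D)) (L k)" for k
    have L': "L' k \<in> ?\<L>" for k
      using L(1)[of k] q by (auto simp: L'_def lists_eq_set)
    have "(\<lambda>k. LINT x|?M. (q * f x - step_fun (L' k) x)\<^sup>2) \<longlonglongrightarrow> 0"
    proof -
      have "(q * f x - step_fun (L' k) x)\<^sup>2 = q\<^sup>2 * (f x - step_fun (L k) x)\<^sup>2" for k x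
        by (simp add: L'_def step_fun_scale power_mult_distrib flip: right_diff_distrib)
      then show ?thesis using tendsto_mult_right_zero[OF L(2), of "q\<^sup>2"] by simp
    qed
    then show ?thesis by (rule L2_approximableI[OF scaleL[OF fL] L'])
  qed
  have app_scale: "L2_approximable \<D> V (\<lambda>x. c * f x)" if f: "L2_approximable \<D> V f" for f c
  proof -
    have fL: "f \<in> Lp 2 V" using f by (simp add: L2_approximable_def)
    have "\<exists>q\<in>\<rat>. c < q \<and> q < c + inverse (Suc k)" for k
      by (rule Rats_dense_in_real) simp
    then have "\<exists>q. \<forall>k. q k \<in> \<rat> \<and> c < q k \<and> q k < c + inverse (Suc k)"
      by (intro choice allI) blast
    then obtain q where "\<forall>k. q k \<in> \<rat> \<and> c < q k \<and> q k < c + inverse (Suc k)" ..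
    then have q: "q k \<in> \<rat>" "c < q k" "q k < c + inverse (Suc k)" for k by blast+
    have "(\<lambda>k. c + inverse (real (Suc k))) \<longlonglongrightarrow> c + 0"
      by (intro tendsto_intros LIMSEQ_inverse_real_of_nat)
    then have up: "(\<lambda>k. c + inverse (real (Suc k))) \<longlonglongrightarrow> c" by simp
    have "q \<longlonglongrightarrow> c"
      by (rule tendsto_sandwich[OF always_eventually[OF allI] always_eventually[OF allI] tendsto_const up])
        (rule less_imp_le, rule q)+
    then have "(\<lambda>k. (c - q k)\<^sup>2 * (LINT x|?M. (f x)\<^sup>2)) \<longlonglongrightarrow> (c - c)\<^sup>2 * (LINT x|?M. (f x)\<^sup>2)"
      by (intro tendsto_intros)
    moreover have "(LINT x|?M. (c * f x - q k * f x)\<^sup>2) = (c - q k)\<^sup>2 * (LINT x|?M. (f x)\<^sup>2)" for k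
      by (simp add: power_mult_distrib flip: left_diff_distrib)
    ultimately have "(\<lambda>k. LINT x|?M. (c * f x - q k * f x)\<^sup>2) \<longlonglongrightarrow> 0" by simp
    then show ?thesis by (rule app_limit[OF scaleL[OF fL] app_rat[OF f q(1)]])
  qed
  have app_open: "L2_approximable \<D> V (indicator W)" if W: "open W" for W
  proof -
    obtain D where D: "\<And>k::nat. D k \<in> \<D>" "\<And>k. D k \<subseteq> W \<inter> V" "\<And>x. x \<in> W \<inter> V \<Longrightarrow> \<exists>k. \<forall>j\<ge>k. x \<in> D j"
      using exh[OF open_Int[OF W V(1)]] by blast
    have L: "[(1, D k)] \<in> ?\<L>" for k using D(1,2)[of k] by auto
    have "(\<lambda>k. LINT x|?M. (indicator W x - step_fun [(1, D k)] x)\<^sup>2) \<longlonglongrightarrow> 0"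
    proof (rule L2_dominated_tendsto[OF oneL ind_meas[OF open_sets_lebesgue[OF W]] meas[OF L]])
      show "AE x in ?M. (\<lambda>k. step_fun [(1, D k)] x) \<longlonglongrightarrow> indicator W x"
      proof (rule AE_I2)
        fix x assume "x \<in> space ?M"
        then have xV: "x \<in> V" by simp
        show "(\<lambda>k. step_fun [(1, D k)] x) \<longlonglongrightarrow> indicator W x"
        proof (cases "x \<in> W")
          case True
          then obtain k where "\<forall>j\<ge>k. x \<in> D j" using D(3) xV by blast
          then have "\<forall>\<^sub>F j in sequentially. step_fun [(1, D j)] x = indicator W x"
            using True by (intro eventually_sequentiallyI[of k]) simp
          then show ?thesis by (rule tendsto_eventually)
        next
          case False
          then have "x \<notin> D k" for k using D(2) by blast
          with False show ?thesis by simp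
        qed
      qed
      show "\<bar>indicator W x - step_fun [(1, D k)] x\<bar> \<le> \<bar>1 :: real\<bar>" for k x
        by (simp add: indicator_def)
    qed
    then show ?thesis by (rule L2_approximableI[OF indL[OF open_sets_lebesgue[OF W]] L])
  qed
  have app_set: "L2_approximable \<D> V (indicator S)" if S: "S \<in> sets lebesgue" for S
  proof -
    obtain T where T: "\<And>n::nat. open (T n)" "\<And>n. S \<subseteq> T n"
        "AE x in lebesgue. (\<lambda>n. indicator (T n) x :: real) \<longlonglongrightarrow> indicator S x"
      using outer_open_approximation[OF S] by blast
    have "(\<lambda>n. LINT x|?M. (indicator S x - indicator (T n) x :: real)\<^sup>2) \<longlonglongrightarrow> 0"
    proof (rule L2_dominated_tendsto[OF oneL ind_meas[OF S] ind_meas[OF open_sets_lebesgue[OF T(1)]]])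
      show "AE x in ?M. (\<lambda>n. indicator (T n) x :: real) \<longlonglongrightarrow> indicator S x"
        using T(3) VS by (auto simp: AE_lebesgue_on_iff elim!: eventually_mono)
      show "\<bar>indicator S x - indicator (T n) x\<bar> \<le> \<bar>1 :: real\<bar>" for n x by (simp add: indicator_def)
    qed
    then show ?thesis by (rule app_limit[OF indL[OF S] app_open[OF T(1)]])
  qed
  have app_zero: "L2_approximable \<D> V (\<lambda>x. 0)"
    using app_scale[OF app_open[OF open_empty], of 0] by simp
  have app_sum: "L2_approximable \<D> V (\<lambda>x. \<Sum>y\<in>Y. indicator (S y) x * c y)"
    if "finite Y" "\<And>y. y \<in> Y \<Longrightarrow> S y \<in> sets lebesgue"
    for Y :: "real set" and S :: "real \<Rightarrow> (real^'n) set" and c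
    using that
  proof (induction Y rule: finite_induct)
    case (insert y Y)
    have "S y \<in> sets lebesgue" by (rule insert.prems) simp
    moreover have IH: "L2_approximable \<D> V (\<lambda>x. \<Sum>y\<in>Y. indicator (S y) x * c y)"
      by (rule insert.IH, rule insert.prems, rule insertI2)
    ultimately have "L2_approximable \<D> V (\<lambda>x. c y * indicator (S y) x + (\<Sum>y\<in>Y. indicator (S y) x * c y))"
      by (intro app_add[OF app_scale[OF app_set] IH])
    then show ?case by (simp only: sum.insert[OF insert.hyps] mult.commute[of "c y"])
  qed (simp add: app_zero)
  have app_cong: "L2_approximable \<D> V g" if f: "L2_approximable \<D> V f" and eq: "\<And>x. x \<in> V \<Longrightarrow> f x = g x" for f g
  proof -
    have "g \<in> Lp 2 V"
    proof (rule Lp_cong_AE[OF _ _ VS])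
      show "f \<in> Lp 2 V" using f by (simp add: L2_approximable_def)
      show "AE x in ?M. f x = g x" using eq by (intro AE_I2) simp
    qed
    moreover have "(LINT x|?M. (g x - h x)\<^sup>2) = (LINT x|?M. (f x - h x)\<^sup>2)" for h
      using eq by (intro Bochner_Integration.integral_cong) auto
    ultimately show ?thesis using f by (simp add: L2_approximable_def)
  qed
  have app_simple: "L2_approximable \<D> V s" if s: "simple_function ?M s" for s
  proof (rule app_cong)
    have "finite (s ` V)" using simple_functionD(1)[OF s] by simp
    moreover have "s -` {y} \<inter> V \<in> sets lebesgue" for y
      using simple_functionD(2)[OF s, of "{y}"] VS by (simp add: sets_restrict_space_iff)
    ultimately show "L2_approximable \<D> V (\<lambda>x. \<Sum>y\<in>s ` V. indicator (s -` {y} \<inter> V) x * y)"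
      by (rule app_sum)
    show "(\<Sum>y\<in>s ` V. indicator (s -` {y} \<inter> V) x * y) = s x" if "x \<in> V" for x
      using simple_function_indicator_representation_banach[OF s, of x] that
      by (simp only: space_lebesgue_on real_scaleR_def)
  qed
  have fm: "f \<in> borel_measurable ?M" using f by (simp add: Lp2_iff)
  obtain s where s: "\<And>i. simple_function ?M (s i)" "\<And>x. x \<in> V \<Longrightarrow> (\<lambda>i. s i x) \<longlonglongrightarrow> f x"
    "\<And>i x. x \<in> V \<Longrightarrow> \<bar>s i x\<bar> \<le> 2 * \<bar>f x\<bar>"
  proof -
    obtain s where "(\<forall>i. simple_function ?M (s i)) \<and> (\<forall>x\<in>space ?M. (\<lambda>i. s i x) \<longlonglongrightarrow> f x) \<and>
        (\<forall>i. \<forall>x\<in>space ?M. dist (s i x) 0 \<le> 2 * dist (f x) 0)"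
      using borel_measurable_implies_sequence_metric[OF fm, of 0] by (rule exE)
    then show thesis by (intro that[of s]) simp_all
  qed
  have "(\<lambda>i. LINT x|?M. (f x - s i x)\<^sup>2) \<longlonglongrightarrow> 0"
  proof (rule L2_dominated_tendsto[OF scaleL[OF f, of 3] fm borel_measurable_simple_function[OF s(1)]])
    show "AE x in ?M. (\<lambda>i. s i x) \<longlonglongrightarrow> f x" using s(2) by (intro AE_I2) simp
    show "\<bar>f x - s i x\<bar> \<le> \<bar>3 * f x\<bar>" if "x \<in> V" for i x
      using s(3)[OF that, of i] by simp
  qed
  then show ?thesis by (rule app_limit[OF f app_simple[OF s(1)]])
qed

text \<open>Insert step functions that approximate \<open>g\<close> itself.\<close>

lemma L2_bound_by_duality:
  fixes V :: "(real^'n) set"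
  assumes V: "open V" "V \<in> lmeasurable" and \<D>: "\<And>D. D \<in> \<D> \<Longrightarrow> compact D"
    and exh: "\<And>V. open V \<Longrightarrow> \<exists>D. (\<forall>k::nat. D k \<in> \<D> \<and> D k \<subseteq> V) \<and> (\<forall>x\<in>V. \<exists>k. \<forall>j\<ge>k. x \<in> D j)"
    and g: "g \<in> Lp 2 V" and K: "0 \<le> K"
    and le: "\<And>L. L \<in> lists (\<rat> \<times> {D\<in>\<D>. D \<subseteq> V}) \<Longrightarrow>
      \<bar>LINT x|lebesgue_on V. g x * step_fun L x\<bar> \<le> K * sqrt (LINT x|lebesgue_on V. (step_fun L x)\<^sup>2)"
  shows "(LINT x|lebesgue_on V. (g x)\<^sup>2) \<le> K\<^sup>2"
proof -
  let ?M = "lebesgue_on V"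
  define G where "G = (LINT x|?M. (g x)\<^sup>2)"
  have "L2_approximable \<D> V g" by (rule step_functions_dense_in_L2[OF V \<D> exh g])
  then obtain L where L: "\<And>k::nat. L k \<in> lists (\<rat> \<times> {D\<in>\<D>. D \<subseteq> V})"
    and lim: "(\<lambda>k. LINT x|?M. (g x - step_fun (L k) x)\<^sup>2) \<longlonglongrightarrow> 0"
    unfolding L2_approximable_def by blast
  have sL: "step_fun (L k) \<in> Lp 2 V" for k
    by (rule step_fun_Lp2[OF \<D> L V(2)])
  have pair: "(\<lambda>k. LINT x|?M. g x * step_fun (L k) x) \<longlonglongrightarrow> G"
    using L2_pairing_tendsto[OF g g Lp_diff[OF g sL] lim] by (simp add: G_def power2_eq_square)
  have eq: "(LINT x|?M. (step_fun (L k) x)\<^sup>2)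
      = (LINT x|?M. (g x - step_fun (L k) x)\<^sup>2) - G + 2 * (LINT x|?M. g x * step_fun (L k) x)" for k
  proof -
    have i: "integrable ?M (\<lambda>x. (g x)\<^sup>2)" "integrable ?M (\<lambda>x. (step_fun (L k) x)\<^sup>2)"
      "integrable ?M (\<lambda>x. g x * step_fun (L k) x)"
      using g sL[of k] Lp2_mult_integrable[OF g sL] by (auto simp: Lp2_iff)
    have "(g x - step_fun (L k) x)\<^sup>2 = (g x)\<^sup>2 + (step_fun (L k) x)\<^sup>2 - 2 * (g x * step_fun (L k) x)" for x
      by (simp add: power2_diff)
    then have "(LINT x|?M. (g x - step_fun (L k) x)\<^sup>2)
        = G + (LINT x|?M. (step_fun (L k) x)\<^sup>2) - 2 * (LINT x|?M. g x * step_fun (L k) x)"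
      using i by (simp add: G_def)
    then show ?thesis by simp
  qed
  have "(\<lambda>k. LINT x|?M. (step_fun (L k) x)\<^sup>2) \<longlonglongrightarrow> 0 - G + 2 * G"
    unfolding eq by (intro tendsto_intros lim pair)
  then have upper: "(\<lambda>k. K * sqrt (LINT x|?M. (step_fun (L k) x)\<^sup>2)) \<longlonglongrightarrow> K * sqrt G"
    by (intro tendsto_intros) simp
  have "\<bar>G\<bar> \<le> K * sqrt G"
    by (rule LIMSEQ_le[OF tendsto_rabs[OF pair] upper]) (use le[OF L] in blast)
  moreover have G0: "0 \<le> G" by (simp add: G_def)
  ultimately have *: "sqrt G * sqrt G \<le> K * sqrt G" by simp
  have "sqrt G \<le> K"
  proof (cases "G = 0")
    case False
    then have "0 < sqrt G" using G0 by simp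
    with * show ?thesis by (rule mult_right_le_imp_le)
  qed (use K in simp)
  then have "(sqrt G)\<^sup>2 \<le> K\<^sup>2" using G0 by (intro power_mono) auto
  then show ?thesis using G0 by (simp add: G_def)
qed

section \<open>Values of potentials at a pole\<close>

text \<open>Every rational bound on every member of a countable base is violated on a null set only.\<close>

lemma AE_value_le_local_AE_bound:
  fixes H :: "(real^'n \<Rightarrow> real^'m) set"
  assumes \<Omega>: "open \<Omega>" and H: "countable H"
  shows "AE y in lebesgue_on \<Omega>. \<forall>h\<in>H. \<forall>s c. 0 < s \<longrightarrow>
    (AE z in lebesgue_on (\<Omega> \<inter> ball y s). norm (h z) \<le> c) \<longrightarrow> norm (h y) \<le> c"
proof -
  obtain \<B> :: "(real^'n) set set" where \<B>: "countable \<B>" "topological_basis \<B>"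
    using ex_countable_basis by blast
  have BS: "\<Omega> \<inter> B \<in> sets lebesgue" "open B" if "B \<in> \<B>" for B
    using topological_basis_open[OF \<B>(2) that] \<Omega> by (auto intro: open_sets_lebesgue)
  let ?P = "\<lambda>y h B q. (AE z in lebesgue_on (\<Omega> \<inter> B). norm (h z) \<le> q) \<longrightarrow> y \<in> \<Omega> \<inter> B \<longrightarrow> norm (h y) \<le> q"
  have P: "AE y in lebesgue. ?P y h B q" if "B \<in> \<B>" for h :: "real^'n \<Rightarrow> real^'m" and B q
  proof (cases "AE z in lebesgue_on (\<Omega> \<inter> B). norm (h z) \<le> q")
    case True
    then have "AE y in lebesgue. y \<in> \<Omega> \<inter> B \<longrightarrow> norm (h y) \<le> q"
      using BS(1)[OF that] by (simp only: AE_lebesgue_on_iff)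
    then show ?thesis by (rule eventually_mono) blast
  qed simp
  have "\<forall>p \<in> H \<times> \<B> \<times> \<rat>. AE y in lebesgue. ?P y (fst p) (fst (snd p)) (snd (snd p))"
    by (intro ballI P) (simp add: mem_Times_iff)
  moreover have "countable (H \<times> \<B> \<times> (\<rat> :: real set))"
    by (intro countable_SIGMA H \<B>(1) countable_rat)
  ultimately have "AE y in lebesgue. \<forall>p \<in> H \<times> \<B> \<times> \<rat>. ?P y (fst p) (fst (snd p)) (snd (snd p))"
    by (subst AE_ball_countable)
  then have "AE y in lebesgue. y \<in> \<Omega> \<longrightarrow> (\<forall>h\<in>H. \<forall>s c. 0 < s \<longrightarrow>
      (AE z in lebesgue_on (\<Omega> \<inter> ball y s). norm (h z) \<le> c) \<longrightarrow> norm (h y) \<le> c)"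
  proof (rule eventually_mono, intro impI ballI allI)
    fix y h s c
    assume *: "\<forall>p \<in> H \<times> \<B> \<times> \<rat>. ?P y (fst p) (fst (snd p)) (snd (snd p))"
    assume y: "y \<in> \<Omega>" and h: "h \<in> H" and s: "0 < (s::real)"
      and AE: "AE z in lebesgue_on (\<Omega> \<inter> ball y s). norm (h z) \<le> c"
    obtain B where B: "B \<in> \<B>" "y \<in> B" "B \<subseteq> ball y s"
      using topological_basisE[OF \<B>(2) open_ball, of y y s] s by auto
    have "norm (h y) \<le> q" if q: "q \<in> \<rat>" "c < q" for q
    proof -
      have "AE z in lebesgue_on (\<Omega> \<inter> B). norm (h z) \<le> c"
        using AE_lebesgue_on_subset[OF AE, of "\<Omega> \<inter> B"] B(3) BS(1)[OF B(1)] \<Omega>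
        by (auto intro: open_sets_lebesgue)
      then have "AE z in lebesgue_on (\<Omega> \<inter> B). norm (h z) \<le> q"
        by (rule eventually_mono) (use q(2) in linarith)
      moreover have "(h, B, q) \<in> H \<times> \<B> \<times> \<rat>" using h B(1) q(1) by simp
      note bspec[OF * this, unfolded fst_conv snd_conv]
      ultimately show ?thesis using B(2) y by blast
    qed
    then show "norm (h y) \<le> c"
      using Rats_dense_in_real[of c "norm (h y)"] by force
  qed
  then show ?thesis using \<Omega> by (simp add: AE_lebesgue_on_iff open_sets_lebesgue)
qed

text \<open>The averages over small balls obey the bound, and the value at a precise pole is their limit.\<close>

lemma precise_pole_value_le_local_AE_bound:
  fixes G :: "real^'n \<Rightarrow> real^'n \<Rightarrow> real^'m^'m"
  assumes \<Omega>: "open \<Omega>" and y: "y \<in> \<Omega>" and pole: "precise_pole \<Omega> G y"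
    and f: "f \<in> Linf \<Omega>" "compact K" "K \<subseteq> \<Omega> - {y}" "\<And>x. x \<notin> K \<Longrightarrow> f x = 0"
    and s: "0 < s" and AE: "AE z in lebesgue_on (\<Omega> \<inter> ball y s). norm (green_potential \<Omega> G f z) \<le> c"
  shows "norm (green_potential \<Omega> G f y) \<le> c"
proof -
  let ?u = "green_potential \<Omega> G f"
  have lim: "((\<lambda>r. (1 / measure lebesgue (ball y r)) *\<^sub>R (LINT z|lebesgue_on (ball y r). ?u z)) \<longlongrightarrow> ?u y) (at_right 0)"
    using pole f unfolding precise_pole_def by blast
  obtain e where e: "0 < e" "ball y e \<subseteq> \<Omega>" using \<Omega> y open_contains_ball by blast
  define d where "d = min e s"
  have d: "0 < d" using e(1) s by (simp add: d_def)
  have "norm ((1 / measure lebesgue (ball y r)) *\<^sub>R (LINT z|lebesgue_on (ball y r). ?u z)) \<le> c"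
    if r: "0 < r" "r < d" for r
  proof -
    have sub: "ball y r \<subseteq> \<Omega> \<inter> ball y s" using r e(2) by (auto simp: d_def)
    have AEr: "AE z in lebesgue_on (ball y r). norm (?u z) \<le> c"
      by (rule AE_lebesgue_on_subset[OF AE sub]) (use \<Omega> in \<open>auto intro: open_sets_lebesgue\<close>)
    have c: "0 \<le> c"
    proof (rule ccontr)
      assume "\<not> 0 \<le> c"
      with AEr have "AE z in lebesgue_on (ball y r). False"
        by (elim eventually_mono) (smt (verit) norm_ge_zero)
      then have "ball y r \<in> null_sets lebesgue"
        by (simp add: AE_lebesgue_on_iff AE_iff_null_sets)
      then show False
        using open_not_negligible[of "ball y r"] r(1) by (simp add: negligible_iff_null_sets)
    qed
    interpret finite_measure "lebesgue_on (ball y r)"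
      by (rule finite_measure_lebesgue_on) simp
    have "norm (LINT z|lebesgue_on (ball y r). ?u z) \<le> (LINT z|lebesgue_on (ball y r). norm (?u z))"
      by (rule integral_norm_bound)
    also have "\<dots> \<le> (LINT z|lebesgue_on (ball y r). c)"
      using AEr c by (intro integral_mono_AE') auto
    also have "\<dots> = c * measure lebesgue (ball y r)" by (simp add: measure_restrict_space)
    finally show ?thesis
      using c by (cases "measure lebesgue (ball y r) = 0") (auto simp: divide_simps mult.commute)
  qed
  then have "\<forall>\<^sub>F r in at_right 0. norm ((1 / measure lebesgue (ball y r)) *\<^sub>R (LINT z|lebesgue_on (ball y r). ?u z)) \<le> c"
    using d by (auto simp: eventually_at_right_field)
  then show ?thesis
    by (rule tendsto_upperbound[OF tendsto_norm[OF lim]]) simp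
qed

section \<open>Duality: from potentials to the Green's matrix\<close>

lemma axis_eq_scaleR: "(axis i t :: real^'m) = t *\<^sub>R axis i 1"
  by (simp add: vec_eq_iff axis_def)

text \<open>The potential of \<open>s\<close> has energy at most \<open>32 r\<^sup>2 / \<nu>\<^sup>2\<close> times the square of the norm of \<open>s\<close>, the
  Hardy inequality on the ball around \<open>y\<close> contributes another factor \<open>32 r\<^sup>2\<close>, and on that ball the
  potential solves the homogeneous adjoint equation.\<close>

lemma potential_local_bound:
  fixes A :: "('n::finite, 'm::finite) coeffs" and G :: "real^'n \<Rightarrow> real^'n \<Rightarrow> real^'m^'m"
    and s :: "real^'n \<Rightarrow> real"
  assumes n: "CARD('n) \<ge> 3" and \<Omega>: "open \<Omega>" and \<nu>: "0 < \<nu>" and A: "elliptic_coeffs \<nu> A"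
    and lb: "local_boundedness A \<Omega> Rmax N\<^sub>0" and N0: "0 < N\<^sub>0" and G: "green_matrix A \<Omega> G"
    and y: "y \<in> \<Omega>" and r: "0 < r" "ereal r < Rmax" and disj: "ball x0 r \<inter> ball y r = {}"
    and s: "s \<in> Lp 2 \<Omega>" "\<And>x. x \<notin> \<Omega> \<inter> ball x0 r \<Longrightarrow> s x = 0" "(\<lambda>x. axis i (s x) :: real^'m) \<in> Linf_c \<Omega>"
  shows "AE z in lebesgue_on (\<Omega> \<inter> ball y (r / 2)). norm (green_potential \<Omega> G (\<lambda>x. axis i (s x)) z)
    \<le> N\<^sub>0 * (r powr (- real CARD('n) / 2) * (32 * r\<^sup>2 / \<nu>)) * sqrt (LINT x|lebesgue_on (\<Omega> \<inter> ball x0 r). (s x)\<^sup>2)"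
proof -
  let ?f = "\<lambda>x. axis i (s x) :: real^'m" and ?U = "\<Omega> \<inter> ball y r" and ?B = "adjoint_coeffs A"
  define u where "u = green_potential \<Omega> G ?f"
  have B: "elliptic_coeffs \<nu> ?B" by (rule elliptic_adjoint_coeffs[OF A])
  have "vec_all (\<lambda>w. w \<in> Y12_0 \<Omega>) u \<and> weak_solution ?B \<Omega> u ?f"
    using G s(3) unfolding green_matrix_def u_def by blast
  then have u: "\<And>j. (\<lambda>z. u z $ j) \<in> Y12_0 \<Omega>" and sol: "weak_solution ?B \<Omega> u ?f"
    by (auto simp: vec_all_def)
  have \<Omega>S: "\<Omega> \<in> sets lebesgue" "\<Omega> \<inter> ball x0 r \<in> sets lebesgue"
    using \<Omega> by (auto intro: open_sets_lebesgue)
  define S where "S = (\<Sum>j\<in>UNIV. LINT x|lebesgue_on \<Omega>. (norm (wgrad \<Omega> (\<lambda>z. u z $ j) x))\<^sup>2)"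
  define F where "F = (LINT x|lebesgue_on (\<Omega> \<inter> ball x0 r). (s x)\<^sup>2)"
  have F: "(LINT x|lebesgue_on \<Omega>. (s x)\<^sup>2) = F" "0 \<le> F"
    unfolding F_def using s(2) \<Omega>S by (subst (1 2) integral_lebesgue_on_eq) auto
  have "\<nu>\<^sup>2 * S \<le> 32 * r\<^sup>2 * F"
    unfolding S_def F(1)[symmetric]
    by (rule energy_estimate[OF n \<Omega> \<nu> B u sol r(1) s(1), of x0]) (use s(2) in simp)
  then have S: "S \<le> 32 * r\<^sup>2 / \<nu>\<^sup>2 * F" using \<nu> by (simp add: field_simps)
  have "(\<Sum>j\<in>UNIV. LINT z|lebesgue_on ?U. (u z $ j)\<^sup>2) \<le> 32 * r\<^sup>2 * S"
    unfolding S_def sum_distrib_left by (intro sum_mono Hardy_inequality_Y12_0[OF n \<Omega> u r(1)])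
  also have "\<dots> \<le> 32 * r\<^sup>2 * (32 * r\<^sup>2 / \<nu>\<^sup>2 * F)" using S by (intro mult_left_mono) auto
  also have "\<dots> = (32 * r\<^sup>2 / \<nu>)\<^sup>2 * F" by (simp add: power2_eq_square)
  finally have "sqrt (\<Sum>j\<in>UNIV. LINT z|lebesgue_on ?U. (u z $ j)\<^sup>2) \<le> sqrt ((32 * r\<^sup>2 / \<nu>)\<^sup>2 * F)"
    by (rule real_sqrt_le_mono)
  also have "\<dots> = 32 * r\<^sup>2 / \<nu> * sqrt F"
    using \<nu> by (simp add: real_sqrt_mult)
  finally have L2: "sqrt (\<Sum>j\<in>UNIV. LINT z|lebesgue_on ?U. (u z $ j)\<^sup>2) \<le> 32 * r\<^sup>2 / \<nu> * sqrt F" .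
  have U: "open ?U" "bounded ?U" "?U \<subseteq> \<Omega>" using \<Omega> by auto
  have "weak_solution ?B ?U u (\<lambda>z. 0)"
    unfolding weak_solution_def
  proof (intro allI impI)
    fix \<phi> :: "real^'n \<Rightarrow> real^'m" assume \<phi>: "vec_all (\<lambda>\<psi>. \<psi> \<in> Cc_inf ?U) \<phi>"
    have \<phi>\<Omega>: "vec_all (\<lambda>\<psi>. \<psi> \<in> Cc_inf \<Omega>) \<phi>"
      using \<phi> Cc_inf_mono[OF _ U(3)] unfolding vec_all_def by blast
    have w: "wgrad ?U (\<lambda>z. u z $ j) \<in> Lp 2 ?U" for j
      using Y12_0_restrict(2)[OF n \<Omega> u U order_refl, of j] by (simp add: W12_def)
    have "weak_form ?B ?U u \<phi> = weak_form ?B \<Omega> u \<phi>"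
      by (rule weak_form_subset[OF B U(1) \<Omega> U(3) w Y12_0_restrict(1)[OF n \<Omega> u U order_refl] \<phi>])
    also have "\<dots> = (LINT x|lebesgue_on \<Omega>. axis i (s x) \<bullet> \<phi> x)"
      using sol \<phi>\<Omega> unfolding weak_solution_def by blast
    also have "(\<lambda>x. axis i (s x) \<bullet> \<phi> x) = (\<lambda>x. 0)"
    proof
      fix x show "axis i (s x) \<bullet> \<phi> x = 0"
      proof (cases "x \<in> ?U")
        case True
        then have "s x = 0" using disj by (intro s(2)) blast
        then show ?thesis by (simp add: inner_axis')
      next
        case False
        then have "\<phi> x $ i = 0" using Cc_inf_eq_0[of "\<lambda>z. \<phi> z $ i" ?U x] \<phi> by (simp add: vec_all_def)
        then show ?thesis by (simp add: inner_axis')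
      qed
    qed
    finally show "weak_form ?B ?U u \<phi> = (LINT x|lebesgue_on ?U. 0 \<bullet> \<phi> x)" by simp
  qed
  then have "AE z in lebesgue_on (\<Omega> \<inter> ball y (r / 2)). norm (u z)
      \<le> N\<^sub>0 * (r powr (- real CARD('n) / 2) * sqrt (\<Sum>j\<in>UNIV. LINT z|lebesgue_on ?U. (u z $ j)\<^sup>2))"
    by (intro local_boundedness_homogeneous[OF n \<Omega> lb y r u] disjI2)
  moreover have "N\<^sub>0 * (r powr (- real CARD('n) / 2) * sqrt (\<Sum>j\<in>UNIV. LINT z|lebesgue_on ?U. (u z $ j)\<^sup>2))
      \<le> N\<^sub>0 * (r powr (- real CARD('n) / 2) * (32 * r\<^sup>2 / \<nu>)) * sqrt F"
    using L2 N0 unfolding mult.assoc by (intro mult_left_mono) auto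
  ultimately show ?thesis
    unfolding u_def F_def by (elim eventually_mono) linarith
qed

lemma step_fun_compact_support:
  assumes "\<And>D. D \<in> \<D> \<Longrightarrow> compact D" "L \<in> lists (\<rat> \<times> {D\<in>\<D>. D \<subseteq> V})"
  shows "\<exists>K. compact K \<and> K \<subseteq> V \<and> (\<forall>x. x \<notin> K \<longrightarrow> step_fun L x = 0)"
proof (intro exI conjI allI impI)
  have L: "set L \<subseteq> \<rat> \<times> {D\<in>\<D>. D \<subseteq> V}" using assms(2) by (simp add: lists_eq_set)
  show "compact (\<Union> (snd ` set L))"
    using L assms(1) by (intro compact_Union) auto
  show "\<Union> (snd ` set L) \<subseteq> V" by (auto dest!: subsetD[OF L])
  have "L \<in> lists (UNIV \<times> {D. D \<subseteq> \<Union> (snd ` set L)})"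
    by (auto simp: lists_eq_set)
  then show "step_fun L x = 0" if "x \<notin> \<Union> (snd ` set L)" for x
    using that by (rule step_fun_support)
qed

lemma step_fun_spaces:
  fixes \<D> :: "(real^'n) set set" and V \<Omega> :: "(real^'n) set"
  assumes \<D>: "\<And>D. D \<in> \<D> \<Longrightarrow> compact D" and L: "L \<in> lists (\<rat> \<times> {D\<in>\<D>. D \<subseteq> V})"
    and V: "V \<subseteq> \<Omega>" and \<Omega>: "open \<Omega>"
  shows "step_fun L \<in> Lp 2 \<Omega>" "(\<lambda>x. axis i (step_fun L x) :: real^'m) \<in> Linf \<Omega>"
    "(\<lambda>x. axis i (step_fun L x) :: real^'m) \<in> Linf_c \<Omega>"
proof -
  obtain K where K: "compact K" "K \<subseteq> V" "\<And>x. x \<notin> K \<Longrightarrow> step_fun L x = 0"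
    using step_fun_compact_support[OF \<D> L] by blast
  obtain c where c: "\<And>x. \<bar>step_fun L x\<bar> \<le> c" using step_fun_bounded[of L] by blast
  have m: "step_fun L \<in> borel_measurable (lebesgue_on T)" for T
    by (rule step_fun_measurable_lebesgue_on[OF \<D> L])
  have \<Omega>S: "\<Omega> \<in> sets lebesgue" using \<Omega> by (rule open_sets_lebesgue)
  have KS: "K \<in> sets lebesgue" and KM: "K \<in> lmeasurable"
    using K(1) by (auto simp: borel_compact lmeasurable_compact)
  have "step_fun L \<in> Lp 2 K" by (rule step_fun_Lp2[OF \<D> L KM])
  then have "integrable (lebesgue_on K) (\<lambda>x. (step_fun L x)\<^sup>2)" by (simp add: Lp2_iff)
  moreover have zero: "(step_fun L x)\<^sup>2 = 0" if "x \<notin> K" for x using K(3)[OF that] by simp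
  ultimately have "integrable lebesgue (\<lambda>x. (step_fun L x)\<^sup>2)"
    using integrable_lebesgue_on_eq[OF KS, of "\<lambda>x. (step_fun L x)\<^sup>2"] by blast
  moreover have "(step_fun L x)\<^sup>2 = 0" if "x \<notin> \<Omega>" for x using that K(2) V by (intro zero) blast
  ultimately have "integrable (lebesgue_on \<Omega>) (\<lambda>x. (step_fun L x)\<^sup>2)"
    using integrable_lebesgue_on_eq[OF \<Omega>S, of "\<lambda>x. (step_fun L x)\<^sup>2"] by blast
  then show "step_fun L \<in> Lp 2 \<Omega>" using m by (simp add: Lp2_iff)
  have "(\<lambda>x. step_fun L x *\<^sub>R axis i 1 :: real^'m) \<in> borel_measurable (lebesgue_on \<Omega>)"
    by (intro borel_measurable_scaleR m borel_measurable_const)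
  then have "(\<lambda>x. axis i (step_fun L x) :: real^'m) \<in> borel_measurable (lebesgue_on \<Omega>)"
    by (simp only: axis_eq_scaleR[of i "step_fun L _"])
  moreover have "norm (axis i (step_fun L x) :: real^'m) \<le> c" for x
    using c[of x] by (simp add: axis_eq_scaleR[of i "step_fun L x"] norm_axis_1)
  ultimately show Linf: "(\<lambda>x. axis i (step_fun L x) :: real^'m) \<in> Linf \<Omega>"
    unfolding Linf_def by (auto intro!: exI[of _ c])
  have "K \<subseteq> closure \<Omega>" using K(2) V closure_subset by blast
  moreover have "axis i (step_fun L x) = (0 :: real^'m)" if "x \<notin> K" for x
    using K(3)[OF that] by simp
  ultimately show "(\<lambda>x. axis i (step_fun L x) :: real^'m) \<in> Linf_c \<Omega>"
    unfolding Linf_c_def using Linf K(1) by blast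
qed

lemma norm_matrix_le_columns:
  fixes M :: "real^'m^'m"
  assumes "\<And>k. norm (column k M) \<le> c"
  shows "norm M \<le> (real CARD('m))\<^sup>2 * c"
proof -
  have "norm M \<le> (\<Sum>i\<in>UNIV. norm (M $ i))"
    unfolding norm_vec_def[of M] by (rule L2_set_le_sum) simp
  also have "\<dots> \<le> (\<Sum>i\<in>(UNIV::'m set). real CARD('m) * c)"
  proof (rule sum_mono)
    fix i
    have "norm (M $ i) \<le> (\<Sum>k\<in>UNIV. \<bar>M $ i $ k\<bar>)" by (rule norm_le_l1_cart)
    also have "\<dots> \<le> (\<Sum>k\<in>(UNIV::'m set). c)"
    proof (rule sum_mono)
      fix k
      have "\<bar>M $ i $ k\<bar> \<le> norm (column k M)"
        using component_le_norm_cart[of "column k M" i] by (simp add: column_def)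
      then show "\<bar>M $ i $ k\<bar> \<le> c" using assms[of k] by linarith
    qed
    finally show "norm (M $ i) \<le> real CARD('m) * c" by simp
  qed
  finally show ?thesis by (simp add: power2_eq_square mult.assoc)
qed

text \<open>With \<open>r = |x\<^sub>0 - y| / 2\<close> the balls of radius \<open>r\<close> around \<open>x\<^sub>0\<close> and \<open>y\<close> are disjoint. Local
  boundedness is used twice: around \<open>y\<close> for potentials of step functions on the first ball, which
  bounds the \<open>L\<^sup>2\<close> norm of the Green's matrix there, and around \<open>x\<^sub>0\<close> for the Green's matrix, whose
  columns agree near \<open>x\<^sub>0\<close> with functions in \<open>Y12_0\<close>.\<close>

lemma green_matrix_local_bound:
  fixes A :: "('n::finite, 'm::finite) coeffs" and G :: "real^'n \<Rightarrow> real^'n \<Rightarrow> real^'m^'m"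
    and \<D> :: "(real^'n) set set"
  assumes n: "CARD('n) \<ge> 3" and \<Omega>: "open \<Omega>" and \<nu>: "0 < \<nu>" and A: "elliptic_coeffs \<nu> A"
    and lb: "local_boundedness A \<Omega> Rmax N\<^sub>0" and N0: "0 < N\<^sub>0" and G: "green_matrix A \<Omega> G"
    and \<D>: "\<And>D. D \<in> \<D> \<Longrightarrow> compact D"
    and exh: "\<And>V. open V \<Longrightarrow> \<exists>D. (\<forall>k::nat. D k \<in> \<D> \<and> D k \<subseteq> V) \<and> (\<forall>x\<in>V. \<exists>k. \<forall>j\<ge>k. x \<in> D j)"
    and y: "y \<in> \<Omega>"
    and pole: "\<And>(L :: (real \<times> (real^'n) set) list) (i::'m) s c. L \<in> lists (\<rat> \<times> {D\<in>\<D>. D \<subseteq> \<Omega> - {y}}) \<Longrightarrow> 0 < s \<Longrightarrow>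
      AE z in lebesgue_on (\<Omega> \<inter> ball y s). norm (green_potential \<Omega> G (\<lambda>x. axis i (step_fun L x)) z) \<le> c \<Longrightarrow>
      norm (green_potential \<Omega> G (\<lambda>x. axis i (step_fun L x)) y) \<le> c"
    and x0: "x0 \<in> \<Omega>" "x0 \<noteq> y" "ereal (norm (x0 - y)) < Rmax" and r_def: "r = norm (x0 - y) / 2"
  shows "AE z in lebesgue_on (\<Omega> \<inter> ball x0 (r / 2)). norm (G z y)
    \<le> 32 * (real CARD('m))\<^sup>2 * sqrt (real CARD('m)) * N\<^sub>0\<^sup>2 / \<nu> * r powr (2 - real CARD('n))"
proof -
  let ?V = "\<Omega> \<inter> ball x0 r"
  have r: "0 < r" using x0(2) by (simp add: r_def)
  have "ereal r \<le> ereal (norm (x0 - y))" by (simp add: r_def)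
  then have rR: "ereal r < Rmax" using x0(3) by (rule le_less_trans)
  have far: "r < dist z y" if "z \<in> ball x0 r" for z
    using that dist_triangle[of x0 y z] by (simp add: r_def dist_norm)
  have disj: "ball x0 r \<inter> ball y r = {}"
    using far by (force simp: dist_commute)
  have yV: "y \<notin> ?V" using far[of y] r by auto
  have V: "open ?V" "bounded ?V" "?V \<subseteq> \<Omega>" "?V \<in> lmeasurable" "?V \<in> sets lebesgue" "?V \<subseteq> \<Omega> - {y}"
  proof -
    show "open ?V" "bounded ?V" "?V \<subseteq> \<Omega>" using \<Omega> by auto
    then show "?V \<in> lmeasurable" "?V \<in> sets lebesgue" by (auto intro: lmeasurable_open open_sets_lebesgue)
    show "?V \<subseteq> \<Omega> - {y}" using yV by blast
  qed
  obtain \<rho> where \<rho>: "0 < \<rho>" "\<rho> \<le> r" "cball y \<rho> \<subseteq> \<Omega>"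
  proof -
    obtain e where "0 < e" "cball y e \<subseteq> \<Omega>" using \<Omega> y open_contains_cball by blast
    then show thesis using r by (intro that[of "min e r"]) auto
  qed
  \<comment> \<open>Cutting off the pole puts the columns of \<open>G(\<cdot>,y)\<close> into \<open>Y12_0\<close> and does not change them near \<open>x\<^sub>0\<close>.\<close>
  obtain \<zeta> \<epsilon> where \<zeta>: "\<zeta> \<in> Cc_inf \<Omega>" "0 < \<epsilon>" "\<And>x. x \<in> ball y \<epsilon> \<Longrightarrow> \<zeta> x = 1"
    "\<And>x. x \<notin> cball y \<rho> \<Longrightarrow> \<zeta> x = 0"
    using cutoff_exists[OF \<rho>(1,3)] by blast
  have \<zeta>V: "\<zeta> x = 0" if "x \<in> ?V" for x
    using far[of x] that \<rho>(2) by (intro \<zeta>(4)) (auto simp: dist_commute)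
  define v where "v k x = (1 - \<zeta> x) *\<^sub>R column k (G x y)" for k x
  have vV: "v k x = column k (G x y)" if "x \<in> ?V" for k x
    using \<zeta>V[OF that] by (simp add: v_def)
  have vY: "(\<lambda>z. v k z $ i) \<in> Y12_0 \<Omega>" for k i
  proof -
    have "vec_all (\<lambda>w. w \<in> Y12_0 \<Omega>) (\<lambda>x. (1 - \<zeta> x) *\<^sub>R column k (G x y))"
      using G y \<zeta>(1,2,3) unfolding green_matrix_def by blast
    then show ?thesis by (simp add: vec_all_def v_def)
  qed
  have vW: "(\<lambda>z. v k z $ i) \<in> W12 ?V" for k i
    by (rule Y12_0_restrict(2)[OF n \<Omega> vY V(1-3) order_refl])
  define K where "K = N\<^sub>0 * (r powr (- real CARD('n) / 2) * (32 * r\<^sup>2 / \<nu>))"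
  have K: "0 \<le> K" using N0 \<nu> by (simp add: K_def)
  have L2: "(LINT z|lebesgue_on ?V. (v k z $ i)\<^sup>2) \<le> K\<^sup>2" for k i
  proof (rule L2_bound_by_duality[OF V(1,4) \<D> exh _ K])
    show "(\<lambda>z. v k z $ i) \<in> Lp 2 ?V" using vW by (simp add: W12_def)
    fix L :: "(real \<times> (real^'n) set) list" assume L: "L \<in> lists (\<rat> \<times> {D\<in>\<D>. D \<subseteq> ?V})"
    let ?f = "\<lambda>x. axis i (step_fun L x) :: real^'m"
    obtain C where C: "compact C" "C \<subseteq> ?V" "\<And>x. x \<notin> C \<Longrightarrow> step_fun L x = 0"
      using step_fun_compact_support[OF \<D> L] by blast
    have L0: "step_fun L x = 0" if "x \<notin> ?V" for x using C(2) that by (intro C(3)) blast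
    have "AE z in lebesgue_on (\<Omega> \<inter> ball y (r / 2)). norm (green_potential \<Omega> G ?f z)
        \<le> K * sqrt (LINT x|lebesgue_on ?V. (step_fun L x)\<^sup>2)"
      unfolding K_def
      by (rule potential_local_bound[OF n \<Omega> \<nu> A lb N0 G y r rR disj step_fun_spaces(1)[OF \<D> L V(3) \<Omega>] L0
            step_fun_spaces(3)[OF \<D> L V(3) \<Omega>]])
    moreover have "L \<in> lists (\<rat> \<times> {D\<in>\<D>. D \<subseteq> \<Omega> - {y}})"
      using L V(6) by (auto simp: lists_eq_set)
    ultimately have le: "norm (green_potential \<Omega> G ?f y) \<le> K * sqrt (LINT x|lebesgue_on ?V. (step_fun L x)\<^sup>2)"
      using pole[of L "r / 2" i] r by simp
    have sum_axis: "(\<Sum>j\<in>UNIV. G z y $ j $ k * axis i t $ j) = G z y $ i $ k * t" for z t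
      by (simp add: axis_def if_distrib[of "\<lambda>t. G z y $ _ $ k * t"] cong: if_cong)
    have "green_potential \<Omega> G ?f y $ k = (LINT z|lebesgue_on \<Omega>. G z y $ i $ k * step_fun L z)"
      by (simp add: green_potential_def sum_axis)
    also have "\<dots> = (LINT z|lebesgue. G z y $ i $ k * step_fun L z)"
      using L0 V(3) open_sets_lebesgue[OF \<Omega>] by (intro integral_lebesgue_on_eq) auto
    also have "\<dots> = (LINT z|lebesgue_on ?V. G z y $ i $ k * step_fun L z)"
      using L0 V(5) by (intro integral_lebesgue_on_eq[symmetric]) auto
    also have "\<dots> = (LINT z|lebesgue_on ?V. v k z $ i * step_fun L z)"
      by (intro Bochner_Integration.integral_cong) (auto simp: vV column_def)
    finally have "\<bar>LINT z|lebesgue_on ?V. v k z $ i * step_fun L z\<bar> \<le> norm (green_potential \<Omega> G ?f y)"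
      using component_le_norm_cart[of "green_potential \<Omega> G ?f y" k] by simp
    with le show "\<bar>LINT z|lebesgue_on ?V. v k z $ i * step_fun L z\<bar>
        \<le> K * sqrt (LINT z|lebesgue_on ?V. (step_fun L z)\<^sup>2)" by linarith
  qed
  define H where "H = N\<^sub>0 * (r powr (- real CARD('n) / 2) * (sqrt (real CARD('m)) * K))"
  have col: "AE z in lebesgue_on (\<Omega> \<inter> ball x0 (r / 2)). norm (column k (G z y)) \<le> H" for k
  proof -
    let ?E = "N\<^sub>0 * (r powr (- real CARD('n) / 2) * sqrt (\<Sum>i\<in>UNIV. LINT z|lebesgue_on ?V. (v k z $ i)\<^sup>2))"
    have "weak_solution A ?V (v k) (\<lambda>z. 0)"
      unfolding weak_solution_def
    proof (intro allI impI)
      fix \<phi> :: "real^'n \<Rightarrow> real^'m" assume \<phi>: "vec_all (\<lambda>\<psi>. \<psi> \<in> Cc_inf ?V) \<phi>"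
      have \<phi>\<Omega>: "vec_all (\<lambda>\<psi>. \<psi> \<in> Cc_inf \<Omega>) \<phi>"
        using \<phi> Cc_inf_mono[OF _ V(3)] unfolding vec_all_def by blast
      let ?g = "\<lambda>x. column k (G x y)"
      have w_eq: "wgrad ?V (\<lambda>z. v k z $ j) = wgrad ?V (\<lambda>z. ?g z $ j)" for j
        by (rule wgrad_cong) (simp add: vV)
      have gW: "(\<lambda>z. ?g z $ j) \<in> W11_loc \<Omega>" for j
        using G y unfolding green_matrix_def vec_all_def by blast
      have gAE: "AE x in lebesgue_on ?V. wgrad ?V (\<lambda>z. ?g z $ j) x = wgrad \<Omega> (\<lambda>z. ?g z $ j) x" for j
        by (rule wgrad_eq_AE[OF V(1) weak_gradient_subset[OF W11_loc_weak_gradient[OF gW] V(3,1) \<Omega>]])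
      have wL: "wgrad ?V (\<lambda>z. ?g z $ j) \<in> Lp 2 ?V" for j
        using vW[of k j] unfolding w_eq[symmetric] by (simp add: W12_def)
      have "weak_form A ?V (v k) \<phi> = weak_form A ?V ?g \<phi>"
        by (simp add: weak_form_def w_eq)
      also have "\<dots> = weak_form A \<Omega> ?g \<phi>"
        by (rule weak_form_subset[OF A V(1) \<Omega> V(3) wL gAE \<phi>])
      also have "\<dots> = \<phi> y $ k"
        using G y \<phi>\<Omega> unfolding green_matrix_def by blast
      also have "\<dots> = 0"
        using \<phi> yV Cc_inf_eq_0[of "\<lambda>z. \<phi> z $ k" ?V y] by (simp add: vec_all_def)
      finally show "weak_form A ?V (v k) \<phi> = (LINT x|lebesgue_on ?V. 0 \<bullet> \<phi> x)" by simp
    qed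
    then have "AE z in lebesgue_on (\<Omega> \<inter> ball x0 (r / 2)). norm (v k z) \<le> ?E"
      by (intro local_boundedness_homogeneous[OF n \<Omega> lb x0(1) r rR vY] disjI1)
    moreover have "?E \<le> H"
    proof -
      have "(\<Sum>i\<in>UNIV. LINT z|lebesgue_on ?V. (v k z $ i)\<^sup>2) \<le> (\<Sum>i\<in>(UNIV::'m set). K\<^sup>2)"
        by (intro sum_mono L2)
      then have "sqrt (\<Sum>i\<in>UNIV. LINT z|lebesgue_on ?V. (v k z $ i)\<^sup>2) \<le> sqrt (real CARD('m) * K\<^sup>2)"
        by (intro real_sqrt_le_mono) simp
      also have "\<dots> = sqrt (real CARD('m)) * K" using K by (simp add: real_sqrt_mult)
      finally show ?thesis using N0 unfolding H_def by (intro mult_left_mono) auto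
    qed
    moreover have "AE z in lebesgue_on (\<Omega> \<inter> ball x0 (r / 2)). z \<in> \<Omega> \<inter> ball x0 (r / 2)"
      by (intro AE_I2) simp
    ultimately show ?thesis
    proof (elim AE_mp, intro AE_I2 impI)
      fix z assume "norm (v k z) \<le> ?E"
        and z: "z \<in> \<Omega> \<inter> ball x0 (r / 2)"
        and "?E \<le> H"
      moreover have "z \<in> ?V" using z r by auto
      ultimately show "norm (column k (G z y)) \<le> H" using vV[of z k] by simp
    qed
  qed
  have H_eq: "(real CARD('m))\<^sup>2 * H
      = 32 * (real CARD('m))\<^sup>2 * sqrt (real CARD('m)) * N\<^sub>0\<^sup>2 / \<nu> * r powr (2 - real CARD('n))"
  proof -
    have "r powr (2 - real CARD('n)) = r powr (- real CARD('n) / 2 + (- real CARD('n) / 2 + 2))"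
      by simp
    also have "\<dots> = r powr (- real CARD('n) / 2) * (r powr (- real CARD('n) / 2) * r\<^sup>2)"
      using r by (simp only: powr_add powr_numeral less_imp_le)
    finally show ?thesis by (simp add: H_def K_def power2_eq_square)
  qed
  have "AE z in lebesgue_on (\<Omega> \<inter> ball x0 (r / 2)). \<forall>k. norm (column k (G z y)) \<le> H"
    using col by (subst AE_all_countable) blast
  then show ?thesis
    unfolding H_eq[symmetric] by (rule eventually_mono) (rule norm_matrix_le_columns, blast)
qed

text \<open>Nearby points have comparable distances to the pole: \<open>|z - y| \<le> 5 r / 2\<close> for \<open>z\<close> within
  \<open>r / 2\<close> of \<open>x\<^sub>0\<close> and \<open>r = |x\<^sub>0 - y| / 2\<close>. This turns the local bounds into one power of \<open>|z - y|\<close>.\<close>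

lemma holds_pointwise_power_bound:
  fixes g :: "real^'n \<Rightarrow> 'b::euclidean_space" and Rmax :: ereal
  assumes n: "CARD('n) \<ge> 3" and \<Omega>: "open \<Omega>" and C0: "0 \<le> C\<^sub>0"
    and loc: "\<And>x0 r. x0 \<in> \<Omega> \<Longrightarrow> x0 \<noteq> y \<Longrightarrow> ereal (norm (x0 - y)) < Rmax \<Longrightarrow> r = norm (x0 - y) / 2 \<Longrightarrow>
      AE z in lebesgue_on (\<Omega> \<inter> ball x0 (r / 2)). norm (g z) \<le> C\<^sub>0 * r powr (2 - real CARD('n))"
  shows "holds_pointwise (\<Omega> - {y}) g (\<lambda>x M. 0 < norm (x - y) \<and> ereal (norm (x - y)) < Rmax \<longrightarrow>
    norm M \<le> C\<^sub>0 * (2 / 5) powr (2 - real CARD('n)) * norm (x - y) powr (2 - real CARD('n)))"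
proof -
  define q where "q = 2 - real CARD('n)"
  have q: "q \<le> 0" using n by (simp add: q_def)
  define b where "b z = C\<^sub>0 * (2 / 5) powr q * norm (z - y) powr q" for z
  define W where "W = {x \<in> \<Omega> - {y}. ereal (norm (x - y)) < Rmax}"
  have W_open: "open W"
  proof -
    have "open {x. ereal (norm (x - y)) < Rmax}"
      by (intro open_Collect_less continuous_intros)
    then have "open ((\<Omega> - {y}) \<inter> {x. ereal (norm (x - y)) < Rmax})"
      using \<Omega> by (intro open_Int open_Diff) auto
    moreover have "W = (\<Omega> - {y}) \<inter> {x. ereal (norm (x - y)) < Rmax}" by (auto simp: W_def)
    ultimately show ?thesis by simp
  qed
  have AE_W: "AE z in lebesgue_on W. norm (g z) \<le> b z"
  proof (rule AE_lebesgue_on_local[OF W_open])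
    fix x0 assume x0: "x0 \<in> W"
    define r where "r = norm (x0 - y) / 2"
    have x: "x0 \<in> \<Omega>" "x0 \<noteq> y" "ereal (norm (x0 - y)) < Rmax" using x0 by (auto simp: W_def)
    have r: "0 < r" using x(2) by (simp add: r_def)
    have "AE z in lebesgue_on (\<Omega> \<inter> ball x0 (r / 2)). norm (g z) \<le> C\<^sub>0 * r powr q"
      unfolding q_def by (rule loc[OF x r_def])
    then have "AE z in lebesgue_on (W \<inter> ball x0 (r / 2)). norm (g z) \<le> C\<^sub>0 * r powr q"
      by (rule AE_lebesgue_on_subset) (use W_open \<Omega> in \<open>auto simp: W_def intro: open_sets_lebesgue\<close>)
    moreover have "AE z in lebesgue_on (W \<inter> ball x0 (r / 2)). z \<in> W \<inter> ball x0 (r / 2)"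
      by (intro AE_I2) simp
    ultimately have "AE z in lebesgue_on (W \<inter> ball x0 (r / 2)). norm (g z) \<le> b z"
    proof eventually_elim
      case (elim z)
      have "norm (z - y) \<le> norm (z - x0) + norm (x0 - y)"
        using norm_triangle_ineq[of "z - x0" "x0 - y"] by simp
      moreover have "norm (z - x0) \<le> r / 2" using elim(2) by (simp add: dist_norm norm_minus_commute)
      ultimately have "2 / 5 * norm (z - y) \<le> r" by (simp add: r_def)
      moreover have "0 < 2 / 5 * norm (z - y)" using elim(2) by (simp add: W_def)
      ultimately have "r powr q \<le> (2 / 5 * norm (z - y)) powr q"
        using q by (intro powr_mono2') auto
      also have "\<dots> = (2 / 5) powr q * norm (z - y) powr q" by (rule powr_mult)
      finally have "C\<^sub>0 * r powr q \<le> b z"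
        unfolding b_def mult.assoc using C0 by (intro mult_left_mono) auto
      with elim(1) show ?case by linarith
    qed
    then show "\<exists>V. open V \<and> x0 \<in> V \<and> (AE z in lebesgue_on (W \<inter> V). norm (g z) \<le> b z)"
      using r by (intro exI[of _ "ball x0 (r / 2)"]) simp
  qed
  have sets: "W \<in> sets lebesgue" "\<Omega> - {y} \<in> sets lebesgue"
    using W_open \<Omega> by (auto intro: open_sets_lebesgue)
  have AE_W': "AE z in lebesgue. z \<in> W \<longrightarrow> norm (g z) \<le> b z"
    using AE_W sets(1) by (simp only: AE_lebesgue_on_iff)
  have "AE x in lebesgue_on (\<Omega> - {y}). 0 < norm (x - y) \<and> ereal (norm (x - y)) < Rmax \<longrightarrow> norm (g x) \<le> b x"
    unfolding AE_lebesgue_on_iff[OF sets(2)]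
    using AE_W' by (rule eventually_mono) (simp add: W_def)
  moreover have "norm (h x) \<le> b x"
    if h: "continuous_on (\<Omega> - {y}) h" "AE x in lebesgue_on (\<Omega> - {y}). h x = g x" and x: "x \<in> W" for h x
  proof (rule ccontr)
    assume contra: "\<not> norm (h x) \<le> b x"
    define T where "T = W \<inter> (\<lambda>z. norm (h z) - b z) -` {0<..}"
    have "continuous_on W (\<lambda>z. norm (h z) - b z)"
      unfolding b_def
      by (intro continuous_intros continuous_on_subset[OF h(1)]) (auto simp: W_def)
    then have "open T" unfolding T_def using W_open by (rule continuous_open_preimage) simp
    moreover have "x \<in> T" using x contra by (simp add: T_def)
    ultimately have "T \<notin> null_sets lebesgue"
      using open_not_negligible[of T] by (auto simp: negligible_iff_null_sets)
    have "AE z in lebesgue. z \<in> \<Omega> - {y} \<longrightarrow> h z = g z"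
      using h(2) by (simp only: AE_lebesgue_on_iff[OF sets(2)])
    with AE_W' have "AE z in lebesgue. z \<notin> T"
    proof eventually_elim
      case (elim z)
      show ?case
      proof
        assume z: "z \<in> T"
        then have "h z = g z" "norm (g z) \<le> b z" using elim by (auto simp: T_def W_def)
        with z show False by (simp add: T_def)
      qed
    qed
    moreover have "T \<in> sets lebesgue" using \<open>open T\<close> by (rule open_sets_lebesgue)
    ultimately have "T \<in> null_sets lebesgue" by (simp add: AE_iff_null_sets)
    with \<open>T \<notin> null_sets lebesgue\<close> show False ..
  qed
  ultimately show ?thesis
    unfolding holds_pointwise_def b_def q_def W_def by auto
qed

theorem theorem3p3:
  fixes \<nu> N\<^sub>0 :: real
  assumes "CARD('n::finite) \<ge> 3"
    and "0 < \<nu>" and "\<nu> \<le> 1" and "0 < N\<^sub>0"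
  shows "\<exists>C. \<forall>(\<Omega> :: (real^'n) set) (A :: ('n, 'm::finite) coeffs) (Rmax :: ereal)
              (G :: real^'n \<Rightarrow> real^'n \<Rightarrow> real^'m^'m).
           open \<Omega> \<longrightarrow> connected \<Omega> \<longrightarrow> \<Omega> \<noteq> {} \<longrightarrow>
           elliptic_coeffs \<nu> A \<longrightarrow>
           0 < Rmax \<longrightarrow> local_boundedness A \<Omega> Rmax N\<^sub>0 \<longrightarrow>
           green_matrix A \<Omega> G \<longrightarrow>
           (AE y in lebesgue_on \<Omega>. green_bound_at \<Omega> G Rmax C y) \<and>
           (\<forall>y\<in>\<Omega>. precise_pole \<Omega> G y \<longrightarrow> green_bound_at \<Omega> G Rmax C y)"
proof -
  define C\<^sub>0 where "C\<^sub>0 = 32 * (real CARD('m))\<^sup>2 * sqrt (real CARD('m)) * N\<^sub>0\<^sup>2 / \<nu>"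
  let ?C = "C\<^sub>0 * (2 / 5) powr (2 - real CARD('n))"
  have C0: "0 \<le> C\<^sub>0" using assms(2) by (simp add: C\<^sub>0_def)
  obtain \<D> :: "(real^'n) set set" where \<D>: "countable \<D>" "\<And>D. D \<in> \<D> \<Longrightarrow> compact D"
    "\<And>V. open V \<Longrightarrow> \<exists>D. (\<forall>k::nat. D k \<in> \<D> \<and> D k \<subseteq> V) \<and> (\<forall>x\<in>V. \<exists>k. \<forall>j\<ge>k. x \<in> D j)"
    by (rule countable_compact_exhausting_family) blast
  show ?thesis
  proof (intro exI[of _ ?C] allI impI)
    fix \<Omega> :: "(real^'n) set" and A :: "('n, 'm) coeffs" and Rmax :: ereal
      and G :: "real^'n \<Rightarrow> real^'n \<Rightarrow> real^'m^'m"
    assume \<Omega>: "open \<Omega>" and A: "elliptic_coeffs \<nu> A" and lb: "local_boundedness A \<Omega> Rmax N\<^sub>0"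
      and G: "green_matrix A \<Omega> G"
    define p where "p L i = green_potential \<Omega> G (\<lambda>x. axis i (step_fun L x))"
      for L :: "(real \<times> (real^'n) set) list" and i :: 'm
    \<comment> \<open>The only property of a pole that enters: local bounds on the potentials of the step functions
      hold at the pole itself. Almost every pole and every precise pole have it.\<close>
    have bound: "green_bound_at \<Omega> G Rmax ?C y"
      if y: "y \<in> \<Omega>" and pole: "\<And>L i s c. L \<in> lists (\<rat> \<times> {D\<in>\<D>. D \<subseteq> \<Omega> - {y}}) \<Longrightarrow> 0 < s \<Longrightarrow>
        AE z in lebesgue_on (\<Omega> \<inter> ball y s). norm (p L i z) \<le> c \<Longrightarrow> norm (p L i y) \<le> c" for y
      unfolding green_bound_at_def
    proof (rule holds_pointwise_power_bound[OF assms(1) \<Omega> C0])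
      fix x0 r assume x0: "x0 \<in> \<Omega>" "x0 \<noteq> y" "ereal (norm (x0 - y)) < Rmax" "r = norm (x0 - y) / 2"
      show "AE z in lebesgue_on (\<Omega> \<inter> ball x0 (r / 2)). norm (G z y) \<le> C\<^sub>0 * r powr (2 - real CARD('n))"
        unfolding C\<^sub>0_def
        by (rule green_matrix_local_bound[OF assms(1) \<Omega> assms(2) A lb assms(4) G \<D>(2,3) y
              pole[unfolded p_def] x0])
    qed
    let ?H = "(\<lambda>(L, i). p L i) ` (lists (\<rat> \<times> \<D>) \<times> UNIV)"
    have "countable (lists (\<rat> \<times> \<D>) \<times> (UNIV :: 'm set))"
      by (intro countable_SIGMA countable_lists countable_rat \<D>(1) countable_finite) simp
    then have "countable ?H"
      by (rule countable_image)
    then have "AE y in lebesgue_on \<Omega>. \<forall>h\<in>?H. \<forall>s c. 0 < s \<longrightarrow>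
        (AE z in lebesgue_on (\<Omega> \<inter> ball y s). norm (h z) \<le> c) \<longrightarrow> norm (h y) \<le> c"
      by (rule AE_value_le_local_AE_bound[OF \<Omega>])
    moreover have "AE y in lebesgue_on \<Omega>. y \<in> \<Omega>" by (intro AE_I2) simp
    ultimately have "AE y in lebesgue_on \<Omega>. green_bound_at \<Omega> G Rmax ?C y"
    proof eventually_elim
      case (elim y)
      show ?case
      proof (rule bound[OF elim(2)])
        fix L i and s c :: real
        assume L: "L \<in> lists (\<rat> \<times> {D\<in>\<D>. D \<subseteq> \<Omega> - {y}})" and s: "0 < s"
          and AE: "AE z in lebesgue_on (\<Omega> \<inter> ball y s). norm (p L i z) \<le> c"
        have "L \<in> lists (\<rat> \<times> \<D>)" using L by (auto simp: lists_eq_set)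
        then have "p L i \<in> ?H"
          by (intro image_eqI[of _ _ "(L, i)"]) auto
        with elim(1) s AE show "norm (p L i y) \<le> c" by blast
      qed
    qed
    moreover have "green_bound_at \<Omega> G Rmax ?C y"
      if y: "y \<in> \<Omega>" and precise: "precise_pole \<Omega> G y" for y
    proof (rule bound[OF y])
      fix L i and s c :: real
      assume L: "L \<in> lists (\<rat> \<times> {D\<in>\<D>. D \<subseteq> \<Omega> - {y}})" and s: "0 < s"
        and AE: "AE z in lebesgue_on (\<Omega> \<inter> ball y s). norm (p L i z) \<le> c"
      obtain K where K: "compact K" "K \<subseteq> \<Omega> - {y}" "\<forall>x. x \<notin> K \<longrightarrow> step_fun L x = 0"
        using step_fun_compact_support[OF \<D>(2) L] by blast
      have zero: "axis i (step_fun L x) = (0 :: real^'m)" if "x \<notin> K" for x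
        using K(3) that by simp
      show "norm (p L i y) \<le> c"
        unfolding p_def
        by (rule precise_pole_value_le_local_AE_bound[OF \<Omega> y precise
              step_fun_spaces(2)[OF \<D>(2) L Diff_subset \<Omega>] K(1,2) zero s AE[unfolded p_def]])
    qed
    ultimately show "(AE y in lebesgue_on \<Omega>. green_bound_at \<Omega> G Rmax ?C y) \<and>
        (\<forall>y\<in>\<Omega>. precise_pole \<Omega> G y \<longrightarrow> green_bound_at \<Omega> G Rmax ?C y)"
      by blast
  qed
qed

end
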